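(* Let $L$ be a relational language and let $\mathcal{S} = (S, L^S)$ be a countable monomorphic $L$-structure. Then $\mathrm{spec}(\mathcal{S})$ is finite if and only if there exists a linear order $<$ on $S$ which chains $\mathcal{S}$ and such that $\mathrm{spec}(S, <)$ is finite.
   Context: A relational language $L$ is a set (possibly infinite) of relation symbols with finite arities. For $L$-structures $\mathcal{A}$, $\mathcal{B}$, an embedding $f : \mathcal{A} \hookrightarrow \mathcal{B}$ is an injective map with $R^{A}(a_1,\ldots,a_h) \Leftrightarrow R^{B}(f(a_1),\ldots,f(a_h))$ for all $R \in L$ (of arity $h$) and all $a_1,\ldots,a_h \in A$; $\mathrm{Emb}(\mathcal{A},\mathcal{B})$ is the set of all embeddings. Substructures are induced substructures. Big Ramsey degrees: $T(\mathcal{A},\mathcal{C})$ is the least positive integer $t$ such that for every positive integer $k$ and every coloring $\chi : \mathrm{Emb}(\mathcal{A},\mathcal{C}) \to \{0,\ldots,k-1\}$ there is a $w \in \mathrm{Emb}(\mathcal{C},\mathcal{C})$ with $|\chi(w \circ \mathrm{Emb}(\mathcal{A},\mathcal{C}))| \le t$; if no such $t$ exists, $T(\mathcal{A},\mathcal{C}) = \infty$. An infinite relational structure $\mathcal{S}$ is monomorphic if for each $n \ge 1$ all its $n$-element substructures are isomorphic; let $\mathcal{A}_n$ be the $n$-element substructure (unique up to isomorphism). Then $\mathrm{spec}(\mathcal{S}) = (T(\mathcal{A}_1,\mathcal{S}), T(\mathcal{A}_2,\mathcal{S}), \ldots)$, and "$\mathrm{spec}(\mathcal{S})$ is finite" means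 $T(\mathcal{A}_n,\mathcal{S}) < \infty$ for all $n \ge 1$. A chain (linearly ordered set) $\mathcal{C}$ is regarded as a structure with one binary relation, and $\mathrm{spec}(\mathcal{C}) = (T(1,\mathcal{C}), T(2,\mathcal{C}),\ldots)$, where $n$ denotes the $n$-element chain; $\mathrm{spec}(\mathcal{C})$ is finite if $T(n,\mathcal{C}) < \infty$ for all $n \ge 1$. A linear order $<$ on $S$ chains $\mathcal{S} = (S, L^S)$ if $\mathcal{S}$ is quantifier-free definable in $(S,<)$: for every $R \in L$ of arity $h$ there is a quantifier-free formula $\varphi_R(x_1,\ldots,x_h)$ in the language $\{<\}$ (with equality) such that $\mathcal{S} \models R[a_1,\ldots,a_h]$ iff $(S,<) \models \varphi_R[a_1,\ldots,a_h]$ for all $a_1,\ldots,a_h \in S$. *)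

theory Defs
  imports Main "HOL-Library.FuncSet" "HOL-Library.Countable_Set" "HOL-Library.Extended_Nat"
begin

section \<open>Relational structures\<close>

text \<open>A relational language is a set \<open>L\<close> of symbols (possibly empty or infinite) together with
  an arity function \<open>ar\<close>; tuples are lists.\<close>

record ('r, 'a) rel_struct =
  universe :: "'a set"
  interp :: "'r \<Rightarrow> 'a list set"

definition tuples :: "nat \<Rightarrow> 'a set \<Rightarrow> 'a list set" where
  "tuples h A = {xs. length xs = h \<and> set xs \<subseteq> A}"

definition is_structure :: "'r set \<Rightarrow> ('r \<Rightarrow> nat) \<Rightarrow> ('r, 'a) rel_struct \<Rightarrow> bool" where
  "is_structure L ar \<A> \<longleftrightarrow> (\<forall>R\<in>L. interp \<A> R \<subseteq> tuples (ar R) (universe \<A>))"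

text \<open>Embeddings are extensional functions, so that two maps agreeing on the universe of the
  source are the same embedding; they are composed with \<^const>\<open>compose\<close>.\<close>

definition Emb :: "'r set \<Rightarrow> ('r \<Rightarrow> nat) \<Rightarrow> ('r, 'a) rel_struct \<Rightarrow> ('r, 'b) rel_struct \<Rightarrow> ('a \<Rightarrow> 'b) set"
  where
  "Emb L ar \<A> \<B> = {f \<in> universe \<A> \<rightarrow>\<^sub>E universe \<B>. inj_on f (universe \<A>) \<and>
     (\<forall>R\<in>L. \<forall>xs\<in>tuples (ar R) (universe \<A>). xs \<in> interp \<A> R \<longleftrightarrow> map f xs \<in> interp \<B> R)}"

definition isomorphic :: "'r set \<Rightarrow> ('r \<Rightarrow> nat) \<Rightarrow> ('r, 'a) rel_struct \<Rightarrow> ('r, 'b) rel_struct \<Rightarrow> bool"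
  where
  "isomorphic L ar \<A> \<B> \<longleftrightarrow> (\<exists>f\<in>Emb L ar \<A> \<B>. f ` universe \<A> = universe \<B>)"

definition substructure_on :: "('r, 'a) rel_struct \<Rightarrow> 'a set \<Rightarrow> ('r, 'a) rel_struct" where
  "substructure_on \<S> A = \<lparr>universe = A, interp = (\<lambda>R. interp \<S> R \<inter> lists A)\<rparr>"

section \<open>Big Ramsey degrees and spectra\<close>

definition ramsey_bound ::
    "'r set \<Rightarrow> ('r \<Rightarrow> nat) \<Rightarrow> ('r, 'a) rel_struct \<Rightarrow> ('r, 'b) rel_struct \<Rightarrow> nat \<Rightarrow> bool" where
  "ramsey_bound L ar \<A> \<C> t \<longleftrightarrow>
     (\<forall>k::nat. \<forall>\<chi> :: ('a \<Rightarrow> 'b) \<Rightarrow> nat. k > 0 \<longrightarrow> \<chi> \<in> Emb L ar \<A> \<C> \<rightarrow> {..<k} \<longrightarrow>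
       (\<exists>w\<in>Emb L ar \<C> \<C>. card (\<chi> ` (compose (universe \<A>) w ` Emb L ar \<A> \<C>)) \<le> t))"

definition big_ramsey_degree ::
    "'r set \<Rightarrow> ('r \<Rightarrow> nat) \<Rightarrow> ('r, 'a) rel_struct \<Rightarrow> ('r, 'b) rel_struct \<Rightarrow> enat" where
  "big_ramsey_degree L ar \<A> \<C> =
     (if \<exists>t>0. ramsey_bound L ar \<A> \<C> t
      then enat (LEAST t. t > 0 \<and> ramsey_bound L ar \<A> \<C> t) else \<infinity>)"

definition nsubsets :: "'a set \<Rightarrow> nat \<Rightarrow> 'a set set" where
  "nsubsets S n = {A. A \<subseteq> S \<and> finite A \<and> card A = n}"

definition monomorphic :: "'r set \<Rightarrow> ('r \<Rightarrow> nat) \<Rightarrow> ('r, 'a) rel_struct \<Rightarrow> bool" where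
  "monomorphic L ar \<S> \<longleftrightarrow> infinite (universe \<S>) \<and>
     (\<forall>n\<ge>1. \<forall>A\<in>nsubsets (universe \<S>) n. \<forall>B\<in>nsubsets (universe \<S>) n.
        isomorphic L ar (substructure_on \<S> A) (substructure_on \<S> B))"

text \<open>For monomorphic \<open>\<S>\<close> the substructure chosen here is unique up to isomorphism. Only the
  entries with \<open>n \<ge> 1\<close> belong to the spectrum.\<close>

definition nth_substructure :: "('r, 'a) rel_struct \<Rightarrow> nat \<Rightarrow> ('r, 'a) rel_struct" where
  "nth_substructure \<S> n = substructure_on \<S> (SOME A. A \<in> nsubsets (universe \<S>) n)"

definition spec :: "'r set \<Rightarrow> ('r \<Rightarrow> nat) \<Rightarrow> ('r, 'a) rel_struct \<Rightarrow> nat \<Rightarrow> enat" where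
  "spec L ar \<S> n = big_ramsey_degree L ar (nth_substructure \<S> n) \<S>"

definition finite_spec :: "(nat \<Rightarrow> enat) \<Rightarrow> bool" where
  "finite_spec s \<longleftrightarrow> (\<forall>n\<ge>1. s n < \<infinity>)"

section \<open>Chains\<close>

definition linear_order_of :: "'a set \<Rightarrow> 'a rel \<Rightarrow> bool" where
  "linear_order_of S lt \<longleftrightarrow> lt \<subseteq> S \<times> S \<and> strict_linear_order_on S lt"

text \<open>A chain is a structure over the language whose only symbol, \<open>()\<close>, is binary and is
  interpreted by the strict order.\<close>

definition chain_struct :: "'a set \<Rightarrow> 'a rel \<Rightarrow> (unit, 'a) rel_struct" where
  "chain_struct S lt = \<lparr>universe = S, interp = (\<lambda>_. {[x, y] | x y. (x, y) \<in> lt})\<rparr>"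

definition finite_chain :: "nat \<Rightarrow> (unit, nat) rel_struct" where
  "finite_chain n = chain_struct {..<n} {(i, j). i < j \<and> j < n}"

definition chain_spec :: "'a set \<Rightarrow> 'a rel \<Rightarrow> nat \<Rightarrow> enat" where
  "chain_spec S lt n = big_ramsey_degree {()} (\<lambda>_. 2) (finite_chain n) (chain_struct S lt)"

section \<open>Chainability\<close>

text \<open>Quantifier-free formulas over \<open>{<}\<close> with equality. The variables of a formula
  \<open>\<phi>(x\<^sub>1, \<dots>, x\<^sub>h)\<close> are numbered from \<open>0\<close> to \<open>h - 1\<close> and evaluated by the entries of a
  list of length \<open>h\<close>. The constant \<open>QFalse\<close> matters only for \<open>h = 0\<close>.\<close>

datatype qf = QFalse | QLess nat nat | QEq nat nat | QNot qf | QAnd qf qf | QOr qf qf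

primrec qf_vars :: "qf \<Rightarrow> nat set" where
  "qf_vars QFalse = {}"
| "qf_vars (QLess i j) = {i, j}"
| "qf_vars (QEq i j) = {i, j}"
| "qf_vars (QNot \<phi>) = qf_vars \<phi>"
| "qf_vars (QAnd \<phi> \<psi>) = qf_vars \<phi> \<union> qf_vars \<psi>"
| "qf_vars (QOr \<phi> \<psi>) = qf_vars \<phi> \<union> qf_vars \<psi>"

primrec qf_sat :: "'a rel \<Rightarrow> 'a list \<Rightarrow> qf \<Rightarrow> bool" where
  "qf_sat lt xs QFalse \<longleftrightarrow> False"
| "qf_sat lt xs (QLess i j) \<longleftrightarrow> (xs ! i, xs ! j) \<in> lt"
| "qf_sat lt xs (QEq i j) \<longleftrightarrow> xs ! i = xs ! j"
| "qf_sat lt xs (QNot \<phi>) \<longleftrightarrow> \<not> qf_sat lt xs \<phi>"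
| "qf_sat lt xs (QAnd \<phi> \<psi>) \<longleftrightarrow> qf_sat lt xs \<phi> \<and> qf_sat lt xs \<psi>"
| "qf_sat lt xs (QOr \<phi> \<psi>) \<longleftrightarrow> qf_sat lt xs \<phi> \<or> qf_sat lt xs \<psi>"

definition chains_struct :: "'r set \<Rightarrow> ('r \<Rightarrow> nat) \<Rightarrow> 'a rel \<Rightarrow> ('r, 'a) rel_struct \<Rightarrow> bool" where
  "chains_struct L ar lt \<S> \<longleftrightarrow>
     (\<forall>R\<in>L. \<exists>\<phi>. qf_vars \<phi> \<subseteq> {..<ar R} \<and>
        (\<forall>xs\<in>tuples (ar R) (universe \<S>). xs \<in> interp \<S> R \<longleftrightarrow> qf_sat lt xs \<phi>))"

end

theory Submission
  imports Defs "HOL-Analysis.Analysis" "HOL-Library.Ramsey"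
begin

text \<open>
  If a chain \<open>(S, <)\<close> with finite spectrum chains \<open>\<S>\<close>, then the self-embeddings of the chain are
  self-embeddings of \<open>\<S>\<close>, and the embeddings of an \<open>n\<close>-element substructure with a given image
  correspond to one embedding of the \<open>n\<close>-chain, up to at most \<open>n ^ n\<close> choices.

  Conversely, by Fraisse's theorem \<open>\<S>\<close> is chainable by fixed formulas \<open>\<phi>\<close>. The set \<open>X\<close> of all orders
  chaining \<open>\<S>\<close> by \<open>\<phi>\<close> is compact, and the self-embeddings \<open>w\<close> of \<open>\<S>\<close> act on it by pullback. If
  \<open><\<close> in \<open>X\<close> is recurrent, that is, if every \<open>w\<close> has a \<open>u\<close> such that \<open>w \<circ> u\<close> preserves \<open><\<close>, then
  \<open>T(n, (S, <)) \<le> T(\<A>\<^sub>n, \<S>)\<close>. A recurrent order exists: if all transpositions of neighbours are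
  harmless, then \<open>X\<close> contains an order of type \<open>\<omega>\<close>. Otherwise two orders in \<open>X\<close> that agree on a
  large finite set differ by a rotation or by finitely many inversions near the ends, so that an
  order with countably many cuts has a countable neighbourhood. Take a minimal closed invariant
  subset \<open>K\<close> of \<open>X\<close>. Either all its members have uncountably many cuts; then every countable order
  embeds in each of them. Or \<open>K\<close> has an isolated point by Baire's theorem, which every orbit,
  being dense in \<open>K\<close>, must hit.
\<close>

section \<open>Minimal invariant sets\<close>

lemma minimal_closed_invariant:
  fixes X :: "'t::topological_space set" and M :: "('t \<Rightarrow> 't) set"
  assumes "compact X" "closed X" "X \<noteq> {}" "\<And>g. g \<in> M \<Longrightarrow> g ` X \<subseteq> X"
  obtains K where "K \<subseteq> X" "closed K" "K \<noteq> {}" "\<forall>g\<in>M. g ` K \<subseteq> K"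
    "\<forall>K'. K' \<subseteq> K \<and> closed K' \<and> K' \<noteq> {} \<and> (\<forall>g\<in>M. g ` K' \<subseteq> K') \<longrightarrow> K' = K"
proof -
  define \<K> where "\<K> = {K. K \<subseteq> X \<and> closed K \<and> K \<noteq> {} \<and> (\<forall>g\<in>M. g ` K \<subseteq> K)}"
  have chain: "\<Inter>\<C> \<in> \<K>" if ne: "\<C> \<noteq> {}" and sub: "\<C> \<subseteq> \<K>"
      and ch: "\<And>A B. A \<in> \<C> \<Longrightarrow> B \<in> \<C> \<Longrightarrow> A \<subseteq> B \<or> B \<subseteq> A" for \<C>
  proof -
    have "X \<inter> \<Inter>\<C> \<noteq> {}"
    proof (rule compact_imp_fip[OF assms(1)])
      show "closed T" if "T \<in> \<C>" for T using that sub by (auto simp: \<K>_def)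
    next
      fix \<F> assume fin: "finite \<F>" and F: "\<F> \<subseteq> \<C>"
      show "X \<inter> \<Inter>\<F> \<noteq> {}"
      proof (cases "\<F> = {}")
        case False
        have "\<Inter>\<F> \<in> \<F>"
          using fin False F
        proof (induction rule: finite_ne_induct)
          case (insert A \<F>)
          then have "A \<subseteq> \<Inter>\<F> \<or> \<Inter>\<F> \<subseteq> A" using ch[of A "\<Inter>\<F>"] by blast
          with insert show ?case by (auto simp: Int_absorb1 Int_absorb2)
        qed auto
        then have "\<Inter>\<F> \<in> \<K>" using F sub by blast
        then show ?thesis by (auto simp: \<K>_def)
      qed (use assms in auto)
    qed
    moreover have "\<Inter>\<C> \<subseteq> X" using ne sub unfolding \<K>_def by blast
    moreover have "closed (\<Inter>\<C>)" using sub by (auto simp: \<K>_def)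
    moreover have "g ` \<Inter>\<C> \<subseteq> \<Inter>\<C>" if "g \<in> M" for g
    proof
      fix y assume "y \<in> g ` \<Inter>\<C>"
      then obtain x where x: "x \<in> \<Inter>\<C>" "y = g x" by blast
      show "y \<in> \<Inter>\<C>"
      proof
        fix K assume "K \<in> \<C>"
        then have "x \<in> K" "K \<in> \<K>" using x sub by auto
        then have "g ` K \<subseteq> K" using that by (simp add: \<K>_def)
        with \<open>x \<in> K\<close> have "g x \<in> K" by blast
        then show "y \<in> K" using x by simp
      qed
    qed
    ultimately show ?thesis by (auto simp: \<K>_def)
  qed
  define \<U> where "\<U> = {U. - U \<in> \<K>}"
  have "\<exists>U\<in>\<U>. \<forall>V\<in>\<U>. U \<subseteq> V \<longrightarrow> V = U"
  proof (rule subset_Zorn_nonempty)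
    have "X \<in> \<K>" using assms by (simp add: \<K>_def)
    then have "- X \<in> \<U>" by (simp add: \<U>_def)
    then show "\<U> \<noteq> {}" by blast
  next
    fix \<C> assume ne: "\<C> \<noteq> {}" and "subset.chain \<U> \<C>"
    then have sub: "\<C> \<subseteq> \<U>" and ch: "\<And>A B. A \<in> \<C> \<Longrightarrow> B \<in> \<C> \<Longrightarrow> A \<subseteq> B \<or> B \<subseteq> A"
      unfolding subset.chain_def by blast+
    have "\<Inter>(uminus ` \<C>) \<in> \<K>"
    proof (rule chain)
      show "uminus ` \<C> \<noteq> {}" using ne by simp
      show "uminus ` \<C> \<subseteq> \<K>" using sub unfolding \<U>_def image_subset_iff by blast
      fix A B assume "A \<in> uminus ` \<C>" "B \<in> uminus ` \<C>"
      then show "A \<subseteq> B \<or> B \<subseteq> A" by (elim imageE) (use ch in blast)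
    qed
    moreover have "\<Inter>(uminus ` \<C>) = - \<Union>\<C>" by blast
    ultimately show "\<Union>\<C> \<in> \<U>" by (simp add: \<U>_def)
  qed
  then obtain U where U: "U \<in> \<U>" and max: "\<And>V. V \<in> \<U> \<Longrightarrow> U \<subseteq> V \<Longrightarrow> V = U"
    by blast
  define K where "K = - U"
  have K: "K \<in> \<K>" using U by (simp add: K_def \<U>_def)
  have min: "K' = K" if "K' \<in> \<K>" "K' \<subseteq> K" for K'
  proof -
    have "- K' \<in> \<U>" using that by (simp add: \<U>_def)
    moreover have "U \<subseteq> - K'" using that by (auto simp: K_def)
    ultimately show ?thesis using max[of "- K'"] unfolding K_def by blast
  qed
  show thesis
  proof (rule that)
    show "\<forall>K'. K' \<subseteq> K \<and> closed K' \<and> K' \<noteq> {} \<and> (\<forall>g\<in>M. g ` K' \<subseteq> K') \<longrightarrow> K' = K"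
    proof (intro allI impI, elim conjE)
      fix K' assume *: "K' \<subseteq> K" "closed K'" "K' \<noteq> {}" "\<forall>g\<in>M. g ` K' \<subseteq> K'"
      have "K' \<subseteq> X" using *(1) K by (auto simp: \<K>_def)
      then have "K' \<in> \<K>" using *(2-4) by (simp add: \<K>_def)
      then show "K' = K" using *(1) by (rule min)
    qed
  qed (use K in \<open>simp_all add: \<K>_def\<close>)
qed

lemma countable_nbhd_has_isolated_point:
  fixes K :: "'t::topological_space set"
  assumes "Hausdorff_space (euclidean :: 't topology)" "compact K" "open U"
    and "countable (U \<inter> K)" "U \<inter> K \<noteq> {}"
  obtains x V where "open V" "V \<inter> K = {x}"
proof -
  let ?X = "subtopology euclidean K"
  have "compact_space ?X" using assms(2) by (simp add: compact_space_subtopology)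
  moreover have "Hausdorff_space ?X" using assms(1) by (simp add: Hausdorff_space_subtopology)
  ultimately have reg: "locally_compact_space ?X \<and> regular_space ?X"
    by (simp add: compact_Hausdorff_imp_regular_space compact_imp_locally_compact_space)
  let ?G = "(\<lambda>x. {x}) ` (U \<inter> K)"
  have UG: "\<Union>?G = U \<inter> K" by auto
  have "openin ?X (U \<inter> K)" using assms(3) by (auto simp: openin_subtopology)
  then have ne: "?X interior_of (\<Union>?G) \<noteq> {}"
    unfolding UG using assms(5) by (simp add: interior_of_openin)
  have "\<exists>x\<in>U \<inter> K. ?X interior_of {x} \<noteq> {}"
  proof (rule ccontr)
    assume *: "\<not> ?thesis"
    have "?X interior_of \<Union>?G = {}"
    proof (rule Baire_category_alt)
      show "countable ?G" using assms(4) by simp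
      show "closedin ?X T \<and> ?X interior_of T = {}" if "T \<in> ?G" for T
        using that * \<open>Hausdorff_space ?X\<close> by (auto simp: closedin_Hausdorff_sing_eq)
    qed (use reg in simp)
    with ne show False by simp
  qed
  then obtain x where x: "x \<in> K" "?X interior_of {x} \<noteq> {}" by blast
  have "?X interior_of {x} \<subseteq> {x}" by (rule interior_of_subset)
  with x(2) have eq: "?X interior_of {x} = {x}" by blast
  have "openin ?X {x}" using openin_interior_of[of ?X "{x}"] unfolding eq .
  then obtain V where "open V" "{x} = K \<inter> V" unfolding openin_open by blast
  then show thesis using that[of V x] by (simp add: Int_commute)
qed

text \<open>In a minimal closed invariant set \<open>K\<close> every orbit is dense, so it hits an isolated point.\<close>

lemma isolated_point_recurrent:
  fixes K :: "'t::topological_space set" and M :: "('t \<Rightarrow> 't) set"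
  assumes cl: "closed K" and inv: "\<forall>g\<in>M. g ` K \<subseteq> K"
    and min: "\<forall>K'. K' \<subseteq> K \<and> closed K' \<and> K' \<noteq> {} \<and> (\<forall>g\<in>M. g ` K' \<subseteq> K') \<longrightarrow> K' = K"
    and cont: "\<forall>g\<in>M. continuous_on UNIV g"
    and comp: "\<forall>g\<in>M. \<forall>h\<in>M. \<exists>f\<in>M. \<forall>y\<in>K. f y = g (h y)"
    and V: "open V" "V \<inter> K = {x}" and g: "g \<in> M"
  shows "\<exists>h\<in>M. h (g x) = x"
proof -
  let ?O = "(\<lambda>h. h (g x)) ` M"
  have xK: "x \<in> K" using V by auto
  then have gxK: "g x \<in> K" using inv g by blast
  then have OK: "?O \<subseteq> K" using inv by blast
  have "closure ?O = K"
  proof (rule min[rule_format], intro conjI ballI)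
    show "closure ?O \<subseteq> K" using OK cl by (rule closure_minimal)
    show "closure ?O \<noteq> {}" using g by auto
    fix f assume f: "f \<in> M"
    have "f ` ?O \<subseteq> ?O"
    proof
      fix y assume "y \<in> f ` ?O"
      then obtain h where h: "h \<in> M" "y = f (h (g x))" by auto
      obtain f' where "f' \<in> M" "\<forall>y\<in>K. f' y = f (h y)" using comp f h(1) by blast
      then show "y \<in> ?O" using h gxK by (metis imageI)
    qed
    then have "f ` closure ?O \<subseteq> closure ?O"
      using image_closure_subset[of ?O f "closure ?O"] continuous_on_subset[OF bspec[OF cont f]]
        closure_subset[of ?O] by auto
    then show "f ` closure ?O \<subseteq> closure ?O" .
  qed auto
  then have "V \<inter> ?O \<noteq> {}" using V xK open_Int_closure_eq_empty[of V ?O] by blast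
  then obtain h where "h \<in> M" "h (g x) \<in> V" by blast
  moreover have "h (g x) \<in> K" using OK \<open>h \<in> M\<close> by blast
  ultimately have "h (g x) = x" using V by blast
  with \<open>h \<in> M\<close> show ?thesis by blast
qed

lemma Hausdorff_space_fun:
  "Hausdorff_space (euclidean :: ('i \<Rightarrow> 'b::t2_space) topology)"
proof -
  have "Hausdorff_space (product_topology (\<lambda>i::'i. euclidean :: 'b topology) UNIV)"
    unfolding Hausdorff_space_product_topology
    by (auto simp: Hausdorff_space_def disjnt_def) (metis hausdorff)
  then show ?thesis unfolding euclidean_product_topology .
qed

lemma compact_UNIV_bool_fun: "compact (UNIV :: ('i \<Rightarrow> bool) set)"
proof -
  have "compact_space (product_topology (\<lambda>i::'i. euclidean :: bool topology) UNIV)"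
    unfolding compact_space_product_topology
    by (metis compact_space_def compactin_euclidean_iff finite_class.finite_UNIV finite_imp_compact topspace_euclidean)
  then show ?thesis unfolding euclidean_product_topology
    by (metis compact_space_def compactin_euclidean_iff topspace_euclidean)
qed

lemma clopen_coordinate:
  fixes c :: 'i shows "open {f. f c}" "closed {f. f c}" "open {f. \<not> f c}" "closed {f. \<not> f c}"
proof -
  have *: "open ((\<lambda>f::'i \<Rightarrow> bool. f c) -` B)" for B
    by (rule open_vimage) (auto simp: open_discrete)
  show 1: "open {f::'i \<Rightarrow> bool. f c}" using *[of "{True}"] by (simp add: vimage_def)
  show 2: "open {f::'i \<Rightarrow> bool. \<not> f c}" using *[of "{False}"] by (simp add: vimage_def)
  show "closed {f::'i \<Rightarrow> bool. f c}" using 2 by (simp add: closed_def Collect_neg_eq)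
  show "closed {f::'i \<Rightarrow> bool. \<not> f c}" using 1 by (simp add: closed_def Collect_neg_eq)
qed

section \<open>Finite increasing sequences in linear orders\<close>

abbreviation inc :: "'a rel \<Rightarrow> 'a list \<Rightarrow> bool" where
  "inc lt \<equiv> sorted_wrt (\<lambda>x y. (x, y) \<in> lt)"

lemma linear_order_ofD:
  assumes "linear_order_of S lt"
  shows "(x, y) \<in> lt \<Longrightarrow> x \<in> S" "(x, y) \<in> lt \<Longrightarrow> y \<in> S"
    "(x, x) \<notin> lt" "(x, y) \<in> lt \<Longrightarrow> (y, z) \<in> lt \<Longrightarrow> (x, z) \<in> lt"
    "(x, y) \<in> lt \<Longrightarrow> (y, x) \<notin> lt"
    "x \<in> S \<Longrightarrow> y \<in> S \<Longrightarrow> x \<noteq> y \<Longrightarrow> (x, y) \<in> lt \<or> (y, x) \<in> lt"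
    "x \<in> S \<Longrightarrow> y \<in> S \<Longrightarrow> (x, y) \<notin> lt \<Longrightarrow> x = y \<or> (y, x) \<in> lt"
  using assms unfolding linear_order_of_def strict_linear_order_on_def
  by (auto simp: irrefl_def total_on_def elim: transE)

lemma linear_order_of_converse:
  "linear_order_of S lt \<Longrightarrow> linear_order_of S (lt\<inverse>)"
  unfolding linear_order_of_def strict_linear_order_on_def by auto

lemma inc_converse: "inc (lt\<inverse>) xs \<longleftrightarrow> inc lt (rev xs)"
  by (simp add: sorted_wrt_rev)

lemma inc_distinct: "linear_order_of S lt \<Longrightarrow> inc lt xs \<Longrightarrow> distinct xs"
  by (induction xs) (auto dest: linear_order_ofD(3))

lemma inc_insert_split:
  assumes lin: "linear_order_of S lt" and "inc lt fs" "set fs \<subseteq> S" "x \<in> S" "x \<notin> set fs"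
  shows "\<exists>us ds. fs = us @ ds \<and> inc lt (us @ x # ds)"
  using assms(2-)
proof (induction fs)
  case (Cons f fs)
  show ?case
  proof (cases "(x, f) \<in> lt")
    case True
    then have "inc lt ([] @ x # f # fs)" using Cons.prems linear_order_ofD(4)[OF lin True] by auto
    then show ?thesis by blast
  next
    case False
    then have "(f, x) \<in> lt" using linear_order_ofD(7)[OF lin] Cons.prems by auto
    moreover obtain us ds where "fs = us @ ds" "inc lt (us @ x # ds)" using Cons by auto
    ultimately have "f # fs = (f # us) @ ds \<and> inc lt ((f # us) @ x # ds)"
      using Cons.prems by auto
    then show ?thesis by blast
  qed
qed auto

lemma inc_exists:
  assumes lin: "linear_order_of S lt" and "finite F" "F \<subseteq> S"
  shows "\<exists>xs. inc lt xs \<and> set xs = F"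
  using assms(2,3)
proof (induction F)
  case (insert x F)
  then obtain fs where fs: "inc lt fs" "set fs = F" by auto
  then obtain us ds where "fs = us @ ds" "inc lt (us @ x # ds)"
    using inc_insert_split[OF lin, of fs x] insert by auto
  then show ?case using fs by (intro exI[of _ "us @ x # ds"]) auto
qed auto

lemma inc_unique:
  assumes lin: "linear_order_of S lt" and "inc lt xs" "inc lt ys" "set xs = set ys"
  shows "xs = ys"
  using assms(2-)
proof (induction xs arbitrary: ys)
  case (Cons x xs)
  then obtain y ys' where ys: "ys = y # ys'" by (cases ys) auto
  have "x \<in> set ys" "y \<in> set (x # xs)" using Cons.prems unfolding ys by auto
  then have "x = y" using Cons.prems linear_order_ofD(5)[OF lin, of x y] unfolding ys by auto
  moreover have "x \<notin> set xs" "y \<notin> set ys'"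
    using Cons.prems linear_order_ofD(3)[OF lin] unfolding ys by auto
  ultimately have "set xs = set ys'" using Cons.prems unfolding ys by auto
  then show ?case using Cons \<open>x = y\<close> unfolding ys by auto
qed auto

definition below_count :: "'a rel \<Rightarrow> 'a set \<Rightarrow> 'a \<Rightarrow> nat" where
  "below_count lt F x = card {f \<in> F. (f, x) \<in> lt}"

lemma inc_below:
  assumes lin: "linear_order_of S lt" and "inc lt (us @ x # ds)" "set us \<union> set ds = F"
  shows "{f \<in> F. (f, x) \<in> lt} = set us" "below_count lt F x = length us"
proof -
  show *: "{f \<in> F. (f, x) \<in> lt} = set us"
    using assms linear_order_ofD(5)[OF lin] by (auto simp: sorted_wrt_append)
  have "distinct us" using inc_distinct[OF lin assms(2)] by simp
  then show "below_count lt F x = length us"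
    unfolding below_count_def * by (rule distinct_card)
qed

lemma inc_insert_below:
  assumes lin: "linear_order_of S lt" and "inc lt fs" "set fs \<subseteq> S" "x \<in> S" "x \<notin> set fs"
  shows "inc lt (take (below_count lt (set fs) x) fs @ x # drop (below_count lt (set fs) x) fs)"
    "{f \<in> set fs. (f, x) \<in> lt} = set (take (below_count lt (set fs) x) fs)"
    "below_count lt (set fs) x \<le> length fs"
proof -
  obtain us ds where *: "fs = us @ ds" "inc lt (us @ x # ds)"
    using inc_insert_split[OF assms] by blast
  have "set us \<union> set ds = set fs" by (simp add: *)
  note b = inc_below[OF lin *(2) this]
  show "inc lt (take (below_count lt (set fs) x) fs @ x # drop (below_count lt (set fs) x) fs)"
    "{f \<in> set fs. (f, x) \<in> lt} = set (take (below_count lt (set fs) x) fs)"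
    "below_count lt (set fs) x \<le> length fs"
    using *(2) b(1) unfolding b(2) by (simp_all add: *(1))
qed

section \<open>Rearrangements of finite sequences\<close>

text \<open>\<open>E xs ys\<close> abstracts from the statement that enumerating the same finite set increasingly as
  \<open>xs\<close> or as \<open>ys\<close> yields the same structure.\<close>

locale pattern_equiv =
  fixes E :: "'a list \<Rightarrow> 'a list \<Rightarrow> bool"
  assumes infinite_UNIV: "infinite (UNIV :: 'a set)"
    and E_sym: "E xs ys \<Longrightarrow> E ys xs"
    and E_trans: "E xs ys \<Longrightarrow> E ys zs \<Longrightarrow> E xs zs"
    and E_map: "E xs ys \<Longrightarrow> inj_on f (set xs \<union> set ys) \<Longrightarrow> E (map f xs) (map f ys)"
    and E_filter: "E xs ys \<Longrightarrow> E (filter P xs) (filter P ys)"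
    and E_refl: "E xs xs"
begin

definition cyc :: "nat \<Rightarrow> nat \<Rightarrow> nat \<Rightarrow> bool" where
  "cyc i c j \<longleftrightarrow> (\<forall>us x cs vs. length us = i \<and> length cs = c \<and> length vs = j \<and>
     distinct (us @ x # cs @ vs) \<longrightarrow> E (us @ x # cs @ vs) (us @ cs @ x # vs))"

lemma cycD: "cyc i c j \<Longrightarrow> length us = i \<Longrightarrow> length cs = c \<Longrightarrow> length vs = j \<Longrightarrow>
    distinct (us @ x # cs @ vs) \<Longrightarrow> E (us @ x # cs @ vs) (us @ cs @ x # vs)"
  unfolding cyc_def by blast

lemma cycI:
  assumes "E (us @ x # cs @ vs) (us @ cs @ x # vs)" "distinct (us @ x # cs @ vs)"
  shows "cyc (length us) (length cs) (length vs)"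
  unfolding cyc_def
proof (intro allI impI, elim conjE)
  fix us' cs' vs' :: "'a list" and x' :: 'a
  assume len: "length us' = length us" "length cs' = length cs" "length vs' = length vs"
    and dist: "distinct (us' @ x' # cs' @ vs')"
  let ?xs = "us @ x # cs @ vs" and ?ys = "us' @ x' # cs' @ vs'"
  define f where "f a = the (map_of (zip ?xs ?ys) a)" for a
  have "map f ?xs = ?ys"
  proof (rule nth_equalityI)
    show "length (map f ?xs) = length ?ys" using len by simp
    show "map f ?xs ! i = ?ys ! i" if i: "i < length (map f ?xs)" for i
    proof -
      have "map_of (zip ?xs ?ys) (?xs ! i) = Some (?ys ! i)"
        by (rule map_of_zip_nth) (use assms len i in auto)
      then show ?thesis using i by (simp only: f_def nth_map length_map option.sel)
    qed
  qed
  then have m: "map f us = us'" "f x = x'" "map f cs = cs'" "map f vs = vs'"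
    using len by (auto simp: append_eq_append_conv)
  have "inj_on f (set ?xs)"
    using dist \<open>map f ?xs = ?ys\<close> by (metis distinct_map)
  then have "inj_on f (set ?xs \<union> set (us @ cs @ x # vs))" by (simp add: insert_commute Un_ac inj_on_def)
  from E_map[OF assms(1) this] show "E ?ys (us' @ cs' @ x' # vs')" using m by simp
qed

lemma fresh_list:
  assumes "finite (F :: 'a set)"
  obtains xs where "length xs = n" "distinct xs" "set xs \<inter> F = {}"
proof -
  have "infinite (UNIV - F)" using infinite_UNIV assms by simp
  then obtain A where "A \<subseteq> UNIV - F" "finite A" "card A = n"
    using infinite_arbitrarily_large by metis
  moreover from this obtain xs where "set xs = A" "distinct xs" using finite_distinct_list by blast
  ultimately have "length xs = n" "distinct xs" "set xs \<inter> F = {}"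
    using distinct_card[of xs] by auto
  then show thesis by (rule that)
qed

lemma cyc_mono:
  assumes "cyc i c j" "i' \<le> i" "c' \<le> c" "j' \<le> j"
  shows "cyc i' c' j'"
  unfolding cyc_def
proof (intro allI impI, elim conjE)
  fix us cs vs :: "'a list" and x :: 'a
  assume len: "length us = i'" "length cs = c'" "length vs = j'"
    and dist: "distinct (us @ x # cs @ vs)"
  let ?S = "set (us @ x # cs @ vs)"
  have "finite ?S" by simp
  obtain as where as: "length as = (i - i') + (c - c') + (j - j')" "distinct as" "set as \<inter> ?S = {}"
    using fresh_list[OF \<open>finite ?S\<close>] by blast
  define a b d where "a = take (i - i') as" and "b = take (c - c') (drop (i - i') as)"
    and "d = drop (c - c') (drop (i - i') as)"
  have abd: "as = a @ b @ d" by (simp add: a_def b_def d_def flip: drop_drop)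
  have l: "length a = i - i'" "length b = c - c'" "length d = j - j'"
    using as(1) by (auto simp: a_def b_def d_def)
  have "E ((a @ us) @ x # (b @ cs) @ (d @ vs)) ((a @ us) @ (b @ cs) @ x # (d @ vs))"
    by (rule cycD[OF assms(1)]) (use l len assms as dist in \<open>auto simp: abd\<close>)
  then have "E (filter (\<lambda>z. z \<in> ?S) ((a @ us) @ x # (b @ cs) @ (d @ vs)))
      (filter (\<lambda>z. z \<in> ?S) ((a @ us) @ (b @ cs) @ x # (d @ vs)))" by (rule E_filter)
  moreover have "filter (\<lambda>z. z \<in> ?S) a = []" "filter (\<lambda>z. z \<in> ?S) b = []" "filter (\<lambda>z. z \<in> ?S) d = []"
    using as(3) unfolding abd by (auto simp: filter_empty_conv)
  moreover have "filter (\<lambda>z. z \<in> ?S) us = us" "filter (\<lambda>z. z \<in> ?S) cs = cs" "filter (\<lambda>z. z \<in> ?S) vs = vs"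
    by (auto simp: filter_id_conv)
  ultimately show "E (us @ x # cs @ vs) (us @ cs @ x # vs)" by simp
qed

text \<open>Moving \<open>x\<close> to the right over \<open>cs @ [y]\<close> and then back to the left over \<open>cs\<close>
  transposes \<open>x\<close> and \<open>y\<close>.\<close>

lemma cyc_imp_transposition_right:
  assumes "cyc i (Suc c) (Suc j)"
  shows "cyc (i + c) 1 j"
proof -
  have 1: "cyc i c (Suc j)" and 2: "cyc i (Suc c) j" using assms by (auto intro: cyc_mono)
  show ?thesis unfolding cyc_def
  proof (intro allI impI, elim conjE)
    fix us ys vs :: "'a list" and x :: 'a
    assume len: "length us = i + c" "length ys = 1" "length vs = j"
      and dist: "distinct (us @ x # ys @ vs)"
    then obtain y where ys: "ys = [y]" by (auto simp: length_Suc_conv)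
    define u cs where "u = take i us" and "cs = drop i us"
    have us: "us = u @ cs" and l: "length u = i" "length cs = c" using len by (auto simp: u_def cs_def)
    have "E (u @ x # cs @ (y # vs)) (u @ cs @ x # (y # vs))"
      by (rule cycD[OF 1]) (use l len dist in \<open>auto simp: us ys\<close>)
    moreover have "E (u @ x # (cs @ [y]) @ vs) (u @ (cs @ [y]) @ x # vs)"
      by (rule cycD[OF 2]) (use l len dist in \<open>auto simp: us ys\<close>)
    then have "E (u @ x # cs @ (y # vs)) (u @ (cs @ [y]) @ x # vs)" by simp
    ultimately have "E (u @ cs @ x # y # vs) (u @ (cs @ [y]) @ x # vs)"
      using E_sym E_trans by blast
    then show "E (us @ x # ys @ vs) (us @ ys @ x # vs)" unfolding us ys by simp
  qed
qed

lemma cyc_imp_transposition_left: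
  assumes "cyc (Suc i) (Suc c) j"
  shows "cyc i 1 (j + c)"
proof -
  have 1: "cyc (Suc i) c j" and 2: "cyc i (Suc c) j" using assms by (auto intro: cyc_mono)
  show ?thesis unfolding cyc_def
  proof (intro allI impI, elim conjE)
    fix us xs vs :: "'a list" and y :: 'a
    assume len: "length us = i" "length xs = 1" "length vs = j + c"
      and dist: "distinct (us @ y # xs @ vs)"
    then obtain x where xs: "xs = [x]" by (auto simp: length_Suc_conv)
    define cs v where "cs = take c vs" and "v = drop c vs"
    have vs: "vs = cs @ v" and l: "length v = j" "length cs = c" using len by (auto simp: v_def cs_def)
    have "E ((us @ [x]) @ y # cs @ v) ((us @ [x]) @ cs @ y # v)"
      by (rule cycD[OF 1]) (use l len dist in \<open>auto simp: vs xs\<close>)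
    then have "E (us @ x # y # cs @ v) (us @ (x # cs) @ y # v)" by simp
    moreover have "E (us @ y # (x # cs) @ v) (us @ (x # cs) @ y # v)"
      by (rule cycD[OF 2]) (use l len dist in \<open>auto simp: vs xs\<close>)
    ultimately have "E (us @ y # (x # cs) @ v) (us @ x # y # cs @ v)"
      using E_sym E_trans by blast
    then show "E (us @ y # xs @ vs) (us @ xs @ y # vs)" unfolding vs xs by simp
  qed
qed

lemma E_move_front:
  assumes "\<And>i j. cyc i 1 j" "distinct (us @ x # ps @ qs)"
  shows "E (us @ x # ps @ qs) (us @ ps @ x # qs)"
  using assms(2)
proof (induction ps arbitrary: us)
  case (Cons p ps)
  have "E (us @ x # [p] @ (ps @ qs)) (us @ [p] @ x # (ps @ qs))"
    by (rule cycD[OF assms(1)]) (use Cons.prems in auto)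
  then have "E (us @ x # (p # ps) @ qs) ((us @ [p]) @ x # ps @ qs)" by simp
  moreover have "E ((us @ [p]) @ x # ps @ qs) ((us @ [p]) @ ps @ x # qs)"
    by (rule Cons.IH) (use Cons.prems in auto)
  ultimately have "E (us @ x # (p # ps) @ qs) ((us @ [p]) @ ps @ x # qs)" by (rule E_trans)
  then show ?case by simp
qed (simp add: E_refl)

lemma E_all:
  assumes "\<And>i j. cyc i 1 j" "distinct xs" "distinct ys" "set xs = set ys"
  shows "E xs ys"
proof -
  have "E (us @ xs) (us @ ys)" if "distinct (us @ xs)" "distinct (us @ ys)" "set xs = set ys" for us
    using that
  proof (induction xs arbitrary: us ys)
    case (Cons x xs)
    then have "x \<in> set ys" by auto
    then obtain ps qs where ys: "ys = ps @ x # qs" by (auto simp: in_set_conv_decomp)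
    have "set xs = set (ps @ qs)"
    proof -
      have "x \<notin> set xs" "x \<notin> set (ps @ qs)" using Cons.prems by (auto simp: ys)
      moreover have "insert x (set xs) = insert x (set (ps @ qs))" using Cons.prems by (simp add: ys)
      ultimately show ?thesis by (metis insert_ident)
    qed
    then have "E ((us @ [x]) @ xs) ((us @ [x]) @ (ps @ qs))"
      by (intro Cons.IH) (use Cons.prems in \<open>auto simp: ys\<close>)
    then have "E (us @ x # xs) (us @ x # ps @ qs)" by simp
    moreover have "E (us @ x # ps @ qs) (us @ ps @ x # qs)"
      by (rule E_move_front[OF assms(1)]) (use Cons.prems in \<open>auto simp: ys\<close>)
    ultimately show ?case unfolding ys by (rule E_trans)
  qed (simp add: E_refl)
  from this[of "[]"] show ?thesis using assms by simp
qed

lemma E_rotate: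
  assumes "\<And>c. cyc 0 c 0" "distinct (ws @ zs)"
  shows "E (ws @ zs) (zs @ ws)"
  using assms(2)
proof (induction ws arbitrary: zs)
  case (Cons w ws)
  have "E ([] @ w # (ws @ zs) @ []) ([] @ (ws @ zs) @ w # [])"
    by (rule cycD[OF assms(1)]) (use Cons.prems in auto)
  then have "E ((w # ws) @ zs) (ws @ (zs @ [w]))" by simp
  moreover have "E (ws @ (zs @ [w])) ((zs @ [w]) @ ws)" by (rule Cons.IH) (use Cons.prems in auto)
  ultimately have "E ((w # ws) @ zs) ((zs @ [w]) @ ws)" by (rule E_trans)
  then show ?case by simp
qed (simp add: E_refl)

lemma cyc_rotate:
  assumes rot: "\<And>c. cyc 0 c 0" and "cyc i 1 j" "i' + j' = i + j"
  shows "cyc i' 1 j'"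
proof -
  have 0: "cyc 0 1 (i + j)" unfolding cyc_def
  proof (intro allI impI, elim conjE)
    fix us ys vs :: "'a list" and x :: 'a
    assume len: "length us = 0" "length ys = 1" "length vs = i + j"
      and dist: "distinct (us @ x # ys @ vs)"
    then obtain y where ys: "ys = [y]" by (auto simp: length_Suc_conv)
    define v u where "v = take j vs" and "u = drop j vs"
    have vs: "vs = v @ u" and l: "length v = j" "length u = i" using len by (auto simp: v_def u_def)
    have r: "E ((x # y # v) @ u) (u @ (x # y # v))" "E ((y # x # v) @ u) (u @ (y # x # v))"
      by (rule E_rotate[OF rot]; use dist in \<open>auto simp: ys vs\<close>)+
    have "E (u @ x # [y] @ v) (u @ [y] @ x # v)"
      by (rule cycD[OF assms(2)]) (use len l dist in \<open>auto simp: ys vs\<close>)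
    then have "E (u @ (x # y # v)) (u @ (y # x # v))" by simp
    from E_trans[OF E_trans[OF r(1) this] E_sym[OF r(2)]]
    show "E (us @ x # ys @ vs) (us @ ys @ x # vs)" using len unfolding ys vs by simp
  qed
  show ?thesis unfolding cyc_def
  proof (intro allI impI, elim conjE)
    fix us ys vs :: "'a list" and x :: 'a
    assume len: "length us = i'" "length ys = 1" "length vs = j'"
      and dist: "distinct (us @ x # ys @ vs)"
    then obtain y where ys: "ys = [y]" by (auto simp: length_Suc_conv)
    have r: "E (us @ (x # y # vs)) ((x # y # vs) @ us)" "E (us @ (y # x # vs)) ((y # x # vs) @ us)"
      by (rule E_rotate[OF rot]; use dist in \<open>auto simp: ys\<close>)+
    have "E ([] @ x # [y] @ (vs @ us)) ([] @ [y] @ x # (vs @ us))"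
      by (rule cycD[OF 0]) (use len assms dist in \<open>auto simp: ys\<close>)
    then have "E ((x # y # vs) @ us) ((y # x # vs) @ us)" by simp
    from E_trans[OF E_trans[OF r(1) this] E_sym[OF r(2)]]
    show "E (us @ x # ys @ vs) (us @ ys @ x # vs)" unfolding ys by simp
  qed
qed

end

lemma inc_agree:
  assumes "lt \<inter> F \<times> F = lt' \<inter> F \<times> F" "set fs \<subseteq> F" "inc lt fs"
  shows "inc lt' fs"
  using assms(3) by (rule sorted_wrt_mono_rel[rotated]) (use assms in blast)

lemma below_count_mono:
  assumes "linear_order_of S lt" "finite F" "(x, y) \<in> lt"
  shows "below_count lt F x \<le> below_count lt F y"
proof -
  have "{f \<in> F. (f, x) \<in> lt} \<subseteq> {f \<in> F. (f, y) \<in> lt}"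
    using linear_order_ofD(4)[OF assms(1) _ assms(3)] by blast
  then show ?thesis unfolding below_count_def using assms(2) by (intro card_mono) auto
qed

lemma below_count_less_imp:
  assumes lin: "linear_order_of S lt" and "inc lt fs" "set fs \<subseteq> S" "x \<in> S"
    and "below_count lt (set fs) x < k" "d \<in> set (drop k fs)"
  shows "(x, d) \<in> lt"
proof (rule ccontr)
  assume "(x, d) \<notin> lt"
  moreover have "d \<in> S" using assms(3,6) by (meson in_set_dropD subsetD)
  ultimately have "d = x \<or> (d, x) \<in> lt" using linear_order_ofD(7)[OF lin \<open>x \<in> S\<close>, of d] by blast
  moreover have "(f, d) \<in> lt" if "f \<in> set (take k fs)" for f
  proof -
    have "inc lt (take k fs @ drop k fs)" using assms(2) by simp
    then show ?thesis using assms(6) that unfolding sorted_wrt_append by blast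
  qed
  ultimately have "(f, x) \<in> lt" if "f \<in> set (take k fs)" for f
    using that linear_order_ofD(4)[OF lin, of f d x] by blast
  then have "set (take k fs) \<subseteq> {f \<in> set fs. (f, x) \<in> lt}" by (auto dest: in_set_takeD)
  then have "card (set (take k fs)) \<le> below_count lt (set fs) x"
    unfolding below_count_def by (intro card_mono) auto
  moreover have "card (set (take k fs)) = k"
  proof -
    have "k \<le> length fs" using assms(6) by (cases "k \<le> length fs") auto
    moreover have "distinct (take k fs)" using inc_distinct[OF lin assms(2)] by (rule distinct_take)
    ultimately show ?thesis using distinct_card[of "take k fs"] by simp
  qed
  ultimately show False using assms(5) by simp
qed

definition initial_segments :: "'a set \<Rightarrow> 'a rel \<Rightarrow> 'a set set" where
  "initial_segments S lt = {I. I \<subseteq> S \<and> (\<forall>x\<in>I. \<forall>y. (y, x) \<in> lt \<longrightarrow> y \<in> I)}"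

definition low_part :: "nat \<Rightarrow> 'a set \<Rightarrow> 'a rel \<Rightarrow> 'a set" where
  "low_part m S lt = {x \<in> S. finite {z. (z, x) \<in> lt} \<and> card {z. (z, x) \<in> lt} \<le> m}"

lemma finite_low_part:
  assumes lin: "linear_order_of S lt"
  shows "finite (low_part m S lt)"
proof (rule ccontr)
  assume "infinite (low_part m S lt)"
  then obtain G where G: "G \<subseteq> low_part m S lt" "finite G" "card G = m + 2"
    using infinite_arbitrarily_large by metis
  moreover have "low_part m S lt \<subseteq> S" by (auto simp: low_part_def)
  ultimately obtain xs where xs: "inc lt xs" "set xs = G"
    using inc_exists[OF lin, of G] by blast
  then have len: "length xs = m + 2" using G(3) distinct_card[OF inc_distinct[OF lin xs(1)]] by simp
  then obtain ys y where ys: "xs = ys @ [y]" by (cases xs rule: rev_cases) auto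
  have "y \<in> low_part m S lt" using G xs ys by auto
  then have "finite {z. (z, y) \<in> lt}" "card {z. (z, y) \<in> lt} \<le> m" by (auto simp: low_part_def)
  moreover have "set ys \<subseteq> {z. (z, y) \<in> lt}" using xs by (auto simp: ys sorted_wrt_append)
  ultimately have "card (set ys) \<le> m" using card_mono le_trans by blast
  moreover have "card (set ys) = m + 1"
    using len inc_distinct[OF lin xs(1)] by (simp add: ys distinct_card)
  ultimately show False by simp
qed

locale order_family = pattern_equiv E for E :: "'a list \<Rightarrow> 'a list \<Rightarrow> bool" +
  fixes S :: "'a set" and X :: "'a rel set"
  assumes X_linear: "lt \<in> X \<Longrightarrow> linear_order_of S lt"
    and X_E: "lt \<in> X \<Longrightarrow> lt' \<in> X \<Longrightarrow> inc lt xs \<Longrightarrow> inc lt' ys \<Longrightarrow> set xs = set ys \<Longrightarrow>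
      set xs \<subseteq> S \<Longrightarrow> E xs ys"
begin

lemma dual_order_family: "order_family (\<lambda>xs ys. E (rev xs) (rev ys)) S (converse ` X)"
proof unfold_locales
  show "E (rev (map f xs)) (rev (map f ys))"
    if "E (rev xs) (rev ys)" "inj_on f (set xs \<union> set ys)" for xs ys f
    using E_map[OF that(1), of f] that(2) by (simp add: rev_map)
  show "E (rev (filter P xs)) (rev (filter P ys))" if "E (rev xs) (rev ys)" for xs ys P
    using E_filter[OF that] by (simp add: rev_filter)
  show "E (rev xs) (rev ys)"
    if mem: "lt \<in> converse ` X" "lt' \<in> converse ` X"
      and incs: "inc lt xs" "inc lt' ys" "set xs = set ys" "set xs \<subseteq> S"
    for lt lt' xs ys
  proof -
    obtain l l' where "l \<in> X" "l' \<in> X" "lt = l\<inverse>" "lt' = l'\<inverse>"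
      using mem by (metis imageE)
    then have "inc l (rev xs)" "inc l' (rev ys)" using incs(1,2) by (simp_all only: inc_converse)
    then show ?thesis using X_E[OF \<open>l \<in> X\<close> \<open>l' \<in> X\<close>, of "rev xs" "rev ys"] incs by simp
  qed
next
  show "E (rev xs) (rev zs)" if "E (rev xs) (rev ys)" "E (rev ys) (rev zs)" for xs ys zs
    using that by (rule E_trans)
qed (auto simp: infinite_UNIV E_refl intro: E_sym linear_order_of_converse X_linear)

lemma dual_cyc:
  assumes "pattern_equiv.cyc (\<lambda>xs ys. E (rev xs) (rev ys)) i c j"
  shows "cyc j c i"
proof -
  interpret d: order_family "\<lambda>xs ys. E (rev xs) (rev ys)" S "converse ` X"
    by (rule dual_order_family)
  show ?thesis unfolding cyc_def
  proof (intro allI impI, elim conjE)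
    fix us cs vs :: "'a list" and x :: 'a
    assume *: "length us = j" "length cs = c" "length vs = i" "distinct (us @ x # cs @ vs)"
    then have "E (rev (rev vs @ x # rev cs @ rev us)) (rev (rev vs @ rev cs @ x # rev us))"
      by (intro d.cycD[OF assms]) auto
    then show "E (us @ x # cs @ vs) (us @ cs @ x # vs)" by (auto intro: E_sym)
  qed
qed

lemma jump_imp_cyc:
  assumes X: "lt \<in> X" "lt' \<in> X" and fs: "inc lt fs" "inc lt' fs" "set fs \<subseteq> S"
    and x: "x \<in> S" "x \<notin> set fs"
    and le: "below_count lt (set fs) x \<le> below_count lt' (set fs) x"
  shows "cyc (below_count lt (set fs) x) (below_count lt' (set fs) x - below_count lt (set fs) x)
    (length fs - below_count lt' (set fs) x)"
proof -
  let ?i = "below_count lt (set fs) x" and ?j = "below_count lt' (set fs) x"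
  note b = inc_insert_below[OF X_linear[OF X(1)] fs(1,3) x]
    and b' = inc_insert_below[OF X_linear[OF X(2)] fs(2,3) x]
  define us cs vs where "us = take ?i fs" and "cs = drop ?i (take ?j fs)" and "vs = drop ?j fs"
  have "us = take ?i (take ?j fs)" using le by (simp add: us_def min_def)
  then have 1: "take ?j fs = us @ cs" by (simp only: cs_def append_take_drop_id)
  have 2: "drop ?i fs = cs @ vs"
  proof -
    have "vs = drop (?j - ?i) (drop ?i fs)" using le by (simp add: vs_def)
    then show ?thesis by (simp only: cs_def drop_take append_take_drop_id)
  qed
  have *: "inc lt (us @ x # cs @ vs)" "inc lt' (us @ cs @ x # vs)"
    using b(1) b'(1) unfolding 1 2 by (simp_all add: us_def vs_def)
  have "us @ (cs @ vs) = fs" unfolding us_def 2[symmetric] by simp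
  then have "set us \<union> set (cs @ vs) = set fs" by (metis set_append)
  then have "set (us @ x # cs @ vs) = insert x (set fs)" by auto
  then have "E (us @ x # cs @ vs) (us @ cs @ x # vs)"
    by (intro X_E[OF X *]) (use fs x in auto)
  then have "cyc (length us) (length cs) (length vs)"
    by (rule cycI) (rule inc_distinct[OF X_linear[OF X(1)] *(1)])
  then show ?thesis using le b(3) b'(3) by (simp add: us_def cs_def vs_def)
qed

lemma swap_imp_transposition:
  assumes X: "lt \<in> X" "lt' \<in> X" and fs: "inc lt fs" "inc lt' fs" "set fs \<subseteq> S"
    and x: "x \<in> S" "x \<notin> set fs" and y: "y \<in> S" "y \<notin> set fs"
    and xy: "(x, y) \<in> lt" "(y, x) \<in> lt'"
    and eq: "below_count lt (set fs) x = i" "below_count lt (set fs) y = i"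
      "below_count lt' (set fs) x = i" "below_count lt' (set fs) y = i"
  shows "cyc i 1 (length fs - i)"
proof -
  note bx = inc_insert_below[OF X_linear[OF X(1)] fs(1,3) x, unfolded eq]
    and bx' = inc_insert_below[OF X_linear[OF X(2)] fs(2,3) x, unfolded eq]
    and cy = inc_insert_below[OF X_linear[OF X(1)] fs(1,3) y, unfolded eq]
    and cy' = inc_insert_below[OF X_linear[OF X(2)] fs(2,3) y, unfolded eq]
  define us vs where "us = take i fs" and "vs = drop i fs"
  have *: "inc lt (us @ x # [y] @ vs)" "inc lt' (us @ [y] @ x # vs)"
    using bx(1) bx'(1) cy(1) cy'(1) xy by (auto simp: us_def vs_def sorted_wrt_append)
  have "us @ vs = fs" by (simp add: us_def vs_def)
  then have "set us \<union> set vs = set fs" by (metis set_append)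
  then have "E (us @ x # [y] @ vs) (us @ [y] @ x # vs)"
    by (intro X_E[OF X *]) (use fs x y in auto)
  then have "cyc (length us) (length [y]) (length vs)"
    by (rule cycI) (rule inc_distinct[OF X_linear[OF X(1)] *(1)])
  then show ?thesis using bx(3) by (simp add: us_def vs_def)
qed

lemma countable_nbhd_rotations:
  assumes rot: "\<And>c. cyc 0 c 0" and p: "\<not> cyc p 1 p" and inf: "infinite S"
    and lt: "lt \<in> X" and cuts: "countable (initial_segments S lt)"
  shows "\<exists>F. finite F \<and> F \<subseteq> S \<and> countable {lt' \<in> X. lt' \<inter> F \<times> F = lt \<inter> F \<times> F}"
proof -
  have tr: "a + b < 2 * p" if "cyc a 1 b" for a b
  proof (rule ccontr)
    assume *: "\<not> a + b < 2 * p"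
    then have "cyc p 1 (a + b - p)" by (intro cyc_rotate[OF rot that]) auto
    then have "cyc p 1 p" by (rule cyc_mono) (use * in auto)
    with p show False by simp
  qed
  have big: "i = 0 \<and> j = 0" if cy: "cyc i c j" and c1: "c \<ge> 1" and large: "i + c + j \<ge> 2 * p + 2" for i c j
  proof (rule ccontr)
    obtain c' where c: "c = Suc c'" using c1 by (cases c) auto
    assume "\<not> ?thesis"
    then consider i' where "i = Suc i'" | j' where "j = Suc j'" by (cases i; cases j) auto
    then show False
    proof cases
      case 1
      then show False using tr[OF cyc_imp_transposition_left[OF cy[unfolded c 1]]] large c 1 by simp
    next
      case 2
      then show False using tr[OF cyc_imp_transposition_right[OF cy[unfolded c 2]]] large c 2 by simp
    qed
  qed
  define N where "N = 2 * p + 2"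
  obtain F where F: "F \<subseteq> S" "finite F" "card F = N"
    using infinite_arbitrarily_large[OF inf] by metis
  obtain fs where fs: "inc lt fs" "set fs = F" using inc_exists[OF X_linear[OF lt] F(2,1)] by blast
  have len: "length fs = N"
    using fs(2) F(3) distinct_card[OF inc_distinct[OF X_linear[OF lt] fs(1)]] by simp
  define \<X> where "\<X> = {lt' \<in> X. lt' \<inter> F \<times> F = lt \<inter> F \<times> F}"
  have \<X>: "lt' \<in> X" "inc lt' fs" if "lt' \<in> \<X>" for lt'
    using that inc_agree[of lt F lt' fs] fs unfolding \<X>_def by auto
  have fsS: "set fs \<subseteq> S" using fs F by simp
  note lin = X_linear[OF lt]
  have pos: "below_count lt' F x = below_count lt F x \<or> below_count lt F x = 0 \<and> below_count lt' F x = N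
      \<or> below_count lt F x = N \<and> below_count lt' F x = 0"
    if "lt' \<in> \<X>" "x \<in> S" "x \<notin> F" for lt' x
  proof -
    note b = inc_insert_below(3)[OF lin fs(1) fsS, unfolded fs, OF that(2,3)]
      and b' = inc_insert_below(3)[OF X_linear[OF \<X>(1)[OF that(1)]] \<X>(2)[OF that(1)] fsS, unfolded fs, OF that(2,3)]
    note j = jump_imp_cyc[OF lt \<X>(1)[OF that(1)] fs(1) \<X>(2)[OF that(1)] fsS, unfolded fs, OF that(2,3)]
      and j' = jump_imp_cyc[OF \<X>(1)[OF that(1)] lt \<X>(2)[OF that(1)] fs(1) fsS, unfolded fs, OF that(2,3)]
    show ?thesis
    proof (cases "below_count lt F x" "below_count lt' F x" rule: linorder_cases)
      case less
      then show ?thesis using big[OF j] b b' by (auto simp: len N_def)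
    next
      case greater
      then show ?thesis using big[OF j'] b b' by (auto simp: len N_def)
    qed auto
  qed
  define J0 where "J0 lt' = {x \<in> S - F. below_count lt F x = 0 \<and> below_count lt' F x = N}" for lt'
  define J1 where "J1 lt' = {x \<in> S - F. below_count lt F x = N \<and> below_count lt' F x = 0}" for lt'
  have ltS: "x \<in> S" "y \<in> S" if "(x, y) \<in> lt" for x y using linear_order_ofD[OF lin] that by blast+
  have N: "N > 0" by (simp add: N_def)
  have bF: "below_count lt F x \<noteq> 0" if "(f, x) \<in> lt" "f \<in> F" for f x
    using that F by (auto simp: below_count_def)
  have bFN: "x \<notin> F \<and> (\<forall>f\<in>F. (f, x) \<in> lt)" if "below_count lt F x = N" for x
  proof -
    have "{f \<in> F. (f, x) \<in> lt} = F"
      using that F by (intro card_subset_eq) (auto simp: below_count_def)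
    then show ?thesis using linear_order_ofD(3)[OF lin] by blast
  qed
  have J0: "J0 lt' \<in> initial_segments S lt" if lt': "lt' \<in> \<X>" for lt'
    unfolding initial_segments_def
  proof (intro CollectI conjI ballI allI impI)
    fix x y assume x: "x \<in> J0 lt'" and yx: "(y, x) \<in> lt"
    have x': "x \<in> S" "x \<notin> F" "below_count lt F x = 0" "below_count lt' F x = N"
      using x by (auto simp: J0_def)
    have y: "y \<in> S" "y \<notin> F" "below_count lt F y = 0"
      using bF[OF yx] x'(3) ltS[OF yx] below_count_mono[OF lin F(2) yx] by auto
    have "below_count lt' F y = N"
    proof (rule ccontr)
      assume "below_count lt' F y \<noteq> N"
      then have y0: "below_count lt' F y = 0" using pos[OF lt' y(1,2)] y(3) by auto
      note lin' = X_linear[OF \<X>(1)[OF lt']]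
      have 1: "inc lt (x # fs)" using inc_insert_below(1)[OF lin fs(1) fsS, unfolded fs, OF x'(1,2)] x'(3) by simp
      have 2: "inc lt (y # fs)" using inc_insert_below(1)[OF lin fs(1) fsS, unfolded fs, OF y(1,2)] y(3) by simp
      have 3: "inc lt' (fs @ [x])"
        using inc_insert_below(1)[OF lin' \<X>(2)[OF lt'] fsS, unfolded fs, OF x'(1,2)] x'(4) len by simp
      have 4: "inc lt' (y # fs)"
        using inc_insert_below(1)[OF lin' \<X>(2)[OF lt'] fsS, unfolded fs, OF y(1,2)] y0 len by simp
      have ne: "fs \<noteq> []" using len N by auto
      have "(y, x) \<in> lt'"
        using 3 4 ne linear_order_ofD(4)[OF lin', of y "hd fs" x] by (cases fs) auto
      then have 5: "inc lt' ([y] @ fs @ x # [])" using 3 4 by (auto simp: sorted_wrt_append)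
      have 6: "inc lt ([y] @ x # fs @ [])" using 1 2 yx by auto
      have "E ([y] @ x # fs @ []) ([y] @ fs @ x # [])"
        by (rule X_E[OF lt \<X>(1)[OF lt'] 6 5]) (use x' y fs F in auto)
      from cycI[OF this inc_distinct[OF lin 6]] have "cyc 1 N 0" using len by simp
      from big[OF this] show False by (simp add: N_def)
    qed
    then show "y \<in> J0 lt'" using y by (simp add: J0_def)
  qed (auto simp: J0_def)
  have J1: "S - J1 lt' \<in> initial_segments S lt" if lt': "lt' \<in> \<X>" for lt'
    unfolding initial_segments_def
  proof (intro CollectI conjI ballI allI impI)
    fix x y assume x: "x \<in> S - J1 lt'" and yx: "(y, x) \<in> lt"
    have "x \<in> J1 lt'" if yJ: "y \<in> J1 lt'"
    proof -
      have y': "y \<in> S" "y \<notin> F" "below_count lt F y = N" "below_count lt' F y = 0"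
        using yJ by (auto simp: J1_def)
      have xN: "below_count lt F x = N"
        using below_count_mono[OF lin F(2) yx] y'(3) card_mono[OF F(2), of "{f \<in> F. (f, x) \<in> lt}"] F(3)
        by (auto simp: below_count_def)
      have x': "x \<in> S" "x \<notin> F" using bFN[OF xN] ltS[OF yx] by auto
      have "below_count lt' F x = 0"
      proof (rule ccontr)
        assume "below_count lt' F x \<noteq> 0"
        then have x0: "below_count lt' F x = N" using pos[OF lt' x'(1,2)] xN by auto
        note lin' = X_linear[OF \<X>(1)[OF lt']]
        have 1: "inc lt (fs @ [x])" using inc_insert_below(1)[OF lin fs(1) fsS, unfolded fs, OF x'(1,2)] xN len by simp
        have 2: "inc lt (fs @ [y])" using inc_insert_below(1)[OF lin fs(1) fsS, unfolded fs, OF y'(1,2)] y'(3) len by simp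
        have 3: "inc lt' (fs @ [x])"
          using inc_insert_below(1)[OF lin' \<X>(2)[OF lt'] fsS, unfolded fs, OF x'(1,2)] x0 len by simp
        have 4: "inc lt' (y # fs)"
          using inc_insert_below(1)[OF lin' \<X>(2)[OF lt'] fsS, unfolded fs, OF y'(1,2)] y'(4) len by simp
        have ne: "fs \<noteq> []" using len N by auto
        have "(y, x) \<in> lt'"
          using 3 4 ne linear_order_ofD(4)[OF lin', of y "hd fs" x] by (cases fs) auto
        then have 5: "inc lt' ([] @ y # fs @ [x])" using 3 4 by (auto simp: sorted_wrt_append)
        have 6: "inc lt ([] @ fs @ y # [x])" using 1 2 yx by (auto simp: sorted_wrt_append)
        have "E ([] @ y # fs @ [x]) ([] @ fs @ y # [x])"
          by (rule X_E[OF \<X>(1)[OF lt'] lt 5 6]) (use x' y' fs F in auto)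
        from cycI[OF this inc_distinct[OF lin' 5]] have "cyc 0 N 1" using len by simp
        from big[OF this] show False by (simp add: N_def)
      qed
      then show ?thesis using x' xN by (simp add: J1_def)
    qed
    then show "y \<in> S - J1 lt'" using x ltS[OF yx] by auto
  qed auto
  have sub: "lt1 \<subseteq> lt2" if 1: "lt1 \<in> \<X>" and 2: "lt2 \<in> \<X>" and J: "J0 lt1 = J0 lt2" "J1 lt1 = J1 lt2" for lt1 lt2
  proof (rule subrelI, rule ccontr)
    note lin1 = X_linear[OF \<X>(1)[OF 1]] and lin2 = X_linear[OF \<X>(1)[OF 2]]
    fix x y assume xy: "(x, y) \<in> lt1" "(x, y) \<notin> lt2"
    have S: "x \<in> S" "y \<in> S" "x \<noteq> y" using linear_order_ofD(1-3)[OF lin1] xy by blast+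
    then have yx: "(y, x) \<in> lt2" using linear_order_ofD(7)[OF lin2] xy by blast
    have yx1: "(y, x) \<notin> lt1" using linear_order_ofD(5)[OF lin1] xy by blast
    have eq: "below_count lt1 F z = below_count lt2 F z" if "z \<in> S" "z \<notin> F" for z
    proof -
      have "z \<in> J0 lt1 \<longleftrightarrow> z \<in> J0 lt2" "z \<in> J1 lt1 \<longleftrightarrow> z \<in> J1 lt2" using J by auto
      then show ?thesis using pos[OF 1 that] pos[OF 2 that] that N by (auto simp: J0_def J1_def)
    qed
    have eqs: "(f, z) \<in> lt1 \<longleftrightarrow> (f, z) \<in> lt2" if "z \<in> S" "z \<notin> F" "f \<in> F" for z f
      using inc_insert_below(2)[OF lin1 \<X>(2)[OF 1] fsS, unfolded fs, OF that(1,2)]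
        inc_insert_below(2)[OF lin2 \<X>(2)[OF 2] fsS, unfolded fs, OF that(1,2)] eq[OF that(1,2)] that(3)
      by auto
    have "x \<notin> F \<or> y \<notin> F" using 1 2 xy unfolding \<X>_def by auto
    moreover have "x \<in> F \<Longrightarrow> y \<in> F" using eqs[of y x] S xy by auto
    moreover have "y \<in> F \<Longrightarrow> x \<in> F" using eqs[of x y] S yx yx1 by auto
    ultimately have nF: "x \<notin> F" "y \<notin> F" by auto
    have "below_count lt1 F x = below_count lt1 F y"
      using below_count_mono[OF lin1 F(2) xy(1)] below_count_mono[OF lin2 F(2) yx] eq S nF by auto
    then have "cyc (below_count lt1 F x) 1 (length fs - below_count lt1 F x)"
      by (intro swap_imp_transposition[OF \<X>(1)[OF 1] \<X>(1)[OF 2] \<X>(2)[OF 1] \<X>(2)[OF 2] fsS, unfolded fs,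
          OF S(1) nF(1) S(2) nF(2) xy(1) yx]) (use eq S nF in auto)
    from tr[OF this] show False by (simp add: len N_def)
  qed
  have "inj_on (\<lambda>lt'. (J0 lt', S - J1 lt')) \<X>"
  proof (rule inj_onI)
    fix lt1 lt2 assume *: "lt1 \<in> \<X>" "lt2 \<in> \<X>" "(J0 lt1, S - J1 lt1) = (J0 lt2, S - J1 lt2)"
    moreover have "J1 lt1 \<subseteq> S" "J1 lt2 \<subseteq> S" by (auto simp: J1_def)
    ultimately have "J0 lt1 = J0 lt2" "J1 lt1 = J1 lt2" by blast+
    then show "lt1 = lt2" using sub *(1,2) by (intro subset_antisym) auto
  qed
  moreover have "(\<lambda>lt'. (J0 lt', S - J1 lt')) ` \<X> \<subseteq> initial_segments S lt \<times> initial_segments S lt"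
    using J0 J1 by auto
  moreover have "countable (initial_segments S lt \<times> initial_segments S lt)" using cuts by simp
  ultimately have "countable \<X>" using countable_image_inj_on countable_subset by blast
  then show ?thesis using F unfolding \<X>_def by blast
qed

text \<open>If \<open>lt'\<close> exchanges \<open>x\<close> and \<open>y\<close>, then the points \<open>z < x\<close> split into those that stay below
  \<open>y\<close> and those that \<open>y\<close> jumps over. Composing with the inverse of the rearrangement of these
  points leaves a pure transposition, respectively a pure cycle.\<close>

lemma card_below_inversion:
  assumes p: "\<not> cyc p 1 p" and X: "lt \<in> X" "lt' \<in> X"
    and ds: "inc lt ds" "inc lt' ds" "set ds \<subseteq> S" "length ds = p + 2"
    and xy: "(x, y) \<in> lt" "(y, x) \<in> lt'"
    and Z: "finite Z" "\<And>z. z \<in> Z \<Longrightarrow> (z, x) \<in> lt"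
    and hi: "\<And>d. d \<in> set ds \<Longrightarrow> (y, d) \<in> lt" "\<And>d. d \<in> set ds \<Longrightarrow> (x, d) \<in> lt'"
      "\<And>d z. d \<in> set ds \<Longrightarrow> z \<in> Z \<Longrightarrow> (z, d) \<in> lt'"
  shows "card Z \<le> 2 * p"
proof (rule ccontr)
  assume big: "\<not> card Z \<le> 2 * p"
  note lin = X_linear[OF X(1)] and lin' = X_linear[OF X(2)]
  note tr = linear_order_ofD(4)[OF lin] and tr' = linear_order_ofD(4)[OF lin']
  have S: "x \<in> S" "y \<in> S" "x \<noteq> y" using linear_order_ofD(1-3)[OF lin] xy by blast+
  have ZS: "Z \<subseteq> S" using linear_order_ofD(1)[OF lin] Z(2) by blast
  have Zy: "(z, y) \<in> lt" if "z \<in> Z" for z using tr Z(2)[OF that] xy by blast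
  have Zd: "(z, d) \<in> lt" if "z \<in> Z" "d \<in> set ds" for z d using tr Zy[OF that(1)] hi(1)[OF that(2)] by blast
  have xd: "(x, d) \<in> lt" if "d \<in> set ds" for d using tr xy hi(1)[OF that] by blast
  have yd: "(y, d) \<in> lt'" if "d \<in> set ds" for d using tr' xy hi(2)[OF that] by blast
  obtain d ds0 where ds_eq: "ds = d # ds0" and len0: "length ds0 = p + 1"
    using ds(4) by (cases ds) auto
  have Zne: "z \<noteq> x" "z \<noteq> y" "z \<notin> set ds" if "z \<in> Z" for z
    using linear_order_ofD(3)[OF lin] Z(2)[OF that] Zy[OF that] Zd[OF that] by blast+
  have dne: "x \<notin> set ds" "y \<notin> set ds"
    using linear_order_ofD(3)[OF lin] xd hi(1) by blast+
  have d0: "d \<notin> set ds0" using inc_distinct[OF lin ds(1)] by (simp add: ds_eq)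
  define Z1 where "Z1 = {z \<in> Z. (z, y) \<in> lt'}"
  define Z2 where "Z2 = {z \<in> Z. (y, z) \<in> lt'}"
  have "(z, y) \<in> lt' \<or> (y, z) \<in> lt'" if "z \<in> Z" for z
    using linear_order_ofD(6)[OF lin', of z y] that ZS S(2) Zne(2)[OF that] by blast
  then have "Z = Z1 \<union> Z2" unfolding Z1_def Z2_def by blast
  then have "card Z \<le> card Z1 + card Z2" by (simp add: card_Un_le)
  then consider "card Z1 \<ge> p" | "card Z2 \<ge> p + 1" using big by linarith
  then show False
  proof cases
    case 1
    have Z1: "finite Z1" "Z1 \<subseteq> S" "Z1 \<subseteq> Z" using Z ZS by (auto simp: Z1_def)
    obtain zs where zs: "inc lt zs" "set zs = Z1" using inc_exists[OF lin Z1(1,2)] by blast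
    obtain zs' where zs': "inc lt' zs'" "set zs' = Z1" using inc_exists[OF lin' Z1(1,2)] by blast
    have len: "length zs' = card Z1" using distinct_card[OF inc_distinct[OF lin' zs'(1)]] zs' by simp
    have Z1x: "(z, x) \<in> lt'" if "z \<in> Z1" for z using tr' xy that by (auto simp: Z1_def)
    have "inc lt (zs @ x # y # ds)"
      using zs ds xy hi xd Z Zy Zd Z1(3) by (auto simp: sorted_wrt_append)
    moreover have "inc lt' (zs' @ y # x # ds)"
      using zs' ds xy hi yd Z1x Z1(3) by (auto simp: sorted_wrt_append Z1_def)
    ultimately have E: "E (zs @ x # y # d # ds0) (zs' @ y # x # d # ds0)"
      unfolding ds_eq by (intro X_E[OF X]) (use zs zs' S ds Z1 in \<open>auto simp: ds_eq\<close>)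
    have nz: "x \<notin> set zs" "y \<notin> set zs" "d \<notin> set zs" "\<forall>z\<in>set zs. z \<notin> set ds0"
      using zs(2) Z1(3) Zne unfolding ds_eq by auto
    have zz: "set zs' = set zs" using zs zs' by simp
    have nd: "x \<noteq> d" "y \<noteq> d" "d \<noteq> x" "d \<noteq> y" "x \<notin> set ds0" "y \<notin> set ds0" using dne by (auto simp: ds_eq)
    have f: "filter (\<lambda>a. a \<noteq> d) zs = zs" "filter (\<lambda>a. a \<noteq> d) zs' = zs'" "filter (\<lambda>a. a \<noteq> d) ds0 = ds0"
      "filter (\<lambda>a. a \<noteq> y) zs = zs" "filter (\<lambda>a. a \<noteq> y) zs' = zs'" "filter (\<lambda>a. a \<noteq> y) ds0 = ds0"
      using zz nz nd d0 by (auto simp: filter_id_conv)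
    have e1: "E (zs @ x # y # ds0) (zs' @ y # x # ds0)"
      using E_filter[OF E, of "\<lambda>a. a \<noteq> d"] f nd by simp
    have e2: "E (zs @ x # d # ds0) (zs' @ x # d # ds0)"
      using E_filter[OF E, of "\<lambda>a. a \<noteq> y"] f nd S(3) by simp
    let ?f = "id(d := y)"
    have m: "map ?f zs = zs" "map ?f zs' = zs'" "map ?f ds0 = ds0"
      using zz nz d0 by (auto intro!: map_idI)
    have "inj_on ?f (set (zs @ x # d # ds0) \<union> set (zs' @ x # d # ds0))"
      using zz nz nd S(3) by (auto simp: inj_on_def)
    from E_map[OF e2 this] have "E (zs @ x # y # ds0) (zs' @ x # y # ds0)"
      using m nd by simp
    then have e3: "E (zs' @ x # [y] @ ds0) (zs' @ [y] @ x # ds0)" using E_trans[OF E_sym e1] by simp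
    have "distinct (zs' @ x # [y] @ ds0)"
      using inc_distinct[OF lin' zs'(1)] inc_distinct[OF lin ds(1)] zz nz nd S(3) by (auto simp: ds_eq)
    from cycI[OF e3 this] have "cyc (card Z1) 1 (p + 1)" using len len0 by simp
    then have "cyc p 1 p" by (rule cyc_mono) (use 1 in auto)
    with p show False by simp
  next
    case 2
    have Z2: "finite Z2" "Z2 \<subseteq> S" "Z2 \<subseteq> Z" using Z ZS by (auto simp: Z2_def)
    obtain zs where zs: "inc lt zs" "set zs = Z2" using inc_exists[OF lin Z2(1,2)] by blast
    obtain zs' where zs': "inc lt' zs'" "set zs' = Z2" using inc_exists[OF lin' Z2(1,2)] by blast
    have len: "length zs' = card Z2" using distinct_card[OF inc_distinct[OF lin' zs'(1)]] zs' by simp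
    have "inc lt (zs @ y # ds)"
      using zs ds hi Zy Zd Z2(3) by (auto simp: sorted_wrt_append)
    moreover have "inc lt' (y # zs' @ ds)"
      using zs' ds hi yd Z2(3) by (auto simp: sorted_wrt_append Z2_def)
    ultimately have E: "E (zs @ y # d # ds0) (y # zs' @ d # ds0)"
      unfolding ds_eq by (intro X_E[OF X]) (use zs zs' S ds Z2 in \<open>auto simp: ds_eq\<close>)
    have nz: "x \<notin> set zs" "y \<notin> set zs" "d \<notin> set zs" "\<forall>z\<in>set zs. z \<notin> set ds0"
      using zs(2) Z2(3) Zne unfolding ds_eq by auto
    have zz: "set zs' = set zs" using zs zs' by simp
    have nd: "x \<noteq> d" "y \<noteq> d" "d \<noteq> x" "d \<noteq> y" "x \<notin> set ds0" "y \<notin> set ds0" using dne by (auto simp: ds_eq)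
    have f: "filter (\<lambda>a. a \<noteq> d) zs = zs" "filter (\<lambda>a. a \<noteq> d) zs' = zs'" "filter (\<lambda>a. a \<noteq> d) ds0 = ds0"
      "filter (\<lambda>a. a \<noteq> y) zs = zs" "filter (\<lambda>a. a \<noteq> y) zs' = zs'" "filter (\<lambda>a. a \<noteq> y) ds0 = ds0"
      using zz nz nd d0 by (auto simp: filter_id_conv)
    have e1: "E (zs @ y # ds0) (y # zs' @ ds0)"
      using E_filter[OF E, of "\<lambda>a. a \<noteq> d"] f nd by simp
    have e2: "E (zs @ d # ds0) (zs' @ d # ds0)"
      using E_filter[OF E, of "\<lambda>a. a \<noteq> y"] f nd by simp
    let ?f = "id(d := y)"
    have m: "map ?f zs = zs" "map ?f zs' = zs'" "map ?f ds0 = ds0"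
      using zz nz d0 by (auto intro!: map_idI)
    have "inj_on ?f (set (zs @ d # ds0) \<union> set (zs' @ d # ds0))"
      using zz nz nd by (auto simp: inj_on_def)
    from E_map[OF e2 this] have "E (zs @ y # ds0) (zs' @ y # ds0)" using m by simp
    then have e3: "E ([] @ y # zs' @ ds0) ([] @ zs' @ y # ds0)" using E_trans[OF E_sym[OF e1]] by simp
    have "distinct ([] @ y # zs' @ ds0)"
      using inc_distinct[OF lin' zs'(1)] inc_distinct[OF lin ds(1)] zz nz nd by (auto simp: ds_eq)
    from cycI[OF e3 this] have "cyc 0 (card Z2) (p + 1)" using len len0 by simp
    then have "cyc 0 (Suc p) (Suc p)" by (rule cyc_mono) (use 2 in auto)
    from cyc_imp_transposition_right[OF this] p show False by simp
  qed
qed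

lemma jump_bound:
  assumes r: "\<not> cyc 0 r 0" and X: "lt \<in> X" "lt' \<in> X"
    and fs: "inc lt fs" "inc lt' fs" "set fs \<subseteq> S" and x: "x \<in> S"
  shows "below_count lt' (set fs) x < below_count lt (set fs) x + r"
proof (rule ccontr)
  assume *: "\<not> ?thesis"
  have "r \<noteq> 0"
  proof
    assume "r = 0"
    have "cyc 0 0 0" by (simp add: cyc_def E_refl)
    with r \<open>r = 0\<close> show False by simp
  qed
  show False
  proof (cases "x \<in> set fs")
    case True
    then obtain us vs where fs_eq: "fs = us @ x # vs" by (auto simp: in_set_conv_decomp)
    have "below_count l (set fs) x = length us" if "l \<in> X" "inc l fs" for l
    proof -
      have "{f \<in> set fs. (f, x) \<in> l} = {f \<in> set us \<union> set vs. (f, x) \<in> l}"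
        using linear_order_ofD(3)[OF X_linear[OF that(1)]] by (auto simp: fs_eq)
      then show ?thesis
        using inc_below(2)[OF X_linear[OF that(1)], of us x vs] that(2) by (simp add: fs_eq below_count_def)
    qed
    then show False using * X fs \<open>r \<noteq> 0\<close> by simp
  next
    case False
    have "cyc 0 r 0"
      by (rule cyc_mono[OF jump_imp_cyc[OF X fs x False]]) (use * in auto)
    with r show False by simp
  qed
qed

lemma inversion_low_part:
  assumes p: "\<not> cyc p 1 p" and r: "\<not> cyc 0 r 0" and X: "lt \<in> X" "lt' \<in> X"
    and fs: "inc lt fs" "inc lt' fs" "set fs \<subseteq> S"
    and xy: "(x, y) \<in> lt" "(y, x) \<in> lt'"
    and low: "below_count lt (set fs) x + 2 * r + p + 3 \<le> length fs"
  shows "x \<in> low_part (2 * p) S lt"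
proof -
  note lin = X_linear[OF X(1)] and lin' = X_linear[OF X(2)]
  have S: "x \<in> S" "y \<in> S" using linear_order_ofD(1,2)[OF lin] xy by blast+
  let ?b = "below_count lt (set fs)" and ?b' = "below_count lt' (set fs)"
  define k where "k = ?b x + 2 * r + 1"
  define ds where "ds = take (p + 2) (drop k fs)"
  have dsk: "set ds \<subseteq> set (drop k fs)" by (simp add: ds_def set_take_subset)
  have len: "length ds = p + 2" using low by (simp add: ds_def k_def)
  have inc_ds: "inc l ds" if "inc l fs" for l
    unfolding ds_def using that by (intro sorted_wrt_take sorted_wrt_drop)
  have dsS: "set ds \<subseteq> S" using dsk fs(3) by (meson in_set_dropD subset_code(1))
  have bx: "?b' x < ?b x + r" using jump_bound[OF r X fs S(1)] .
  have byx: "?b' y \<le> ?b' x" using below_count_mono[OF lin' _ xy(2)] by simp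
  have bY: "?b y < ?b' y + r" using jump_bound[OF r X(2,1) fs(2,1,3) S(2)] .
  have card: "card Z \<le> 2 * p" if Z: "finite Z" "Z \<subseteq> {z. (z, x) \<in> lt}" for Z
  proof (rule card_below_inversion[OF p X inc_ds[OF fs(1)] inc_ds[OF fs(2)] dsS len xy Z(1)])
    show "(z, x) \<in> lt" if "z \<in> Z" for z using Z that by auto
    show "(y, d) \<in> lt" if "d \<in> set ds" for d
      by (rule below_count_less_imp[OF lin fs(1,3) S(2), of k]) (use bx byx bY that dsk in \<open>auto simp: k_def\<close>)
    show "(x, d) \<in> lt'" if "d \<in> set ds" for d
      by (rule below_count_less_imp[OF lin' fs(2,3) S(1), of k]) (use bx that dsk in \<open>auto simp: k_def\<close>)
    show "(z, d) \<in> lt'" if "d \<in> set ds" "z \<in> Z" for d z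
    proof -
      have zx: "(z, x) \<in> lt" using Z that by auto
      then have zS: "z \<in> S" using linear_order_ofD(1)[OF lin] by blast
      have "?b z \<le> ?b x" using below_count_mono[OF lin _ zx] by simp
      moreover have "?b' z < ?b z + r" using jump_bound[OF r X fs zS] .
      ultimately show ?thesis
        by (intro below_count_less_imp[OF lin' fs(2,3) zS, of k]) (use that dsk in \<open>auto simp: k_def\<close>)
    qed
  qed
  have fin: "finite {z. (z, x) \<in> lt}"
  proof (rule ccontr)
    assume "infinite {z. (z, x) \<in> lt}"
    then obtain Z where "Z \<subseteq> {z. (z, x) \<in> lt}" "finite Z" "card Z = 2 * p + 1"
      using infinite_arbitrarily_large by metis
    then show False using card[of Z] by simp
  qed
  then show ?thesis using card[of "{z. (z, x) \<in> lt}"] S by (simp add: low_part_def)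
qed

lemma inversion_both_low:
  assumes p: "\<not> cyc p 1 p" and r: "\<not> cyc 0 r 0" and X: "lt \<in> X" "lt' \<in> X"
    and fs: "inc lt fs" "inc lt' fs" "set fs \<subseteq> S"
    and xy: "(x, y) \<in> lt" "(y, x) \<in> lt'"
    and low: "below_count lt (set fs) x + 3 * r + p + 3 \<le> length fs"
  shows "x \<in> low_part (2 * p) S lt \<and> y \<in> low_part (2 * p) S lt'"
proof -
  have S: "x \<in> S" "y \<in> S" using linear_order_ofD(1,2)[OF X_linear[OF X(1)]] xy by blast+
  have "below_count lt' (set fs) y \<le> below_count lt' (set fs) x"
    using below_count_mono[OF X_linear[OF X(2)] _ xy(2)] by simp
  moreover have "below_count lt' (set fs) x < below_count lt (set fs) x + r"
    using jump_bound[OF r X fs S(1)] .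
  ultimately show ?thesis
    using inversion_low_part[OF p r X fs xy] inversion_low_part[OF p r X(2,1) fs(2,1,3) xy(2,1)] low by simp
qed

lemma countable_nbhd_no_rotations:
  assumes p: "\<not> cyc p 1 p" and r: "\<not> cyc 0 r 0" and inf: "infinite S" and cS: "countable S"
    and lt: "lt \<in> X"
  shows "\<exists>F. finite F \<and> F \<subseteq> S \<and> countable {lt' \<in> X. lt' \<inter> F \<times> F = lt \<inter> F \<times> F}"
proof -
  interpret d: order_family "\<lambda>xs ys. E (rev xs) (rev ys)" S "converse ` X"
    by (rule dual_order_family)
  have dp: "\<not> d.cyc p 1 p" and dr: "\<not> d.cyc 0 r 0" using dual_cyc p r by blast+
  define N where "N = 2 * (3 * r + p + 3)"
  obtain F where F: "F \<subseteq> S" "finite F" "card F = N"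
    using infinite_arbitrarily_large[OF inf] by metis
  obtain fs where fs: "inc lt fs" "set fs = F" using inc_exists[OF X_linear[OF lt] F(2,1)] by blast
  have len: "length fs = N"
    using fs(2) F(3) distinct_card[OF inc_distinct[OF X_linear[OF lt] fs(1)]] by simp
  have fsS: "set fs \<subseteq> S" using fs F by simp
  define \<X> where "\<X> = {lt' \<in> X. lt' \<inter> F \<times> F = lt \<inter> F \<times> F}"
  have \<X>: "lt' \<in> X" "inc lt' fs" if "lt' \<in> \<X>" for lt'
    using that inc_agree[of lt F lt' fs] fs unfolding \<X>_def by auto
  let ?L = "low_part (2 * p) S"
  define inv where "inv l = ((?L l, l \<inter> ?L l \<times> ?L l), (?L (l\<inverse>), l \<inter> ?L (l\<inverse>) \<times> ?L (l\<inverse>)))" for l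
  have sub: "lt1 \<subseteq> lt2" if 1: "lt1 \<in> \<X>" and 2: "lt2 \<in> \<X>" and eq: "inv lt1 = inv lt2" for lt1 lt2
  proof (rule subrelI, rule ccontr)
    note X1 = \<X>(1)[OF 1] and X2 = \<X>(1)[OF 2] and i1 = \<X>(2)[OF 1] and i2 = \<X>(2)[OF 2]
    note lin1 = X_linear[OF X1] and lin2 = X_linear[OF X2]
    fix x y assume xy: "(x, y) \<in> lt1" "(x, y) \<notin> lt2"
    have S: "x \<in> S" "y \<in> S" "x \<noteq> y" using linear_order_ofD(1-3)[OF lin1] xy by blast+
    then have yx: "(y, x) \<in> lt2" using linear_order_ofD(7)[OF lin2] xy by blast
    have eqs: "?L lt1 = ?L lt2" "lt1 \<inter> ?L lt1 \<times> ?L lt1 = lt2 \<inter> ?L lt2 \<times> ?L lt2"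
      "?L (lt1\<inverse>) = ?L (lt2\<inverse>)"
      "lt1 \<inter> ?L (lt1\<inverse>) \<times> ?L (lt1\<inverse>) = lt2 \<inter> ?L (lt2\<inverse>) \<times> ?L (lt2\<inverse>)"
      using eq unfolding inv_def prod.inject by blast+
    show False
    proof (cases "below_count lt1 F x + 3 * r + p + 3 \<le> N")
      case True
      then have "x \<in> ?L lt1 \<and> y \<in> ?L lt2"
        by (intro inversion_both_low[OF p r X1 X2 i1 i2 fsS xy(1) yx]) (simp add: fs len)
      then have "(x, y) \<in> lt1 \<inter> ?L lt1 \<times> ?L lt1" using eqs(1) xy(1) by simp
      then show False using eqs(2) xy(2) by simp
    next
      case False
      have "below_count (lt1\<inverse>) F y + below_count lt1 F x \<le> N"
      proof -
        have "below_count (lt1\<inverse>) F y + below_count lt1 F x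
            = card ({f \<in> F. (f, y) \<in> lt1\<inverse>} \<union> {f \<in> F. (f, x) \<in> lt1})"
          unfolding below_count_def
        proof (rule card_Un_disjoint[symmetric])
          show "{f \<in> F. (f, y) \<in> lt1\<inverse>} \<inter> {f \<in> F. (f, x) \<in> lt1} = {}"
          proof (rule ccontr)
            assume "\<not> ?thesis"
            then obtain f where "(y, f) \<in> lt1" "(f, x) \<in> lt1" by auto
            then show False using linear_order_ofD(4,5)[OF lin1] xy(1) by blast
          qed
        qed (use F in auto)
        also have "\<dots> \<le> card F" by (rule card_mono) (use F in auto)
        finally show ?thesis using F by simp
      qed
      then have "below_count (lt1\<inverse>) F y + 3 * r + p + 3 \<le> N" using False by (simp add: N_def)
      then have low: "below_count (lt1\<inverse>) (set (rev fs)) y + 3 * r + p + 3 \<le> length (rev fs)"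
        by (simp add: fs len)
      have i': "inc (lt1\<inverse>) (rev fs)" "inc (lt2\<inverse>) (rev fs)"
        using i1 i2 by (simp_all only: inc_converse rev_rev_ident)
      have "y \<in> ?L (lt1\<inverse>) \<and> x \<in> ?L (lt2\<inverse>)"
        by (rule d.inversion_both_low[OF dp dr imageI[OF X1] imageI[OF X2] i' _ _ _ low])
          (use fsS xy(1) yx in simp_all)
      then have "(x, y) \<in> lt1 \<inter> ?L (lt1\<inverse>) \<times> ?L (lt1\<inverse>)" using eqs(3) xy(1) by simp
      then show False using eqs(4) xy(2) by simp
    qed
  qed
  have inj: "inj_on inv \<X>"
  proof (rule inj_onI)
    fix lt1 lt2 assume *: "lt1 \<in> \<X>" "lt2 \<in> \<X>" "inv lt1 = inv lt2"
    then show "lt1 = lt2" using sub[of lt1 lt2] sub[of lt2 lt1] by (intro subset_antisym) simp_all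
  qed
  let ?A = "{A. finite A \<and> A \<subseteq> S}" and ?B = "{B. finite B \<and> B \<subseteq> S \<times> S}"
  have sub2: "inv ` \<X> \<subseteq> (?A \<times> ?B) \<times> (?A \<times> ?B)"
  proof
    fix t assume "t \<in> inv ` \<X>"
    then obtain l where l: "l \<in> \<X>" "t = inv l" by auto
    have lin: "linear_order_of S l" "linear_order_of S (l\<inverse>)"
      using X_linear[OF \<X>(1)[OF l(1)]] linear_order_of_converse by auto
    have "finite (?L l)" "finite (?L (l\<inverse>))" using lin by (auto intro: finite_low_part)
    moreover have "?L l \<subseteq> S" "?L (l\<inverse>) \<subseteq> S" by (simp_all add: low_part_def)
    ultimately show "t \<in> (?A \<times> ?B) \<times> (?A \<times> ?B)" unfolding l(2) inv_def by auto
  qed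
  have "countable ((?A \<times> ?B) \<times> (?A \<times> ?B))"
    using cS by (intro countable_SIGMA countable_Collect_finite_subset) auto
  from countable_image_inj_on[OF countable_subset[OF sub2 this] inj] have "countable \<X>" .
  then show ?thesis using F unfolding \<X>_def by blast
qed

end

section \<open>Orders with uncountably many cuts\<close>

definition uncountably_separated :: "'a set \<Rightarrow> 'a rel \<Rightarrow> 'a \<Rightarrow> 'a \<Rightarrow> bool" where
  "uncountably_separated S lt x y \<longleftrightarrow> uncountable {I \<in> initial_segments S lt. x \<in> I \<and> y \<notin> I}"

lemma uncountably_separated_dense:
  assumes "countable S" "uncountably_separated S lt x y"
  shows "\<exists>z\<in>S. uncountably_separated S lt x z \<and> uncountably_separated S lt z y"
proof (rule ccontr)
  let ?C = "\<lambda>x y. {I \<in> initial_segments S lt. x \<in> I \<and> y \<notin> I}"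
  define A where "A = {z \<in> S. countable (?C x z)}"
  define B where "B = {z \<in> S. countable (?C z y)}"
  assume "\<not> ?thesis"
  then have AB: "S \<subseteq> A \<union> B" by (auto simp: A_def B_def uncountably_separated_def)
  have sub: "?C x y \<subseteq> (\<Union>z\<in>A. ?C x z) \<union> (\<Union>z\<in>B. ?C z y) \<union> {A}"
  proof
    fix I assume I: "I \<in> ?C x y"
    have "I = A" if "\<forall>z\<in>A. I \<notin> ?C x z" "\<forall>z\<in>B. I \<notin> ?C z y"
    proof -
      have "A \<subseteq> I" using I that(1) by auto
      moreover have "z \<notin> B" if "z \<in> I" for z using I \<open>\<forall>z\<in>B. I \<notin> ?C z y\<close> that by auto
      moreover have "I \<subseteq> S" using I by (simp add: initial_segments_def)
      ultimately show ?thesis using AB by blast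
    qed
    then have "I = A \<or> (\<exists>z\<in>A. I \<in> ?C x z) \<or> (\<exists>z\<in>B. I \<in> ?C z y)" by meson
    then show "I \<in> (\<Union>z\<in>A. ?C x z) \<union> (\<Union>z\<in>B. ?C z y) \<union> {A}"
      unfolding Un_iff UN_iff singleton_iff by argo
  qed
  have AB_count: "countable A" "countable B" using assms(1) by (auto simp: A_def B_def)
  have "countable (\<Union>z\<in>A. ?C x z)"
    by (rule countable_UN[OF AB_count(1)]) (simp add: A_def)
  moreover have "countable (\<Union>z\<in>B. ?C z y)"
    by (rule countable_UN[OF AB_count(2)]) (simp add: B_def)
  ultimately have "countable ((\<Union>z\<in>A. ?C x z) \<union> (\<Union>z\<in>B. ?C z y) \<union> {A})"
    by (intro countable_Un) simp_all
  from countable_subset[OF sub this] show False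
    using assms(2) unfolding uncountably_separated_def by simp
qed

lemma exists_uncountably_separated:
  assumes "countable S" "uncountable (initial_segments S lt)"
  shows "\<exists>x\<in>S. \<exists>y\<in>S. uncountably_separated S lt x y"
proof (rule ccontr)
  assume *: "\<not> ?thesis"
  let ?C = "\<lambda>x y. {I \<in> initial_segments S lt. x \<in> I \<and> y \<notin> I}"
  have "initial_segments S lt \<subseteq> {{}, S} \<union> (\<Union>x\<in>S. \<Union>y\<in>S. ?C x y)"
  proof
    fix I assume I: "I \<in> initial_segments S lt"
    then have "I \<subseteq> S" by (simp add: initial_segments_def)
    then have "I = {} \<or> I = S \<or> (\<exists>x\<in>S. \<exists>y\<in>S. x \<in> I \<and> y \<notin> I)" by blast
    then have "I = {} \<or> I = S \<or> (\<exists>x\<in>S. \<exists>y\<in>S. I \<in> ?C x y)" using I by simp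
    then show "I \<in> {{}, S} \<union> (\<Union>x\<in>S. \<Union>y\<in>S. ?C x y)"
      unfolding Un_iff UN_iff insert_iff by argo
  qed
  moreover have "countable (\<Union>x\<in>S. \<Union>y\<in>S. ?C x y)"
  proof (rule countable_UN[OF assms(1)], rule countable_UN[OF assms(1)])
    show "countable (?C x y)" if "x \<in> S" "y \<in> S" for x y
    proof -
      have "\<not> uncountably_separated S lt x y" using * that by blast
      then show ?thesis by (simp add: uncountably_separated_def)
    qed
  qed
  then have "countable ({{}, S} \<union> (\<Union>x\<in>S. \<Union>y\<in>S. ?C x y))" by (intro countable_Un) simp_all
  ultimately show False using assms(2) countable_subset[of "initial_segments S lt"] by simp
qed

lemma uncountably_separatedD:
  assumes lin: "linear_order_of S lt" and S: "x \<in> S" "y \<in> S" and sep: "uncountably_separated S lt x y"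
  shows "(x, y) \<in> lt" "(y, z) \<in> lt \<Longrightarrow> uncountably_separated S lt x z"
    "(z, x) \<in> lt \<Longrightarrow> uncountably_separated S lt z y"
proof -
  have "{I \<in> initial_segments S lt. x \<in> I \<and> y \<notin> I} \<noteq> {}"
    using sep uncountable_infinite[of "{I \<in> initial_segments S lt. x \<in> I \<and> y \<notin> I}"]
    unfolding uncountably_separated_def by (metis finite.emptyI)
  then obtain I where I: "I \<in> initial_segments S lt" "x \<in> I" "y \<notin> I" by blast
  then have "(y, x) \<notin> lt" "x \<noteq> y" by (auto simp: initial_segments_def)
  then show "(x, y) \<in> lt" using linear_order_ofD(6)[OF lin S] by blast
  show "uncountably_separated S lt x z" if "(y, z) \<in> lt"
  proof -
    have "{I \<in> initial_segments S lt. x \<in> I \<and> y \<notin> I} \<subseteq> {I \<in> initial_segments S lt. x \<in> I \<and> z \<notin> I}"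
      using that by (intro Collect_mono) (auto simp: initial_segments_def)
    then show ?thesis using sep countable_subset unfolding uncountably_separated_def by blast
  qed
  show "uncountably_separated S lt z y" if "(z, x) \<in> lt"
  proof -
    have "{I \<in> initial_segments S lt. x \<in> I \<and> y \<notin> I} \<subseteq> {I \<in> initial_segments S lt. z \<in> I \<and> y \<notin> I}"
      using that by (intro Collect_mono) (auto simp: initial_segments_def)
    then show ?thesis using sep countable_subset unfolding uncountably_separated_def by blast
  qed
qed

lemma finite_has_greatest:
  assumes "linear_order_of S lt" "finite A" "A \<noteq> {}" "A \<subseteq> S"
  shows "\<exists>a\<in>A. \<forall>b\<in>A. b = a \<or> (b, a) \<in> lt"
proof -
  obtain xs where xs: "inc lt xs" "set xs = A" using inc_exists[OF assms(1,2,4)] by blast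
  then obtain ys a where "xs = ys @ [a]" using assms(3) by (cases xs rule: rev_cases) auto
  then show ?thesis using xs by (intro bexI[of _ a]) (auto simp: sorted_wrt_append)
qed

lemma uncountably_separated_between:
  assumes lin: "linear_order_of S lt" and cS: "countable S"
    and L: "finite L" "L \<noteq> {}" "L \<subseteq> S" and H: "finite H" "H \<noteq> {}" "H \<subseteq> S"
    and LH: "\<And>l h. l \<in> L \<Longrightarrow> h \<in> H \<Longrightarrow> uncountably_separated S lt l h"
  shows "\<exists>z\<in>S. (\<forall>l\<in>L. uncountably_separated S lt l z) \<and> (\<forall>h\<in>H. uncountably_separated S lt z h)"
proof -
  obtain l where l: "l \<in> L" "\<And>l'. l' \<in> L \<Longrightarrow> l' = l \<or> (l', l) \<in> lt"
    using finite_has_greatest[OF lin L] by blast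
  obtain h where h: "h \<in> H" "\<And>h'. h' \<in> H \<Longrightarrow> h' = h \<or> (h, h') \<in> lt"
    using finite_has_greatest[OF linear_order_of_converse[OF lin] H] by auto
  obtain z where z: "z \<in> S" "uncountably_separated S lt l z" "uncountably_separated S lt z h"
    using uncountably_separated_dense[OF cS LH[OF l(1) h(1)]] by blast
  have "uncountably_separated S lt l' z" if "l' \<in> L" for l'
    using l(2)[OF that] uncountably_separatedD(3)[OF lin _ z(1,2)] z(2) l(1) L by blast
  moreover have "uncountably_separated S lt z h'" if "h' \<in> H" for h'
    using h(2)[OF that] uncountably_separatedD(2)[OF lin z(1) _ z(3)] z(3) h(1) H by blast
  ultimately show ?thesis using z(1) by blast
qed

lemma countable_order_embeds:
  assumes lin: "linear_order_of S lt" and cS: "countable S"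
    and unc: "uncountable (initial_segments S lt)"
    and linT: "linear_order_of T lt2" and cT: "countable T"
  shows "\<exists>f. (\<forall>x\<in>T. f x \<in> S) \<and> (\<forall>x\<in>T. \<forall>y\<in>T. (x, y) \<in> lt2 \<longrightarrow> (f x, f y) \<in> lt)"
proof (cases "T = {}")
  case False
  define t where "t = from_nat_into T"
  have tT: "t n \<in> T" for n using False by (simp add: t_def from_nat_into)
  have surj: "\<exists>n. t n = x" if "x \<in> T" for x
    using from_nat_into_surj[OF cT that] by (auto simp: t_def)
  obtain a b where ab: "a \<in> S" "b \<in> S" "uncountably_separated S lt a b"
    using exists_uncountably_separated[OF cS unc] by blast
  let ?sep = "uncountably_separated S lt"
  define P where "P n f \<longleftrightarrow> (\<forall>x\<in>t ` {..<n}. f x \<in> S \<and> ?sep a (f x) \<and> ?sep (f x) b \<and>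
      (\<forall>y\<in>t ` {..<n}. (x, y) \<in> lt2 \<longrightarrow> ?sep (f x) (f y)))" for n :: nat and f
  define Q where "Q n f f' \<longleftrightarrow> (\<forall>x\<in>t ` {..<n}. f' x = f x)" for n :: nat and f f' :: "'b \<Rightarrow> 'a"
  have "\<exists>F. \<forall>n. P n (F n) \<and> Q n (F n) (F (Suc n))"
  proof (rule dependent_nat_choice)
    show "\<exists>f. P 0 f" by (simp add: P_def)
  next
    fix f n assume f: "P n f"
    let ?D = "t ` {..<n}"
    have D: "t ` {..<Suc n} = insert (t n) ?D" by (simp add: lessThan_Suc)
    show "\<exists>f'. P (Suc n) f' \<and> Q n f f'"
    proof (cases "t n \<in> ?D")
      case True
      then show ?thesis using f by (intro exI[of _ f]) (simp add: P_def Q_def D insert_absorb)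
    next
      case new: False
      define L where "L = insert a (f ` {x \<in> ?D. (x, t n) \<in> lt2})"
      define H where "H = insert b (f ` {x \<in> ?D. (t n, x) \<in> lt2})"
      have fD: "f x \<in> S" "?sep a (f x)" "?sep (f x) b" if "x \<in> ?D" for x
        using f that by (auto simp: P_def)
      have fDD: "?sep (f x) (f y)" if "x \<in> ?D" "y \<in> ?D" "(x, y) \<in> lt2" for x y
        using f that by (auto simp: P_def)
      have LH: "?sep l h" if "l \<in> L" "h \<in> H" for l h
      proof -
        consider "l = a" "h = b" | y where "l = a" "y \<in> ?D" "h = f y"
          | x where "h = b" "x \<in> ?D" "l = f x"
          | x y where "x \<in> ?D" "y \<in> ?D" "(x, t n) \<in> lt2" "(t n, y) \<in> lt2" "l = f x" "h = f y"
          using \<open>l \<in> L\<close> \<open>h \<in> H\<close> unfolding L_def H_def by blast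
        then show ?thesis
        proof cases
          case (4 x y)
          then show ?thesis using fDD linear_order_ofD(4)[OF linT 4(3,4)] by simp
        qed (use ab fD in auto)
      qed
      have "\<exists>z\<in>S. (\<forall>l\<in>L. ?sep l z) \<and> (\<forall>h\<in>H. ?sep z h)"
        by (rule uncountably_separated_between[OF lin cS])
          (use ab fD(1) LH in \<open>auto simp: L_def H_def\<close>)
      then obtain z where z: "z \<in> S" "\<And>l. l \<in> L \<Longrightarrow> ?sep l z" "\<And>h. h \<in> H \<Longrightarrow> ?sep z h" by blast
      have ne: "x \<noteq> t n" if "x \<in> ?D" for x using that new by blast
      have irr: "(t n, t n) \<notin> lt2" by (rule linear_order_ofD(3)[OF linT])
      have "P (Suc n) (f(t n := z))"
        unfolding P_def D
      proof (intro ballI conjI impI)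
        fix x assume x: "x \<in> insert (t n) ?D"
        show "(f(t n := z)) x \<in> S" using x z(1) fD(1) by auto
        show "?sep a ((f(t n := z)) x)" using x z(2)[of a] fD(2) by (auto simp: L_def)
        show "?sep ((f(t n := z)) x) b" using x z(3)[of b] fD(3) by (auto simp: H_def)
        fix y assume y: "y \<in> insert (t n) ?D" and xy: "(x, y) \<in> lt2"
        consider "x = t n" "y \<in> ?D" | "x \<in> ?D" "y = t n" | "x \<in> ?D" "y \<in> ?D"
          using x y xy irr by blast
        then show "?sep ((f(t n := z)) x) ((f(t n := z)) y)"
        proof cases
          case 1
          then have "f y \<in> H" using xy by (simp add: H_def)
          then show ?thesis using z(3) 1 ne by simp
        next
          case 2
          then have "f x \<in> L" using xy by (simp add: L_def)
          then show ?thesis using z(2) 2 ne by simp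
        next
          case 3
          then show ?thesis using fDD[OF 3 xy] ne by simp
        qed
      qed
      moreover have "Q n f (f(t n := z))" using ne by (simp add: Q_def)
      ultimately show ?thesis by blast
    qed
  qed
  then obtain F where P: "\<And>n. P n (F n)" and Q: "\<And>n. Q n (F n) (F (Suc n))" by blast
  have ext: "F m (t i) = F n (t i)" if "i < n" "n \<le> m" for i n m
    using that(2,1)
  proof (induction m rule: dec_induct)
    case (step m)
    then show ?case using Q[of m] by (simp add: Q_def)
  qed simp
  define g where "g x = F (Suc (LEAST n. t n = x)) x" for x
  have g: "\<exists>i. x = t i \<and> (\<forall>n>i. g x = F n x)" if "x \<in> T" for x
  proof -
    define i where "i = (LEAST n. t n = x)"
    have ti: "t i = x" unfolding i_def using surj[OF that] by (rule LeastI_ex)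
    have "g x = F n x" if "n > i" for n
      using ext[of i "Suc i" n] that ti by (simp add: g_def i_def)
    then show ?thesis using ti by blast
  qed
  have "g x \<in> S \<and> g y \<in> S \<and> ((x, y) \<in> lt2 \<longrightarrow> (g x, g y) \<in> lt)" if xy: "x \<in> T" "y \<in> T" for x y
  proof -
    obtain i j where ij: "x = t i" "\<forall>n>i. g x = F n x" "y = t j" "\<forall>n>j. g y = F n y"
      using g xy by metis
    define n where "n = Suc (max i j)"
    have eq: "g x = F n x" "g y = F n y" using ij by (auto simp: n_def)
    have "x \<in> t ` {..<n}" "y \<in> t ` {..<n}" using ij by (auto simp: n_def)
    then have "F n x \<in> S" "F n y \<in> S" "(x, y) \<in> lt2 \<Longrightarrow> ?sep (F n x) (F n y)"
      using P[of n] unfolding P_def by blast+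
    then show ?thesis unfolding eq using uncountably_separatedD(1)[OF lin] by blast
  qed
  then show ?thesis by blast
qed simp

section \<open>Orders chaining a structure by given formulas\<close>

lemma qf_sat_cong:
  assumes "qf_vars \<phi> \<subseteq> {..<n}"
    and "\<And>i j. i < n \<Longrightarrow> j < n \<Longrightarrow> (a ! i, a ! j) \<in> r \<longleftrightarrow> (b ! i, b ! j) \<in> r'"
    and "\<And>i j. i < n \<Longrightarrow> j < n \<Longrightarrow> a ! i = a ! j \<longleftrightarrow> b ! i = b ! j"
  shows "qf_sat r a \<phi> \<longleftrightarrow> qf_sat r' b \<phi>"
  using assms(1) by (induction \<phi>) (auto simp: assms(2,3))

lemma qf_sat_map:
  assumes "qf_vars \<phi> \<subseteq> {..<length a}" "set a \<subseteq> A" "inj_on f A"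
    and "\<And>x y. x \<in> A \<Longrightarrow> y \<in> A \<Longrightarrow> (x, y) \<in> r \<longleftrightarrow> (f x, f y) \<in> r'"
  shows "qf_sat r a \<phi> \<longleftrightarrow> qf_sat r' (map f a) \<phi>"
proof (rule qf_sat_cong[OF assms(1)])
  fix i j assume "i < length a" "j < length a"
  then have "a ! i \<in> A" "a ! j \<in> A" "map f a ! i = f (a ! i)" "map f a ! j = f (a ! j)"
    using assms(2) by auto
  then show "(a ! i, a ! j) \<in> r \<longleftrightarrow> (map f a ! i, map f a ! j) \<in> r'"
    "a ! i = a ! j \<longleftrightarrow> map f a ! i = map f a ! j"
    using assms(3,4) by (auto dest: inj_onD)
qed

primrec list_order :: "'a list \<Rightarrow> 'a rel" where
  "list_order [] = {}"
| "list_order (x # xs) = {x} \<times> set xs \<union> list_order xs"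

lemma list_order_subset: "list_order xs \<subseteq> set xs \<times> set xs"
  by (induction xs) auto

lemma list_order_filter: "list_order (filter P xs) = list_order xs \<inter> {x. P x} \<times> {x. P x}"
proof (induction xs)
  case (Cons x xs)
  then show ?case using list_order_subset[of xs] by auto
qed simp

lemma list_order_map:
  assumes "inj_on f (set xs)" "x \<in> set xs" "y \<in> set xs"
  shows "(f x, f y) \<in> list_order (map f xs) \<longleftrightarrow> (x, y) \<in> list_order xs"
proof -
  have sub: "list_order xs \<subseteq> set xs \<times> set xs" by (rule list_order_subset)
  have "list_order (map f zs) = map_prod f f ` list_order zs" for zs
  proof (induction zs)
    case (Cons z zs)
    have "{f z} \<times> f ` set zs = map_prod f f ` ({z} \<times> set zs)" by force
    then show ?case using Cons by (simp add: image_Un)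
  qed simp
  then have "(f x, f y) \<in> list_order (map f xs) \<longleftrightarrow>
      map_prod f f (x, y) \<in> map_prod f f ` list_order xs" by simp
  also have "\<dots> \<longleftrightarrow> (x, y) \<in> list_order xs"
    by (rule inj_on_image_mem_iff[OF map_prod_inj_on[OF assms(1) assms(1)]]) (use assms sub in auto)
  finally show ?thesis .
qed

lemma list_order_inc:
  assumes lin: "linear_order_of S lt"
  shows "inc lt xs \<Longrightarrow> x \<in> set xs \<Longrightarrow> y \<in> set xs \<Longrightarrow> (x, y) \<in> list_order xs \<longleftrightarrow> (x, y) \<in> lt"
proof (induction xs)
  case (Cons z zs)
  have "z \<notin> set zs" using inc_distinct[OF lin Cons.prems(1)] by simp
  moreover have "(x, z) \<notin> list_order zs" "(z, y) \<notin> list_order zs" for x y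
    using list_order_subset[of zs] \<open>z \<notin> set zs\<close> by auto
  moreover have "(x, z) \<notin> lt" if "x \<in> set (z # zs)" for x
    using that Cons.prems(1) linear_order_ofD(3,5)[OF lin] by auto
  ultimately show ?case using Cons by auto
qed simp

lemma tuples_mono: "A \<subseteq> B \<Longrightarrow> tuples h A \<subseteq> tuples h B"
  by (auto simp: tuples_def)

lemma map_in_tuples: "a \<in> tuples h A \<Longrightarrow> (\<And>x. x \<in> A \<Longrightarrow> f x \<in> B) \<Longrightarrow> map f a \<in> tuples h B"
  by (auto simp: tuples_def)

lemma length_tuples: "a \<in> tuples h A \<Longrightarrow> length a = h"
  by (simp add: tuples_def)

definition same_structure :: "'r set \<Rightarrow> ('r \<Rightarrow> nat) \<Rightarrow> ('r \<Rightarrow> qf) \<Rightarrow> 'a list \<Rightarrow> 'a list \<Rightarrow> bool" where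
  "same_structure L ar \<phi> xs ys \<longleftrightarrow> set xs = set ys \<and> (\<forall>R\<in>L. \<forall>a\<in>tuples (ar R) (set xs).
     qf_sat (list_order xs) a (\<phi> R) \<longleftrightarrow> qf_sat (list_order ys) a (\<phi> R))"

definition chaining_orders ::
    "'r set \<Rightarrow> ('r \<Rightarrow> nat) \<Rightarrow> ('r \<Rightarrow> qf) \<Rightarrow> ('r, 'a) rel_struct \<Rightarrow> 'a rel set" where
  "chaining_orders L ar \<phi> \<S> = {lt. linear_order_of (universe \<S>) lt \<and>
     (\<forall>R\<in>L. \<forall>a\<in>tuples (ar R) (universe \<S>). a \<in> interp \<S> R \<longleftrightarrow> qf_sat lt a (\<phi> R))}"

lemma pattern_equiv_same_structure:
  assumes inf: "infinite (UNIV :: 'a set)" and vars: "\<And>R. R \<in> L \<Longrightarrow> qf_vars (\<phi> R) \<subseteq> {..<ar R}"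
  shows "pattern_equiv (same_structure L ar \<phi> :: 'a list \<Rightarrow> 'a list \<Rightarrow> bool)"
proof
  show "same_structure L ar \<phi> xs zs"
    if "same_structure L ar \<phi> xs ys" "same_structure L ar \<phi> ys zs" for xs ys zs :: "'a list"
    using that unfolding same_structure_def by simp
  show "same_structure L ar \<phi> ys xs" if "same_structure L ar \<phi> xs ys" for xs ys :: "'a list"
    using that unfolding same_structure_def by simp
  show "same_structure L ar \<phi> (map f xs) (map f ys)"
    if E: "same_structure L ar \<phi> xs ys" and inj: "inj_on f (set xs \<union> set ys)" for xs ys :: "'a list" and f
    unfolding same_structure_def
  proof (intro conjI ballI)
    have st: "set xs = set ys" using E by (simp add: same_structure_def)
    then have inj': "inj_on f (set xs)" "inj_on f (set ys)" using inj by simp_all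
    show "set (map f xs) = set (map f ys)" using st by simp
    fix R a assume R: "R \<in> L" and a: "a \<in> tuples (ar R) (set (map f xs))"
    define b where "b = map (inv_into (set xs) f) a"
    have b: "b \<in> tuples (ar R) (set xs)"
      unfolding b_def using a by (rule map_in_tuples) (auto intro: inv_into_into)
    have ab: "a = map f b"
      using a unfolding b_def tuples_def by (auto simp: f_inv_into_f subset_iff intro!: nth_equalityI)
    have lb: "qf_vars (\<phi> R) \<subseteq> {..<length b}" "set b \<subseteq> set xs" using vars[OF R] b by (auto simp: tuples_def)
    have "qf_sat (list_order xs) b (\<phi> R) \<longleftrightarrow> qf_sat (list_order (map f xs)) a (\<phi> R)"
      unfolding ab by (rule qf_sat_map[OF lb inj'(1)]) (simp add: list_order_map inj')
    moreover have "qf_sat (list_order ys) b (\<phi> R) \<longleftrightarrow> qf_sat (list_order (map f ys)) a (\<phi> R)"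
      unfolding ab by (rule qf_sat_map[OF lb inj'(1)]) (simp add: list_order_map inj' st)
    moreover have "qf_sat (list_order xs) b (\<phi> R) \<longleftrightarrow> qf_sat (list_order ys) b (\<phi> R)"
      using E R b by (simp add: same_structure_def)
    ultimately show "qf_sat (list_order (map f xs)) a (\<phi> R) \<longleftrightarrow> qf_sat (list_order (map f ys)) a (\<phi> R)"
      by simp
  qed
  show "same_structure L ar \<phi> (filter P xs) (filter P ys)"
    if E: "same_structure L ar \<phi> xs ys" for xs ys :: "'a list" and P
    unfolding same_structure_def
  proof (intro conjI ballI)
    show "set (filter P xs) = set (filter P ys)" using E by (simp add: same_structure_def)
    fix R a assume R: "R \<in> L" and a: "a \<in> tuples (ar R) (set (filter P xs))"
    have *: "qf_sat (list_order (filter P zs)) a (\<phi> R) \<longleftrightarrow> qf_sat (list_order zs) a (\<phi> R)" for zs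
    proof (rule qf_sat_cong[OF vars[OF R]])
      fix i j assume "i < ar R" "j < ar R"
      then have "a ! i \<in> set a" "a ! j \<in> set a" using length_tuples[OF a] by simp_all
      then have "P (a ! i)" "P (a ! j)" using a by (auto simp: tuples_def)
      then show "(a ! i, a ! j) \<in> list_order (filter P zs) \<longleftrightarrow> (a ! i, a ! j) \<in> list_order zs"
        by (simp add: list_order_filter)
    qed simp
    have "a \<in> tuples (ar R) (set xs)" using a by (auto simp: tuples_def)
    then show "qf_sat (list_order (filter P xs)) a (\<phi> R) \<longleftrightarrow> qf_sat (list_order (filter P ys)) a (\<phi> R)"
      unfolding * using E R by (simp add: same_structure_def)
  qed
qed (simp_all add: inf same_structure_def)

lemma qf_sat_list_order:
  assumes lin: "linear_order_of S lt" and "inc lt xs" "a \<in> tuples h (set xs)" "qf_vars \<phi> \<subseteq> {..<h}"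
  shows "qf_sat (list_order xs) a \<phi> \<longleftrightarrow> qf_sat lt a \<phi>"
proof (rule qf_sat_cong[OF assms(4)])
  fix i j assume "i < h" "j < h"
  then have "a ! i \<in> set xs" "a ! j \<in> set xs" using assms(3) by (auto simp: tuples_def)
  then show "(a ! i, a ! j) \<in> list_order xs \<longleftrightarrow> (a ! i, a ! j) \<in> lt"
    using list_order_inc[OF lin assms(2)] by blast
qed simp

lemma order_family_chaining_orders:
  fixes \<S> :: "('r, 'a) rel_struct"
  assumes "infinite (universe \<S>)" and vars: "\<And>R. R \<in> L \<Longrightarrow> qf_vars (\<phi> R) \<subseteq> {..<ar R}"
  shows "order_family (same_structure L ar \<phi>) (universe \<S>) (chaining_orders L ar \<phi> \<S>)"
proof -
  have "infinite (UNIV :: 'a set)" using assms(1) finite_subset subset_UNIV by blast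
  then interpret pattern_equiv "same_structure L ar \<phi> :: 'a list \<Rightarrow> 'a list \<Rightarrow> bool"
    using vars by (rule pattern_equiv_same_structure)
  show ?thesis
  proof
    show "linear_order_of (universe \<S>) lt" if "lt \<in> chaining_orders L ar \<phi> \<S>" for lt
      using that by (simp add: chaining_orders_def)
    show "same_structure L ar \<phi> xs ys"
      if X: "lt \<in> chaining_orders L ar \<phi> \<S>" "lt' \<in> chaining_orders L ar \<phi> \<S>"
        and incs: "inc lt xs" "inc lt' ys" and st: "set xs = set ys" "set xs \<subseteq> universe \<S>" for lt lt' xs ys
      unfolding same_structure_def
    proof (intro conjI ballI)
      fix R a assume R: "R \<in> L" and a: "a \<in> tuples (ar R) (set xs)"
      have lin: "linear_order_of (universe \<S>) lt" "linear_order_of (universe \<S>) lt'"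
        using X by (simp_all add: chaining_orders_def)
      have aS: "a \<in> tuples (ar R) (universe \<S>)" using a st(2) tuples_mono by blast
      have "qf_sat (list_order xs) a (\<phi> R) \<longleftrightarrow> qf_sat lt a (\<phi> R)"
        by (rule qf_sat_list_order[OF lin(1) incs(1) a vars[OF R]])
      also have "\<dots> \<longleftrightarrow> qf_sat lt' a (\<phi> R)" using X R aS by (simp add: chaining_orders_def)
      also have "\<dots> \<longleftrightarrow> qf_sat (list_order ys) a (\<phi> R)"
        using qf_sat_list_order[OF lin(2) incs(2) _ vars[OF R]] a st(1) by simp
      finally show "qf_sat (list_order xs) a (\<phi> R) \<longleftrightarrow> qf_sat (list_order ys) a (\<phi> R)" .
    qed (rule st(1))
  qed
qed

definition pullback :: "'a set \<Rightarrow> ('a \<Rightarrow> 'a) \<Rightarrow> 'a rel \<Rightarrow> 'a rel" where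
  "pullback S w lt = {(x, y). x \<in> S \<and> y \<in> S \<and> (w x, w y) \<in> lt}"

lemma EmbD:
  assumes "f \<in> Emb L ar \<A> \<B>"
  shows "x \<in> universe \<A> \<Longrightarrow> f x \<in> universe \<B>" "inj_on f (universe \<A>)"
    "R \<in> L \<Longrightarrow> a \<in> tuples (ar R) (universe \<A>) \<Longrightarrow> a \<in> interp \<A> R \<longleftrightarrow> map f a \<in> interp \<B> R"
    "f \<in> extensional (universe \<A>)"
  using assms unfolding Emb_def by (auto simp: PiE_def)

lemma compose_Emb:
  assumes f: "f \<in> Emb L ar \<A> \<B>" and g: "g \<in> Emb L ar \<B> \<C>"
  shows "compose (universe \<A>) g f \<in> Emb L ar \<A> \<C>"
  unfolding Emb_def
proof (intro CollectI conjI ballI)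
  let ?h = "compose (universe \<A>) g f"
  show "?h \<in> universe \<A> \<rightarrow>\<^sub>E universe \<C>"
    using EmbD(1)[OF f] EmbD(1)[OF g] by (auto simp: compose_def)
  have "inj_on (g \<circ> f) (universe \<A>)"
    using EmbD(1,2)[OF f] EmbD(2)[OF g] by (intro comp_inj_on) (auto intro: inj_on_subset)
  then show "inj_on ?h (universe \<A>)" by (auto simp: inj_on_def compose_def)
  fix R a assume R: "R \<in> L" and a: "a \<in> tuples (ar R) (universe \<A>)"
  have mh: "map ?h a = map g (map f a)" using a by (auto simp: tuples_def compose_def)
  have "map f a \<in> tuples (ar R) (universe \<B>)"
    using a EmbD(1)[OF f] by (rule map_in_tuples)
  then show "a \<in> interp \<A> R \<longleftrightarrow> map ?h a \<in> interp \<C> R"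
    unfolding mh using EmbD(3)[OF f R a] EmbD(3)[OF g R] by blast
qed

lemma linear_order_of_pullback:
  assumes lin: "linear_order_of S lt" and w: "inj_on w S" "\<And>x. x \<in> S \<Longrightarrow> w x \<in> S"
  shows "linear_order_of S (pullback S w lt)"
  unfolding linear_order_of_def strict_linear_order_on_def
proof (intro conjI)
  show "pullback S w lt \<subseteq> S \<times> S" by (auto simp: pullback_def)
  show "trans (pullback S w lt)"
    by (rule transI) (auto simp: pullback_def intro: linear_order_ofD(4)[OF lin])
  show "irrefl (pullback S w lt)" by (auto simp: pullback_def irrefl_def linear_order_ofD(3)[OF lin])
  show "total_on S (pullback S w lt)"
    unfolding total_on_def
  proof (intro ballI impI)
    fix x y assume xy: "x \<in> S" "y \<in> S" "x \<noteq> y"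
    then have "w x \<noteq> w y" using w(1) by (auto dest: inj_onD)
    then show "(x, y) \<in> pullback S w lt \<or> (y, x) \<in> pullback S w lt"
      using linear_order_ofD(6)[OF lin, of "w x" "w y"] w(2) xy by (simp add: pullback_def)
  qed
qed

lemma pullback_chaining_orders:
  assumes vars: "\<And>R. R \<in> L \<Longrightarrow> qf_vars (\<phi> R) \<subseteq> {..<ar R}"
    and lt: "lt \<in> chaining_orders L ar \<phi> \<S>" and w: "w \<in> Emb L ar \<S> \<S>"
  shows "pullback (universe \<S>) w lt \<in> chaining_orders L ar \<phi> \<S>"
  unfolding chaining_orders_def
proof (intro CollectI conjI ballI)
  have lin: "linear_order_of (universe \<S>) lt" using lt by (simp add: chaining_orders_def)
  show "linear_order_of (universe \<S>) (pullback (universe \<S>) w lt)"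
    using linear_order_of_pullback[OF lin EmbD(2)[OF w] EmbD(1)[OF w]] .
  fix R a assume R: "R \<in> L" and a: "a \<in> tuples (ar R) (universe \<S>)"
  have "a \<in> interp \<S> R \<longleftrightarrow> map w a \<in> interp \<S> R" using EmbD(3)[OF w R a] .
  also have "\<dots> \<longleftrightarrow> qf_sat lt (map w a) (\<phi> R)"
    using lt R map_in_tuples[OF a EmbD(1)[OF w]] by (simp add: chaining_orders_def)
  also have "\<dots> \<longleftrightarrow> qf_sat (pullback (universe \<S>) w lt) a (\<phi> R)"
    by (rule qf_sat_map[symmetric, OF _ _ EmbD(2)[OF w]])
      (use vars[OF R] a in \<open>auto simp: tuples_def pullback_def\<close>)
  finally show "a \<in> interp \<S> R \<longleftrightarrow> qf_sat (pullback (universe \<S>) w lt) a (\<phi> R)" .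
qed

section \<open>Recurrent orders\<close>

definition recurrent_order :: "'a set \<Rightarrow> ('a \<Rightarrow> 'a) set \<Rightarrow> 'a rel \<Rightarrow> bool" where
  "recurrent_order S W lt \<longleftrightarrow> (\<forall>w\<in>W. \<exists>u. (\<forall>x\<in>S. u x \<in> S) \<and>
     (\<forall>x\<in>S. \<forall>y\<in>S. (x, y) \<in> lt \<longleftrightarrow> (w (u x), w (u y)) \<in> lt))"

lemma recurrent_omega_order:
  assumes inf: "infinite S" and cS: "countable S"
    and W: "\<And>w x. w \<in> W \<Longrightarrow> x \<in> S \<Longrightarrow> w x \<in> S" "\<And>w. w \<in> W \<Longrightarrow> inj_on w S"
  shows "\<exists>lt. linear_order_of S lt \<and> recurrent_order S W lt"
proof -
  define e where "e = to_nat_on S"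
  have e: "inj_on e S" unfolding e_def using inj_on_to_nat_on[OF cS] .
  define lt where "lt = {(x, y). x \<in> S \<and> y \<in> S \<and> e x < e y}"
  have "linear_order_of S lt"
    unfolding linear_order_of_def strict_linear_order_on_def
  proof (intro conjI)
    show "total_on S lt"
      unfolding total_on_def lt_def using e by (auto dest: inj_onD) (metis inj_onD linorder_neqE_nat)
  qed (auto simp: lt_def irrefl_def intro!: transI)
  moreover have "recurrent_order S W lt"
    unfolding recurrent_order_def
  proof
    fix w assume w: "w \<in> W"
    define N where "N = (e \<circ> w) ` S"
    have "inj_on (e \<circ> w) S"
      using W w e by (intro comp_inj_on) (auto intro: inj_on_subset)
    then have N: "infinite N" using inf finite_imageD unfolding N_def by blast
    have "\<exists>s\<in>S. e (w s) = enumerate N (e x)" for x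
      using enumerate_in_set[OF N, of "e x"] unfolding N_def by auto
    then obtain u where u: "\<And>x. u x \<in> S" "\<And>x. e (w (u x)) = enumerate N (e x)" by metis
    have "(x, y) \<in> lt \<longleftrightarrow> (w (u x), w (u y)) \<in> lt" if "x \<in> S" "y \<in> S" for x y
      using that u W(1)[OF w] N by (simp add: lt_def)
    then show "\<exists>u. (\<forall>x\<in>S. u x \<in> S) \<and> (\<forall>x\<in>S. \<forall>y\<in>S. (x, y) \<in> lt \<longleftrightarrow> (w (u x), w (u y)) \<in> lt)"
      using u(1) by blast
  qed
  ultimately show ?thesis by blast
qed

lemma clopen_qf_sat:
  "open {f. qf_sat (Collect f) a \<phi>} \<and> closed {f. qf_sat (Collect f) a \<phi>}"
proof (induction \<phi>)
  case (QLess i j)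
  show ?case using clopen_coordinate(1,2)[of "(a ! i, a ! j)"] by simp
next
  case (QNot \<phi>)
  then show ?case by (simp add: open_Collect_neg closed_Collect_neg)
next
  case (QAnd \<phi> \<psi>)
  then show ?case by (simp add: open_Collect_conj closed_Collect_conj)
next
  case (QOr \<phi> \<psi>)
  then show ?case by (simp add: open_Collect_disj closed_Collect_disj)
qed simp_all

lemma closed_linear_orders: "closed {f. linear_order_of S (Collect f)}"
proof -
  have "linear_order_of S (Collect f) \<longleftrightarrow> (\<forall>p. f p \<longrightarrow> p \<in> S \<times> S) \<and> (\<forall>x. \<not> f (x, x)) \<and>
      (\<forall>x y z. f (x, y) \<longrightarrow> f (y, z) \<longrightarrow> f (x, z)) \<and>
      (\<forall>x y. x \<in> S \<and> y \<in> S \<and> x \<noteq> y \<longrightarrow> f (x, y) \<or> f (y, x))" for f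
    unfolding linear_order_of_def strict_linear_order_on_def trans_def irrefl_def total_on_def by auto
  then show ?thesis
    by (auto intro!: closed_Collect_conj closed_Collect_all closed_Collect_imp closed_Collect_disj
        closed_Collect_neg clopen_coordinate open_Collect_const closed_Collect_const)
qed

lemma closed_chaining_orders: "closed {f. Collect f \<in> chaining_orders L ar \<phi> \<S>}"
proof -
  have "closed {f. a \<in> interp \<S> R \<longleftrightarrow> qf_sat (Collect f) a (\<phi> R)}" for a R
    using clopen_qf_sat[of a "\<phi> R"] by (cases "a \<in> interp \<S> R") (simp_all add: closed_Collect_neg)
  then have "closed {f. \<forall>R. R \<in> L \<longrightarrow> (\<forall>a. a \<in> tuples (ar R) (universe \<S>) \<longrightarrow>
      (a \<in> interp \<S> R \<longleftrightarrow> qf_sat (Collect f) a (\<phi> R)))}"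
    by (intro closed_Collect_all closed_Collect_imp open_Collect_const)
  from closed_Collect_conj[OF closed_linear_orders this] show ?thesis
    unfolding chaining_orders_def Ball_def mem_Collect_eq .
qed

theorem recurrent_chaining_order:
  fixes \<S> :: "('r, 'a) rel_struct"
  assumes inf: "infinite (universe \<S>)" and cS: "countable (universe \<S>)"
    and vars: "\<And>R. R \<in> L \<Longrightarrow> qf_vars (\<phi> R) \<subseteq> {..<ar R}"
    and ne: "chaining_orders L ar \<phi> \<S> \<noteq> {}"
  shows "\<exists>lt\<in>chaining_orders L ar \<phi> \<S>. recurrent_order (universe \<S>) (Emb L ar \<S> \<S>) lt"
proof -
  let ?S = "universe \<S>" and ?E = "Emb L ar \<S> \<S>"
  define X where "X = chaining_orders L ar \<phi> \<S>"
  interpret order_family "same_structure L ar \<phi>" ?S X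
    unfolding X_def using inf vars by (rule order_family_chaining_orders)
  show ?thesis
  proof (cases "\<forall>i j. cyc i 1 j")
    case True
    obtain lt0 where lt0: "lt0 \<in> X" using ne by (auto simp: X_def)
    have "\<exists>lt. linear_order_of ?S lt \<and> recurrent_order ?S ?E lt"
      by (rule recurrent_omega_order[OF inf cS]) (simp_all add: EmbD(1,2))
    then obtain lt where lt: "linear_order_of ?S lt" "recurrent_order ?S ?E lt" by blast
    have "a \<in> interp \<S> R \<longleftrightarrow> qf_sat lt a (\<phi> R)" if R: "R \<in> L" and a: "a \<in> tuples (ar R) ?S" for R a
    proof -
      have A: "finite (set a)" "set a \<subseteq> ?S" using a by (auto simp: tuples_def)
      obtain xs where xs: "inc lt xs" "set xs = set a" using inc_exists[OF lt(1) A] by blast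
      obtain ys where ys: "inc lt0 ys" "set ys = set a" using inc_exists[OF X_linear[OF lt0] A] by blast
      have "same_structure L ar \<phi> xs ys"
        by (rule E_all) (use True xs ys inc_distinct[OF lt(1) xs(1)] inc_distinct[OF X_linear[OF lt0] ys(1)] in auto)
      moreover have a': "a \<in> tuples (ar R) (set xs)" "a \<in> tuples (ar R) (set ys)"
        using a xs ys by (auto simp: tuples_def)
      ultimately have "qf_sat (list_order xs) a (\<phi> R) \<longleftrightarrow> qf_sat (list_order ys) a (\<phi> R)"
        using R by (simp add: same_structure_def)
      then have "qf_sat lt a (\<phi> R) \<longleftrightarrow> qf_sat lt0 a (\<phi> R)"
        using qf_sat_list_order[OF lt(1) xs(1) a'(1) vars[OF R]]
          qf_sat_list_order[OF X_linear[OF lt0] ys(1) a'(2) vars[OF R]] by simp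
      then show ?thesis using lt0 R a by (simp add: X_def chaining_orders_def)
    qed
    then have "lt \<in> chaining_orders L ar \<phi> \<S>" using lt(1) by (simp add: chaining_orders_def)
    then show ?thesis using lt(2) by blast
  next
    case False
    then obtain i j where "\<not> cyc i 1 j" by blast
    then have p: "\<not> cyc (max i j) 1 (max i j)" using cyc_mono by fastforce
    define \<X> where "\<X> = {f. Collect f \<in> X}"
    define g where "g w f = (\<lambda>p. p \<in> pullback ?S w (Collect f))" for w and f :: "'a \<times> 'a \<Rightarrow> bool"
    have Cg: "Collect (g w f) = pullback ?S w (Collect f)" for w f by (simp add: g_def)
    have "closed \<X>" unfolding \<X>_def X_def by (rule closed_chaining_orders)
    then have "compact \<X>" using compact_Int_closed[OF compact_UNIV_bool_fun] by fastforce
    have "\<X> \<noteq> {}"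
    proof -
      obtain lt0 where "lt0 \<in> X" using ne by (auto simp: X_def)
      then have "(\<lambda>p. p \<in> lt0) \<in> \<X>" by (simp add: \<X>_def)
      then show ?thesis by blast
    qed
    have inv: "h ` \<X> \<subseteq> \<X>" if "h \<in> g ` ?E" for h
      using that pullback_chaining_orders[OF vars] by (auto simp: \<X>_def X_def Cg)
    obtain K where K: "K \<subseteq> \<X>" "closed K" "K \<noteq> {}" "\<forall>h\<in>g ` ?E. h ` K \<subseteq> K"
      and min: "\<forall>K'. K' \<subseteq> K \<and> closed K' \<and> K' \<noteq> {} \<and> (\<forall>h\<in>g ` ?E. h ` K' \<subseteq> K') \<longrightarrow> K' = K"
      by (rule minimal_closed_invariant[OF \<open>compact \<X>\<close> \<open>closed \<X>\<close> \<open>\<X> \<noteq> {}\<close> inv])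
    have KX: "Collect f \<in> X" if "f \<in> K" for f using that K(1) by (auto simp: \<X>_def)
    have gK: "g w f \<in> K" if "w \<in> ?E" "f \<in> K" for w f using K(4) that by blast
    show ?thesis
    proof (cases "\<exists>f\<in>K. countable (initial_segments ?S (Collect f))")
      case False
      obtain f where f: "f \<in> K" using K(3) by blast
      have lin: "linear_order_of ?S (Collect f)" using X_linear[OF KX[OF f]] .
      have "recurrent_order ?S ?E (Collect f)"
        unfolding recurrent_order_def
      proof
        fix w assume w: "w \<in> ?E"
        note gf = gK[OF w f]
        have "uncountable (initial_segments ?S (Collect (g w f)))" using False gf by blast
        from countable_order_embeds[OF X_linear[OF KX[OF gf]] cS this lin cS]
        obtain u where u: "\<forall>x\<in>?S. u x \<in> ?S"
          "\<forall>x\<in>?S. \<forall>y\<in>?S. (x, y) \<in> Collect f \<longrightarrow> (u x, u y) \<in> Collect (g w f)"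
          by (elim exE conjE)
        have 1: "(w (u x), w (u y)) \<in> Collect f" if "x \<in> ?S" "y \<in> ?S" "(x, y) \<in> Collect f" for x y
          using u(2) that unfolding Cg by (simp add: pullback_def)
        have "(x, y) \<in> Collect f \<longleftrightarrow> (w (u x), w (u y)) \<in> Collect f" if "x \<in> ?S" "y \<in> ?S" for x y
        proof
          assume "(w (u x), w (u y)) \<in> Collect f"
          then have "x \<noteq> y" "(y, x) \<notin> Collect f"
            using linear_order_ofD(3,5)[OF lin] 1[OF that(2,1)] by blast+
          then show "(x, y) \<in> Collect f" using linear_order_ofD(6)[OF lin that] by blast
        qed (rule 1[OF that])
        then show "\<exists>u. (\<forall>x\<in>?S. u x \<in> ?S) \<and>
            (\<forall>x\<in>?S. \<forall>y\<in>?S. (x, y) \<in> Collect f \<longleftrightarrow> (w (u x), w (u y)) \<in> Collect f)"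
          using u(1) by blast
      qed
      then show ?thesis using KX[OF f] unfolding X_def by blast
    next
      case True
      then obtain f0 where f0: "f0 \<in> K" "countable (initial_segments ?S (Collect f0))" by blast
      note X0 = KX[OF f0(1)]
      have "\<exists>F. finite F \<and> F \<subseteq> ?S \<and> countable {lt \<in> X. lt \<inter> F \<times> F = Collect f0 \<inter> F \<times> F}"
      proof (cases "\<forall>c. cyc 0 c 0")
        case True
        then show ?thesis using countable_nbhd_rotations[OF _ p inf X0 f0(2)] by blast
      next
        case False
        then show ?thesis using countable_nbhd_no_rotations[OF p _ inf cS X0] by blast
      qed
      then obtain F where F: "finite F" "countable {lt \<in> X. lt \<inter> F \<times> F = Collect f0 \<inter> F \<times> F}" by blast
      define U where "U = (\<Inter>p\<in>F \<times> F. {f. f p = f0 p})"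
      have "open {f. f p = f0 p}" for p
        using clopen_coordinate(1,3)[of p] by (cases "f0 p") simp_all
      then have "open U" unfolding U_def using F(1) by (intro open_INT) auto
      have cUK: "countable (U \<inter> K)"
      proof (rule countable_subset)
        show "U \<inter> K \<subseteq> (\<lambda>lt p. p \<in> lt) ` {lt \<in> X. lt \<inter> F \<times> F = Collect f0 \<inter> F \<times> F}"
        proof
          fix f assume f: "f \<in> U \<inter> K"
          then have "Collect f \<in> {lt \<in> X. lt \<inter> F \<times> F = Collect f0 \<inter> F \<times> F}"
            using KX by (auto simp: U_def)
          then show "f \<in> (\<lambda>lt p. p \<in> lt) ` {lt \<in> X. lt \<inter> F \<times> F = Collect f0 \<inter> F \<times> F}"
            by (intro image_eqI[of _ _ "Collect f"]) simp_all
        qed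
      qed (use F(2) in simp)
      have UK: "U \<inter> K \<noteq> {}" using f0(1) by (auto simp: U_def)
      have cK: "compact K" using K(1,2) \<open>compact \<X>\<close> compact_Int_closed[of \<X> K] by (simp add: Int_absorb1)
      obtain x V where V: "open V" "V \<inter> K = {x}"
        by (rule countable_nbhd_has_isolated_point[OF Hausdorff_space_fun cK \<open>open U\<close> cUK UK])
      then have xK: "x \<in> K" by auto
      have cont: "continuous_on UNIV h" if h: "h \<in> g ` ?E" for h
      proof -
        obtain w where w: "h = g w" using h by blast
        show ?thesis unfolding w
        proof (rule continuous_on_coordinatewise_then_product)
          fix q :: "'a \<times> 'a"
          obtain a b where q: "q = (a, b)" by (cases q)
          show "continuous_on UNIV (\<lambda>f. g w f q)"
          proof (cases "a \<in> ?S \<and> b \<in> ?S")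
            case False
            show ?thesis
              by (rule continuous_on_eq[OF continuous_on_const[of _ False]])
                (use False in \<open>auto simp: q g_def pullback_def\<close>)
          qed (simp add: q g_def pullback_def)
        qed
      qed
      have comp: "\<exists>f\<in>g ` ?E. \<forall>y\<in>K. f y = h1 (h2 y)" if h: "h1 \<in> g ` ?E" "h2 \<in> g ` ?E" for h1 h2
      proof -
        obtain v w where vw: "h1 = g v" "h2 = g w" "v \<in> ?E" "w \<in> ?E" using h by blast
        have "g (compose ?S w v) y = g v (g w y)" for y
          using EmbD(1)[OF vw(3)] by (auto simp: g_def pullback_def compose_def fun_eq_iff)
        then show ?thesis using compose_Emb[OF vw(3,4)] vw(1,2) by blast
      qed
      have "recurrent_order ?S ?E (Collect x)"
        unfolding recurrent_order_def
      proof
        fix w assume w: "w \<in> ?E"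
        have "\<exists>h\<in>g ` ?E. h (g w x) = x"
          using cont comp by (intro isolated_point_recurrent[OF K(2,4) min _ _ V imageI[OF w]]) blast+
        then obtain u where u: "u \<in> ?E" "g u (g w x) = x" by blast
        have "x (a, b) \<longleftrightarrow> x (w (u a), w (u b))" if "a \<in> ?S" "b \<in> ?S" for a b
        proof -
          have "x (a, b) \<longleftrightarrow> g u (g w x) (a, b)" using u(2) by simp
          also have "\<dots> \<longleftrightarrow> x (w (u a), w (u b))"
            using that EmbD(1)[OF u(1)] by (simp add: g_def pullback_def)
          finally show ?thesis .
        qed
        then show "\<exists>u. (\<forall>a\<in>?S. u a \<in> ?S) \<and>
            (\<forall>a\<in>?S. \<forall>b\<in>?S. (a, b) \<in> Collect x \<longleftrightarrow> (w (u a), w (u b)) \<in> Collect x)"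
          using EmbD(1)[OF u(1)] by blast
      qed
      then show ?thesis using KX[OF xK] unfolding X_def by blast
    qed
  qed
qed

section \<open>Chainability of monomorphic structures\<close>

definition order_pattern :: "'a rel \<Rightarrow> 'a list \<Rightarrow> (nat \<times> nat) set" where
  "order_pattern lt a = {(i, j). i < length a \<and> j < length a \<and> (a ! i, a ! j) \<in> lt}"

lemma order_pattern_cong:
  assumes "length a = length b"
    "\<And>i j. i < length b \<Longrightarrow> j < length b \<Longrightarrow> (a ! i, a ! j) \<in> lt \<longleftrightarrow> (b ! i, b ! j) \<in> lt'"
  shows "order_pattern lt a = order_pattern lt' b"
  using assms by (auto simp: order_pattern_def)

lemma order_patternD:
  assumes "order_pattern lt a = order_pattern lt' b" "length a = length b" "i < length a" "j < length a"
  shows "(a ! i, a ! j) \<in> lt \<longleftrightarrow> (b ! i, b ! j) \<in> lt'"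
proof -
  have "(i, j) \<in> order_pattern lt a \<longleftrightarrow> (i, j) \<in> order_pattern lt' b" using assms(1) by simp
  then show ?thesis using assms(2-) by (simp add: order_pattern_def)
qed

lemma qf_sat_conjunction:
  "qf_sat lt a (foldr (\<lambda>p. QAnd (f p)) ps (QNot QFalse)) \<longleftrightarrow> (\<forall>p\<in>set ps. qf_sat lt a (f p))"
  by (induction ps) auto

lemma qf_sat_disjunction:
  "qf_sat lt a (foldr (\<lambda>p. QOr (f p)) ps QFalse) \<longleftrightarrow> (\<exists>p\<in>set ps. qf_sat lt a (f p))"
  by (induction ps) auto

lemma qf_vars_conjunction: "qf_vars (foldr (\<lambda>p. QAnd (f p)) ps (QNot QFalse)) = (\<Union>p\<in>set ps. qf_vars (f p))"
  by (induction ps) auto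

lemma qf_vars_disjunction: "qf_vars (foldr (\<lambda>p. QOr (f p)) ps QFalse) = (\<Union>p\<in>set ps. qf_vars (f p))"
  by (induction ps) auto

lemma pattern_invariant_imp_qf_definable:
  assumes inv: "\<And>a b. a \<in> tuples h S \<Longrightarrow> b \<in> tuples h S \<Longrightarrow>
      order_pattern lt a = order_pattern lt b \<Longrightarrow> a \<in> I \<longleftrightarrow> b \<in> I"
  shows "\<exists>\<phi>. qf_vars \<phi> \<subseteq> {..<h} \<and> (\<forall>a\<in>tuples h S. a \<in> I \<longleftrightarrow> qf_sat lt a \<phi>)"
proof -
  define ps where "ps = List.product [0..<h] [0..<h]"
  define lit where "lit P p = (if p \<in> P then QLess (fst p) (snd p) else QNot (QLess (fst p) (snd p)))" for P p
  define pat where "pat P = foldr (\<lambda>p. QAnd (lit P p)) ps (QNot QFalse)" for P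
  have ps: "set ps = {..<h} \<times> {..<h}" by (auto simp: ps_def)
  have pat: "qf_sat lt a (pat P) \<longleftrightarrow> order_pattern lt a = P"
    if "length a = h" "P \<subseteq> {..<h} \<times> {..<h}" for a P
    using that unfolding pat_def qf_sat_conjunction ps
    by (auto simp: lit_def order_pattern_def split: if_splits)
  have sub: "order_pattern lt a \<subseteq> {..<h} \<times> {..<h}" if "length a = h" for a
    using that by (auto simp: order_pattern_def)
  define \<P> where "\<P> = order_pattern lt ` (I \<inter> tuples h S)"
  have "\<P> \<subseteq> Pow ({..<h} \<times> {..<h})" using sub by (auto simp: \<P>_def tuples_def)
  then have "finite \<P>" by (rule finite_subset) simp
  then obtain Ps where Ps: "set Ps = \<P>" using finite_list by blast
  define \<phi> where "\<phi> = foldr (\<lambda>P. QOr (pat P)) Ps QFalse"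
  have "qf_vars (pat P) \<subseteq> {..<h}" for P
    unfolding pat_def qf_vars_conjunction ps by (auto simp: lit_def split: if_splits)
  then have "qf_vars \<phi> \<subseteq> {..<h}" unfolding \<phi>_def qf_vars_disjunction by blast
  moreover have "a \<in> I \<longleftrightarrow> qf_sat lt a \<phi>" if a: "a \<in> tuples h S" for a
  proof -
    have "qf_sat lt a \<phi> \<longleftrightarrow> (\<exists>P\<in>\<P>. order_pattern lt a = P)"
      unfolding \<phi>_def qf_sat_disjunction Ps
      using pat[OF length_tuples[OF a]] \<open>\<P> \<subseteq> Pow ({..<h} \<times> {..<h})\<close> by blast
    also have "\<dots> \<longleftrightarrow> (\<exists>b\<in>I \<inter> tuples h S. order_pattern lt a = order_pattern lt b)"
      by (auto simp: \<P>_def)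
    also have "\<dots> \<longleftrightarrow> a \<in> I" using inv[OF a] a by blast
    finally show ?thesis by simp
  qed
  ultimately show ?thesis by blast
qed

abbreviation nat_less :: "nat rel" where
  "nat_less \<equiv> {(i, j). i < j}"

lemma homogeneous_tuples:
  fixes H :: "nat set"
  assumes H: "infinite H" and hm: "h \<le> m"
    and a: "a \<in> tuples h H" and b: "b \<in> tuples h H"
    and pat: "order_pattern nat_less a = order_pattern nat_less b"
  obtains X Y idx where "X \<subseteq> H" "finite X" "card X = m" "Y \<subseteq> H" "finite Y" "card Y = m"
    "idx \<in> tuples h {..<m}" "a = map ((!) (sorted_list_of_set X)) idx"
    "b = map ((!) (sorted_list_of_set Y)) idx"
proof -
  have la: "length a = h" and lb: "length b = h" using a b by (simp_all add: tuples_def)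
  have less: "a ! i < a ! j \<longleftrightarrow> b ! i < b ! j" if "i < h" "j < h" for i j
    using order_patternD[OF pat] that la lb by simp
  have eq: "a ! i = a ! j \<longleftrightarrow> b ! i = b ! j" if "i < h" "j < h" for i j
    using less[OF that] less[OF that(2,1)] by (auto simp: not_less_iff_gr_or_eq)
  define f where "f x = b ! (SOME i. i < h \<and> a ! i = x)" for x
  have f: "f (a ! i) = b ! i" if "i < h" for i
  proof -
    have "\<exists>j. j < h \<and> a ! j = a ! i" using that by blast
    then have "(SOME j. j < h \<and> a ! j = a ! i) < h \<and> a ! (SOME j. j < h \<and> a ! j = a ! i) = a ! i"
      by (rule someI_ex)
    then show ?thesis unfolding f_def using eq that by blast
  qed
  have fa: "map f a = b" using f la lb by (auto intro: nth_equalityI)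
  have fmono: "f x < f y" if "x \<in> set a" "y \<in> set a" "x < y" for x y
    using that f less la by (auto simp: in_set_conv_nth)
  define xs where "xs = sorted_list_of_set (set a)"
  have xs: "sorted_wrt (<) xs" "set xs = set a" by (simp_all add: xs_def)
  have "length xs = card (set a)" by (simp add: xs_def)
  then have lxs: "length xs \<le> m" using card_length[of a] la hm by simp
  define ys where "ys = map f xs"
  have ys: "sorted_wrt (<) ys" "set ys = set b"
    unfolding ys_def sorted_wrt_map
    using xs fmono fa by (auto intro: sorted_wrt_mono_rel[OF _ xs(1)])
  have "\<forall>x\<in>set a. \<exists>i<length xs. xs ! i = x" using xs(2) by (metis in_set_conv_nth)
  then obtain pos where pos: "\<And>x. x \<in> set a \<Longrightarrow> pos x < length xs \<and> xs ! pos x = x" by metis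
  define idx where "idx = map pos a"
  have aidx: "a = map ((!) xs) idx" using pos by (simp add: idx_def map_idI)
  then have bidx: "b = map ((!) ys) idx"
    using fa pos by (auto simp: ys_def idx_def nth_map)
  have idx_less: "i < length xs" if "i \<in> set idx" for i using that pos by (auto simp: idx_def)
  have extend: "\<exists>X. X \<subseteq> H \<and> finite X \<and> card X = m \<and> (\<forall>i<length zs. sorted_list_of_set X ! i = zs ! i)"
    if zs: "sorted_wrt (<) zs" "set zs \<subseteq> H" "length zs \<le> m" for zs :: "nat list"
  proof -
    obtain n where n: "\<And>z. z \<in> set zs \<Longrightarrow> z \<le> n" using finite_nat_set_iff_bounded_le[of "set zs"] by auto
    have "infinite (H - {..n})" using H by simp
    then obtain Z where Z: "Z \<subseteq> H - {..n}" "finite Z" "card Z = m - length zs"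
      using infinite_arbitrarily_large by metis
    let ?l = "zs @ sorted_list_of_set Z"
    have sorted: "sorted_wrt (<) ?l"
      using zs(1) Z n by (fastforce simp: sorted_wrt_append)
    then have "sorted_list_of_set (set ?l) = ?l"
      by (metis distinct_card sorted_list_of_set.idem_if_sorted_distinct strict_sorted_iff)
    moreover have "card (set ?l) = m"
      using sorted Z zs(3) distinct_card[of ?l] by (simp add: strict_sorted_iff)
    moreover have "set ?l \<subseteq> H" using zs(2) Z by auto
    ultimately show ?thesis by (intro exI[of _ "set ?l"]) (simp add: nth_append)
  qed
  have "set xs \<subseteq> H" "set ys \<subseteq> H" using a b xs(2) ys(2) by (auto simp: tuples_def)
  then obtain X Y where X: "X \<subseteq> H" "finite X" "card X = m" "\<forall>i<length xs. sorted_list_of_set X ! i = xs ! i"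
    and Y: "Y \<subseteq> H" "finite Y" "card Y = m" "\<forall>i<length ys. sorted_list_of_set Y ! i = ys ! i"
    using extend[OF xs(1)] extend[OF ys(1)] lxs by (auto simp: ys_def)
  show thesis
  proof (rule that[OF X(1-3) Y(1-3)])
    show "idx \<in> tuples h {..<m}" using idx_less lxs la by (fastforce simp: tuples_def idx_def)
    show "a = map ((!) (sorted_list_of_set X)) idx"
      unfolding aidx[symmetric] using X(4) idx_less by (subst aidx) (auto intro!: map_cong)
    show "b = map ((!) (sorted_list_of_set Y)) idx"
      using Y(4) idx_less by (subst bidx) (auto intro!: map_cong simp: ys_def)
  qed
qed

lemma homogeneous_subset:
  fixes \<S> :: "('r, 'a) rel_struct" and e :: "nat \<Rightarrow> 'a"
  assumes L0: "finite L0"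
  shows "\<exists>H. infinite H \<and> (\<forall>R\<in>L0. \<forall>a\<in>tuples (ar R) H. \<forall>b\<in>tuples (ar R) H.
      order_pattern nat_less a = order_pattern nat_less b \<longrightarrow>
      (map e a \<in> interp \<S> R \<longleftrightarrow> map e b \<in> interp \<S> R))"
proof -
  define m where "m = sum ar L0"
  have m: "ar R \<le> m" if "R \<in> L0" for R using that L0 by (simp add: m_def member_le_sum)
  define D where "D = (SIGMA R:L0. tuples (ar R) {..<m})"
  have "finite (tuples h {..<m})" for h
    using finite_lists_length_eq[of "{..<m}" h] by (simp add: tuples_def conj_commute)
  then have "finite D" using L0 by (simp add: D_def)
  define col where "col X = {(R, idx) \<in> D. map (\<lambda>i. e (sorted_list_of_set X ! i)) idx \<in> interp \<S> R}" for X
  have "finite (Pow D)" using \<open>finite D\<close> by simp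
  then obtain g where g: "bij_betw g (Pow D) {0..<card (Pow D)}" using ex_bij_betw_finite_nat by blast
  have colD: "col X \<in> Pow D" for X unfolding col_def by blast
  have gl: "g (col X) < card (Pow D)" for X using bspec[OF bij_betwE[OF g] colD[of X]] by simp
  from Ramsey[OF infinite_UNIV_nat, of m "\<lambda>X. g (col X)" "card (Pow D)"]
  obtain H t where H: "infinite H" "\<forall>X. X \<subseteq> H \<and> finite X \<and> card X = m \<longrightarrow> g (col X) = t"
    using gl by auto
  show ?thesis
  proof (intro exI[of _ H] conjI H(1) ballI impI)
    fix R a b assume R: "R \<in> L0" and a: "a \<in> tuples (ar R) H" and b: "b \<in> tuples (ar R) H"
      and pat: "order_pattern nat_less a = order_pattern nat_less b"
    obtain X Y idx where X: "X \<subseteq> H" "finite X" "card X = m" and Y: "Y \<subseteq> H" "finite Y" "card Y = m"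
      and idx: "idx \<in> tuples (ar R) {..<m}" "a = map ((!) (sorted_list_of_set X)) idx"
        "b = map ((!) (sorted_list_of_set Y)) idx"
      by (rule homogeneous_tuples[OF H(1) m[OF R] a b pat])
    have "g (col X) = g (col Y)" using H(2) X Y by simp
    from inj_onD[OF bij_betw_imp_inj_on[OF g] this colD colD]
    have "(R, idx) \<in> col X \<longleftrightarrow> (R, idx) \<in> col Y" by simp
    moreover have "(R, idx) \<in> D" using R idx(1) by (simp add: D_def)
    ultimately show "map e a \<in> interp \<S> R \<longleftrightarrow> map e b \<in> interp \<S> R"
      unfolding idx(2,3) by (simp add: col_def comp_def)
  qed
qed

definition finitely_chaining ::
    "('r \<Rightarrow> nat) \<Rightarrow> ('r, 'a) rel_struct \<Rightarrow> 'a set \<Rightarrow> 'r set \<Rightarrow> 'a rel \<Rightarrow> bool" where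
  "finitely_chaining ar \<S> F L0 lt \<longleftrightarrow>
     (\<forall>x\<in>F. (x, x) \<notin> lt) \<and>
     (\<forall>x\<in>F. \<forall>y\<in>F. \<forall>z\<in>F. (x, y) \<in> lt \<longrightarrow> (y, z) \<in> lt \<longrightarrow> (x, z) \<in> lt) \<and>
     (\<forall>x\<in>F. \<forall>y\<in>F. x \<noteq> y \<longrightarrow> (x, y) \<in> lt \<or> (y, x) \<in> lt) \<and>
     (\<forall>R\<in>L0. \<forall>a\<in>tuples (ar R) F. \<forall>b\<in>tuples (ar R) F.
        order_pattern lt a = order_pattern lt b \<longrightarrow> (a \<in> interp \<S> R \<longleftrightarrow> b \<in> interp \<S> R))"

lemma finitely_chainingD:
  assumes "finitely_chaining ar \<S> F L0 lt"
  shows "x \<in> F \<Longrightarrow> (x, x) \<notin> lt"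
    and "x \<in> F \<Longrightarrow> y \<in> F \<Longrightarrow> z \<in> F \<Longrightarrow> (x, y) \<in> lt \<Longrightarrow> (y, z) \<in> lt \<Longrightarrow> (x, z) \<in> lt"
    and "x \<in> F \<Longrightarrow> y \<in> F \<Longrightarrow> x \<noteq> y \<Longrightarrow> (x, y) \<in> lt \<or> (y, x) \<in> lt"
    and "R \<in> L0 \<Longrightarrow> a \<in> tuples (ar R) F \<Longrightarrow> b \<in> tuples (ar R) F \<Longrightarrow>
      order_pattern lt a = order_pattern lt b \<Longrightarrow> a \<in> interp \<S> R \<longleftrightarrow> b \<in> interp \<S> R"
  by (rule assms[unfolded finitely_chaining_def, THEN conjunct1, rule_format]
    assms[unfolded finitely_chaining_def, THEN conjunct2, THEN conjunct1, rule_format]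
    assms[unfolded finitely_chaining_def, THEN conjunct2, THEN conjunct2, THEN conjunct1, rule_format]
    assms[unfolded finitely_chaining_def, THEN conjunct2, THEN conjunct2, THEN conjunct2, rule_format]; assumption)+

lemma exists_finitely_chaining:
  fixes \<S> :: "('r, 'a) rel_struct"
  assumes cS: "countable (universe \<S>)" and mono: "monomorphic L ar \<S>"
    and F: "finite F" "F \<subseteq> universe \<S>" and L0: "finite L0" "L0 \<subseteq> L"
  shows "\<exists>lt. finitely_chaining ar \<S> F L0 lt"
proof (cases "F = {}")
  case True
  then show ?thesis by (intro exI[of _ "{}"]) (auto simp: finitely_chaining_def tuples_def)
next
  case False
  have inf: "infinite (universe \<S>)" using mono by (simp add: monomorphic_def)
  define e where "e = from_nat_into (universe \<S>)"
  have e: "bij_betw e UNIV (universe \<S>)" unfolding e_def using bij_betw_from_nat_into[OF cS inf] .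
  obtain H where H: "infinite H" "\<forall>R\<in>L0. \<forall>a\<in>tuples (ar R) H. \<forall>b\<in>tuples (ar R) H.
      order_pattern nat_less a = order_pattern nat_less b \<longrightarrow>
      (map e a \<in> interp \<S> R \<longleftrightarrow> map e b \<in> interp \<S> R)"
    using homogeneous_subset[OF L0(1), of ar e \<S>] by (elim exE conjE)
  obtain N where N: "N \<subseteq> H" "finite N" "card N = card F" using infinite_arbitrarily_large[OF H(1)] by metis
  have einj: "inj_on e A" for A using e by (auto simp: bij_betw_def inj_on_def)
  define B where "B = e ` N"
  have B: "B \<in> nsubsets (universe \<S>) (card F)"
    using N e by (auto simp: nsubsets_def B_def bij_betw_def card_image[OF einj])
  have F': "F \<in> nsubsets (universe \<S>) (card F)" using F by (simp add: nsubsets_def)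
  have "card F \<ge> 1" using False F by (simp add: Suc_le_eq card_gt_0_iff)
  then have "isomorphic L ar (substructure_on \<S> F) (substructure_on \<S> B)"
    using mono B F' unfolding monomorphic_def by blast
  then obtain f where f: "f \<in> Emb L ar (substructure_on \<S> F) (substructure_on \<S> B)"
    unfolding isomorphic_def by blast
  have fF: "f x \<in> B" if "x \<in> F" for x using EmbD(1)[OF f] that by (simp add: substructure_on_def)
  have finj: "inj_on f F" using EmbD(2)[OF f] by (simp add: substructure_on_def)
  have "\<forall>x\<in>F. \<exists>n\<in>N. e n = f x" using fF unfolding B_def by (metis imageE)
  then obtain q where q: "\<And>x. x \<in> F \<Longrightarrow> q x \<in> N \<and> e (q x) = f x" by metis
  have qinj: "x = y" if "x \<in> F" "y \<in> F" "q x = q y" for x y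
    using q that finj by (metis inj_onD)
  define lt where "lt = {(x, y). x \<in> F \<and> y \<in> F \<and> q x < q y}"
  have inv: "a \<in> interp \<S> R \<longleftrightarrow> b \<in> interp \<S> R"
    if R: "R \<in> L0" and a: "a \<in> tuples (ar R) F" and b: "b \<in> tuples (ar R) F"
      and pat: "order_pattern lt a = order_pattern lt b" for R a b
  proof -
    have tr: "map q c \<in> tuples (ar R) H" "c \<in> interp \<S> R \<longleftrightarrow> map e (map q c) \<in> interp \<S> R"
      "order_pattern nat_less (map q c) = order_pattern lt c" if c: "c \<in> tuples (ar R) F" for c
    proof -
      show "map q c \<in> tuples (ar R) H" using c q N(1) by (intro map_in_tuples[OF c]) auto
      have set_c: "set c \<subseteq> F" using c by (simp add: tuples_def)
      have "c \<in> interp (substructure_on \<S> F) R \<longleftrightarrow> map f c \<in> interp (substructure_on \<S> B) R"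
        using EmbD(3)[OF f] R L0(2) c by (auto simp: substructure_on_def)
      moreover have mf: "map f c = map e (map q c)" using q set_c by auto
      moreover have "c \<in> lists F" "map f c \<in> lists B"
        using set_c fF by (simp_all add: in_lists_conv_set subset_iff)
      ultimately show "c \<in> interp \<S> R \<longleftrightarrow> map e (map q c) \<in> interp \<S> R"
        unfolding mf[symmetric] by (simp add: substructure_on_def)
      show "order_pattern nat_less (map q c) = order_pattern lt c"
        by (rule order_pattern_cong) (use set_c in \<open>auto simp: lt_def\<close>)
    qed
    show ?thesis
      using tr(2)[OF a] tr(2)[OF b] H(2)[rule_format, OF R tr(1)[OF a] tr(1)[OF b]]
        tr(3)[OF a] tr(3)[OF b] pat by simp
  qed
  have "finitely_chaining ar \<S> F L0 lt"
    unfolding finitely_chaining_def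
  proof (intro conjI ballI impI)
    show "(x, y) \<in> lt \<or> (y, x) \<in> lt" if "x \<in> F" "y \<in> F" "x \<noteq> y" for x y
      using qinj[OF that(1,2)] that linorder_less_linear[of "q x" "q y"] by (auto simp: lt_def)
    show "a \<in> interp \<S> R \<longleftrightarrow> b \<in> interp \<S> R"
      if "R \<in> L0" "a \<in> tuples (ar R) F" "b \<in> tuples (ar R) F" "order_pattern lt a = order_pattern lt b" for R a b
      using that by (rule inv)
  qed (auto simp: lt_def)
  then show ?thesis by (rule exI)
qed

lemma closed_finitely_chaining:
  fixes \<S> :: "('r, 'b) rel_struct"
  shows "closed {f. finitely_chaining ar \<S> F L0 (Collect f)}"
proof -
  have pat: "open {f. order_pattern (Collect f) a = order_pattern (Collect f) b}"
    if "length a = length b" for a b :: "'b list"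
  proof -
    have "{f. order_pattern (Collect f) a = order_pattern (Collect f) b}
        = (\<Inter>p\<in>{..<length a} \<times> {..<length a}. {f. f (a ! fst p, a ! snd p) = f (b ! fst p, b ! snd p)})"
      using that by (auto simp: order_pattern_def set_eq_iff)
    moreover have "open {f :: 'b \<times> 'b \<Rightarrow> bool. f c = f d}" for c d
    proof -
      have eq: "{f :: 'b \<times> 'b \<Rightarrow> bool. f c = f d} = {f. f c \<and> f d} \<union> {f. \<not> f c \<and> \<not> f d}" by auto
      show ?thesis unfolding eq by (intro open_Un open_Collect_conj clopen_coordinate)
    qed
    ultimately show ?thesis by (simp add: open_INT)
  qed
  have closed_pat: "closed {f. order_pattern (Collect f) a = order_pattern (Collect f) b \<longrightarrow> P}"
    if "a \<in> tuples h F" "b \<in> tuples h F" for a b h P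
    using that by (intro closed_Collect_imp pat closed_Collect_const) (simp add: tuples_def)
  have R: "closed {f. \<forall>a. a \<in> tuples h F \<longrightarrow> (\<forall>b. b \<in> tuples h F \<longrightarrow>
      order_pattern (Collect f) a = order_pattern (Collect f) b \<longrightarrow> P a b)}" for h P
  proof (rule closed_Collect_all)
    fix a
    have "closed {f. b \<in> tuples h F \<longrightarrow>
        order_pattern (Collect f) a = order_pattern (Collect f) b \<longrightarrow> P a b}" if "a \<in> tuples h F" for b
      using closed_pat[OF that, of b] by (cases "b \<in> tuples h F") simp_all
    then show "closed {f. a \<in> tuples h F \<longrightarrow> (\<forall>b. b \<in> tuples h F \<longrightarrow>
        order_pattern (Collect f) a = order_pattern (Collect f) b \<longrightarrow> P a b)}"
      by (cases "a \<in> tuples h F") (simp_all add: closed_Collect_all)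
  qed
  show ?thesis
    unfolding finitely_chaining_def Ball_def mem_Collect_eq
    by (intro closed_Collect_conj;
        ((rule closed_Collect_all, rule closed_Collect_imp[OF open_Collect_const], rule R)
        | (intro closed_Collect_all closed_Collect_imp[OF open_Collect_const]
            closed_Collect_imp[OF clopen_coordinate(1)] closed_Collect_disj clopen_coordinate)))
qed

lemma finitely_chaining_mono:
  assumes fc: "finitely_chaining ar \<S> F' L1 lt" and sub: "F \<subseteq> F'" "L0 \<subseteq> L1"
  shows "finitely_chaining ar \<S> F L0 lt"
proof -
  note t = subsetD[OF tuples_mono[OF sub(1)]] and F = subsetD[OF sub(1)] and L = subsetD[OF sub(2)]
  show ?thesis
    unfolding finitely_chaining_def
  proof (intro conjI ballI impI)
    show "(x, x) \<notin> lt" if "x \<in> F" for x using finitely_chainingD(1)[OF fc F[OF that]] .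
    show "(x, z) \<in> lt" if "x \<in> F" "y \<in> F" "z \<in> F" "(x, y) \<in> lt" "(y, z) \<in> lt" for x y z
      using finitely_chainingD(2)[OF fc F[OF that(1)] F[OF that(2)] F[OF that(3)] that(4,5)] .
    show "(x, y) \<in> lt \<or> (y, x) \<in> lt" if "x \<in> F" "y \<in> F" "x \<noteq> y" for x y
      using finitely_chainingD(3)[OF fc F[OF that(1)] F[OF that(2)] that(3)] .
    show "a \<in> interp \<S> R \<longleftrightarrow> b \<in> interp \<S> R"
      if "R \<in> L0" "a \<in> tuples (ar R) F" "b \<in> tuples (ar R) F" "order_pattern lt a = order_pattern lt b" for R a b
      using finitely_chainingD(4)[OF fc L[OF that(1)] t[OF that(2)] t[OF that(3)] that(4)] .
  qed
qed

text \<open>Fraisse's theorem. Ramsey's theorem gives it for finite parts of structure and language,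
  compactness does the rest.\<close>

theorem monomorphic_imp_chainable:
  fixes \<S> :: "('r, 'a) rel_struct"
  assumes cS: "countable (universe \<S>)" and mono: "monomorphic L ar \<S>"
  shows "\<exists>\<phi>. (\<forall>R\<in>L. qf_vars (\<phi> R) \<subseteq> {..<ar R}) \<and> chaining_orders L ar \<phi> \<S> \<noteq> {}"
proof -
  let ?S = "universe \<S>"
  define I where "I = {F. finite F \<and> F \<subseteq> ?S} \<times> {L0. finite L0 \<and> L0 \<subseteq> L}"
  define Q where "Q p = {f. finitely_chaining ar \<S> (fst p) (snd p) (Collect f)}" for p
  have "UNIV \<inter> \<Inter>(Q ` I) \<noteq> {}"
  proof (rule compact_imp_fip_image[OF compact_UNIV_bool_fun])
    show "closed (Q p)" for p unfolding Q_def by (rule closed_finitely_chaining)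
    fix I' assume I': "finite I'" "I' \<subseteq> I"
    define F where "F = \<Union>(fst ` I')"
    define L0 where "L0 = \<Union>(snd ` I')"
    have pI: "finite (fst p)" "fst p \<subseteq> ?S" "finite (snd p)" "snd p \<subseteq> L" if "p \<in> I'" for p
      using subsetD[OF I'(2) that] by (auto simp: I_def)
    have "finite F" "finite L0" unfolding F_def L0_def using I'(1) pI(1,3) by simp_all
    moreover have "F \<subseteq> ?S" "L0 \<subseteq> L"
      unfolding F_def L0_def by (rule UN_least, erule pI)+
    ultimately obtain lt where "finitely_chaining ar \<S> F L0 lt"
      using exists_finitely_chaining[OF cS mono] by blast
    then have "finitely_chaining ar \<S> (fst p) (snd p) lt" if "p \<in> I'" for p
      by (rule finitely_chaining_mono) (use that in \<open>simp_all add: F_def L0_def UN_upper\<close>)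
    then have "(\<lambda>p. p \<in> lt) \<in> UNIV \<inter> \<Inter>(Q ` I')" by (auto simp: Q_def)
    then show "UNIV \<inter> \<Inter>(Q ` I') \<noteq> {}" by blast
  qed
  then obtain f where f: "\<And>p. p \<in> I \<Longrightarrow> f \<in> Q p" by blast
  have fc: "finitely_chaining ar \<S> F L0 (Collect f)" if "finite F" "F \<subseteq> ?S" "finite L0" "L0 \<subseteq> L" for F L0
    using f[of "(F, L0)"] that by (simp add: I_def Q_def)
  define lt where "lt = Collect f \<inter> ?S \<times> ?S"
  have lin: "linear_order_of ?S lt"
    unfolding linear_order_of_def strict_linear_order_on_def
  proof (intro conjI)
    show "lt \<subseteq> ?S \<times> ?S" by (simp add: lt_def)
    show "trans lt"
    proof (rule transI)
      fix x y z assume *: "(x, y) \<in> lt" "(y, z) \<in> lt"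
      then have "finitely_chaining ar \<S> {x, y, z} {} (Collect f)" by (intro fc) (auto simp: lt_def)
      from finitely_chainingD(2)[OF this, of x y z] show "(x, z) \<in> lt" using * by (simp add: lt_def)
    qed
    show "irrefl lt"
    proof (rule irreflI)
      fix x
      have "finitely_chaining ar \<S> {x} {} (Collect f)" if "x \<in> ?S" using that by (intro fc) auto
      from finitely_chainingD(1)[OF this, of x] show "(x, x) \<notin> lt" by (auto simp: lt_def)
    qed
    show "total_on ?S lt"
    proof (rule total_onI)
      fix x y assume *: "x \<in> ?S" "y \<in> ?S" "x \<noteq> y"
      then have "finitely_chaining ar \<S> {x, y} {} (Collect f)" by (intro fc) auto
      from finitely_chainingD(3)[OF this, of x y] show "(x, y) \<in> lt \<or> (y, x) \<in> lt"
        using * by (simp add: lt_def)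
    qed
  qed
  have "\<exists>\<phi>. qf_vars \<phi> \<subseteq> {..<ar R} \<and> (\<forall>a\<in>tuples (ar R) ?S. a \<in> interp \<S> R \<longleftrightarrow> qf_sat lt a \<phi>)"
    if R: "R \<in> L" for R
  proof (rule pattern_invariant_imp_qf_definable)
    fix a b assume a: "a \<in> tuples (ar R) ?S" and b: "b \<in> tuples (ar R) ?S"
      and pat: "order_pattern lt a = order_pattern lt b"
    have S: "set a \<subseteq> ?S" "set b \<subseteq> ?S" using a b by (auto simp: tuples_def)
    have p: "order_pattern lt c = order_pattern (Collect f) c" if "set c \<subseteq> ?S" for c
      by (rule order_pattern_cong) (use that in \<open>auto simp: lt_def\<close>)
    have fab: "finitely_chaining ar \<S> (set a \<union> set b) {R} (Collect f)" by (rule fc) (use S R in auto)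
    have "a \<in> tuples (ar R) (set a \<union> set b)" "b \<in> tuples (ar R) (set a \<union> set b)"
      using a b by (auto simp: tuples_def)
    from finitely_chainingD(4)[OF fab singletonI this] show "a \<in> interp \<S> R \<longleftrightarrow> b \<in> interp \<S> R"
      using pat unfolding p[OF S(1)] p[OF S(2)] .
  qed
  then obtain \<phi> where \<phi>: "\<And>R. R \<in> L \<Longrightarrow> qf_vars (\<phi> R) \<subseteq> {..<ar R} \<and>
      (\<forall>a\<in>tuples (ar R) ?S. a \<in> interp \<S> R \<longleftrightarrow> qf_sat lt a (\<phi> R))" by metis
  then have "lt \<in> chaining_orders L ar \<phi> \<S>" using lin by (simp add: chaining_orders_def)
  then show ?thesis using \<phi> by blast
qed

section \<open>Chains and big Ramsey degrees\<close>

lemma big_ramsey_degree_finite_iff: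
  "big_ramsey_degree L ar \<A> \<C> < \<infinity> \<longleftrightarrow> (\<exists>t>0. ramsey_bound L ar \<A> \<C> t)"
  by (simp add: big_ramsey_degree_def)

lemma chain_struct_simps [simp]:
  "universe (chain_struct S lt) = S" "[x, y] \<in> interp (chain_struct S lt) R \<longleftrightarrow> (x, y) \<in> lt"
  by (auto simp: chain_struct_def)

lemma chain_Emb_iff:
  assumes A: "linear_order_of A lt" and B: "linear_order_of B lt'"
  shows "f \<in> Emb {()} (\<lambda>_. 2) (chain_struct A lt) (chain_struct B lt') \<longleftrightarrow>
    f \<in> A \<rightarrow>\<^sub>E B \<and> (\<forall>x\<in>A. \<forall>y\<in>A. (x, y) \<in> lt \<longleftrightarrow> (f x, f y) \<in> lt')"
    (is "?L \<longleftrightarrow> ?R")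
proof
  assume f: ?L
  have "(x, y) \<in> lt \<longleftrightarrow> (f x, f y) \<in> lt'" if "x \<in> A" "y \<in> A" for x y
    using EmbD(3)[OF f, of "()" "[x, y]"] that by (simp add: tuples_def)
  then show ?R using f by (simp add: Emb_def)
next
  assume f: ?R
  have "inj_on f A"
  proof (rule inj_onI, rule ccontr)
    fix x y assume *: "x \<in> A" "y \<in> A" "f x = f y" "x \<noteq> y"
    then have "(f x, f y) \<in> lt' \<or> (f y, f x) \<in> lt'"
      using linear_order_ofD(6)[OF A *(1,2,4)] f by blast
    then show False using linear_order_ofD(3)[OF B] * by simp
  qed
  moreover have "xs \<in> interp (chain_struct A lt) () \<longleftrightarrow> map f xs \<in> interp (chain_struct B lt') ()"
    if xs: "xs \<in> tuples 2 A" for xs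
  proof -
    obtain x y where "xs = [x, y]" using length_tuples[OF xs] by (auto simp: numeral_2_eq_2 length_Suc_conv)
    then show ?thesis using xs f by (simp add: tuples_def)
  qed
  ultimately show ?L using f by (simp add: Emb_def)
qed

abbreviation chain_Emb :: "nat \<Rightarrow> 'a set \<Rightarrow> 'a rel \<Rightarrow> (nat \<Rightarrow> 'a) set" where
  "chain_Emb n S lt \<equiv> Emb {()} (\<lambda>_. 2) (finite_chain n) (chain_struct S lt)"

lemma linear_order_of_initial: "linear_order_of {..<n} {(i, j). i < j \<and> j < (n::nat)}"
  unfolding linear_order_of_def strict_linear_order_on_def
  by (auto simp: irrefl_def total_on_def intro!: transI)

lemma universe_finite_chain [simp]: "universe (finite_chain n) = {..<n}"
  by (simp add: finite_chain_def)

lemma chain_Emb_finite_iff: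
  assumes lin: "linear_order_of S lt"
  shows "e \<in> chain_Emb n S lt \<longleftrightarrow> e \<in> {..<n} \<rightarrow>\<^sub>E S \<and> inc lt (map e [0..<n])"
proof -
  have "(\<forall>i\<in>{..<n}. \<forall>j\<in>{..<n}. (i, j) \<in> {(i, j). i < j \<and> j < n} \<longleftrightarrow> (e i, e j) \<in> lt) \<longleftrightarrow>
      (\<forall>i j. i < j \<longrightarrow> j < n \<longrightarrow> (e i, e j) \<in> lt)" (is "?A \<longleftrightarrow> ?B")
  proof
    assume ?A
    then show ?B by auto
  next
    assume B: ?B
    show ?A
    proof (intro ballI)
      fix i j assume "i \<in> {..<n}" "j \<in> {..<n}"
      then show "(i, j) \<in> {(i, j). i < j \<and> j < n} \<longleftrightarrow> (e i, e j) \<in> lt"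
        using B linear_order_ofD(3)[OF lin, of "e i"] linear_order_ofD(5)[OF lin, of "e j" "e i"]
        by (cases i j rule: linorder_cases) auto
    qed
  qed
  then show ?thesis
    unfolding finite_chain_def chain_Emb_iff[OF linear_order_of_initial lin]
    by (auto simp: sorted_wrt_iff_nth_less)
qed

lemma chain_Emb_exists:
  assumes lin: "linear_order_of S lt" and B: "B \<in> nsubsets S n"
  obtains e where "e \<in> chain_Emb n S lt" "e ` {..<n} = B"
proof -
  have fin: "finite B" "B \<subseteq> S" "card B = n" using B by (auto simp: nsubsets_def)
  obtain xs where xs: "inc lt xs" "set xs = B" using inc_exists[OF lin fin(1,2)] by blast
  have len: "length xs = n" using distinct_card[OF inc_distinct[OF lin xs(1)]] xs(2) fin(3) by simp
  define e where "e = restrict ((!) xs) {..<n}"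
  have "map e [0..<n] = xs" using len by (intro nth_equalityI) (auto simp: e_def)
  moreover have "e \<in> {..<n} \<rightarrow>\<^sub>E S" using xs(2) fin(2) len by (auto simp: e_def)
  ultimately have "e \<in> chain_Emb n S lt" using xs(1) unfolding chain_Emb_finite_iff[OF lin] by simp
  moreover have "e ` {..<n} = B"
    using arg_cong[OF \<open>map e [0..<n] = xs\<close>, of set] xs(2) by (simp add: atLeast0LessThan)
  ultimately show thesis by (rule that)
qed

lemma chain_Emb_unique:
  assumes lin: "linear_order_of S lt" and e: "e \<in> chain_Emb n S lt" "e' \<in> chain_Emb n S lt"
    and eq: "e ` {..<n} = e' ` {..<n}"
  shows "e = e'"
proof -
  have 1: "e \<in> {..<n} \<rightarrow>\<^sub>E S" "e' \<in> {..<n} \<rightarrow>\<^sub>E S" "inc lt (map e [0..<n])" "inc lt (map e' [0..<n])"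
    using e unfolding chain_Emb_finite_iff[OF lin] by auto
  then have "map e [0..<n] = map e' [0..<n]"
    using eq by (intro inc_unique[OF lin]) (simp_all add: atLeast0LessThan)
  then have "e i = e' i" if "i \<in> {..<n}" for i using that by simp
  then show ?thesis using PiE_ext[OF 1(1,2)] by blast
qed

lemma nth_substructure_universe:
  assumes "infinite (universe \<S>)"
  shows "universe (nth_substructure \<S> n) \<in> nsubsets (universe \<S>) n"
proof -
  obtain A where "A \<subseteq> universe \<S>" "finite A" "card A = n"
    using infinite_arbitrarily_large[OF assms] by metis
  then have "A \<in> nsubsets (universe \<S>) n" by (simp add: nsubsets_def)
  then have "(SOME A. A \<in> nsubsets (universe \<S>) n) \<in> nsubsets (universe \<S>) n" by (rule someI)
  then show ?thesis unfolding nth_substructure_def substructure_on_def by simp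
qed

lemma chain_self_Emb_imp_Emb:
  assumes lin: "linear_order_of (universe \<S>) lt" and ch: "chains_struct L ar lt \<S>"
    and w: "w \<in> Emb {()} (\<lambda>_. 2) (chain_struct (universe \<S>) lt) (chain_struct (universe \<S>) lt)"
  shows "w \<in> Emb L ar \<S> \<S>"
  unfolding Emb_def
proof (intro CollectI conjI ballI)
  let ?S = "universe \<S>"
  have w': "w \<in> ?S \<rightarrow>\<^sub>E ?S" "\<And>x y. x \<in> ?S \<Longrightarrow> y \<in> ?S \<Longrightarrow> (x, y) \<in> lt \<longleftrightarrow> (w x, w y) \<in> lt"
    using w unfolding chain_Emb_iff[OF lin lin] by auto
  show "w \<in> ?S \<rightarrow>\<^sub>E ?S" by (rule w')
  show inj: "inj_on w ?S" using EmbD(2)[OF w] by simp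
  fix R a assume R: "R \<in> L" and a: "a \<in> tuples (ar R) ?S"
  obtain \<phi> where \<phi>: "qf_vars \<phi> \<subseteq> {..<ar R}" "\<forall>a\<in>tuples (ar R) ?S. a \<in> interp \<S> R \<longleftrightarrow> qf_sat lt a \<phi>"
    using ch R unfolding chains_struct_def by blast
  have "map w a \<in> tuples (ar R) ?S" using a by (rule map_in_tuples) (use w'(1) in auto)
  moreover have "qf_sat lt a \<phi> \<longleftrightarrow> qf_sat lt (map w a) \<phi>"
    by (rule qf_sat_map[OF _ _ inj w'(2)]) (use \<phi>(1) a in \<open>auto simp: tuples_def\<close>)
  ultimately show "a \<in> interp \<S> R \<longleftrightarrow> map w a \<in> interp \<S> R" using \<phi>(2) a by blast
qed

text \<open>A chain embedding is coloured by the set of colours of the embeddings with the same image.\<close>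

lemma ramsey_bound_of_chain:
  fixes \<S> :: "('r, 'a) rel_struct"
  assumes inf: "infinite (universe \<S>)" and lin: "linear_order_of (universe \<S>) lt"
    and ch: "chains_struct L ar lt \<S>"
    and bound: "ramsey_bound {()} (\<lambda>_. 2) (finite_chain n) (chain_struct (universe \<S>) lt) t"
  shows "ramsey_bound L ar (nth_substructure \<S> n) \<S> (t * n ^ n)"
  unfolding ramsey_bound_def
proof (intro allI impI)
  let ?S = "universe \<S>" and ?A = "nth_substructure \<S> n"
  let ?U = "universe ?A" and ?C = "chain_struct ?S lt"
  fix k and \<kappa> :: "('a \<Rightarrow> 'a) \<Rightarrow> nat"
  assume k: "k > 0" and \<kappa>: "\<kappa> \<in> Pi (Emb L ar ?A \<S>) (\<lambda>_. {..<k})"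
  have A0: "finite ?U" "card ?U = n"
    using nth_substructure_universe[OF inf, of n] by (auto simp: nsubsets_def)
  define col where "col B = \<kappa> ` {f \<in> Emb L ar ?A \<S>. f ` ?U = B}" for B
  have col: "col B \<subseteq> {..<k}" for B using \<kappa> by (auto simp: col_def)
  have fin_col: "finite (col B)" for B using col finite_subset by blast
  define \<kappa>' where "\<kappa>' e = set_encode (col (e ` {..<n}))" for e
  have bd: "\<kappa>' e < set_encode {..<k} + 1" for e
  proof -
    have "sum ((^) 2) (col (e ` {..<n})) \<le> (sum ((^) 2) {..<k} :: nat)"
      using col[of "e ` {..<n}"] by (intro sum_mono2) simp_all
    then show ?thesis by (simp add: \<kappa>'_def set_encode_def)
  qed
  then have "\<kappa>' \<in> Pi (chain_Emb n ?S lt) (\<lambda>_. {..<set_encode {..<k} + 1})" by simp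
  then obtain w where w: "w \<in> Emb {()} (\<lambda>_. 2) ?C ?C"
    and wt: "card (\<kappa>' ` (compose {..<n} w ` chain_Emb n ?S lt)) \<le> t"
    using bound unfolding ramsey_bound_def universe_finite_chain by (metis add_gr_0 zero_less_one)
  have wS: "w \<in> Emb L ar \<S> \<S>" by (rule chain_self_Emb_imp_Emb[OF lin ch w])
  define \<D> where "\<D> = set_decode ` (\<kappa>' ` (compose {..<n} w ` chain_Emb n ?S lt))"
  have fin: "finite (\<kappa>' ` (compose {..<n} w ` chain_Emb n ?S lt))"
  proof (rule finite_subset)
    show "\<kappa>' ` (compose {..<n} w ` chain_Emb n ?S lt) \<subseteq> {..<set_encode {..<k} + 1}"
      unfolding image_subset_iff lessThan_iff using bd by blast
  qed simp
  have \<D>: "finite \<D>" "card \<D> \<le> t"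
    unfolding \<D>_def by (rule finite_imageI[OF fin], rule order_trans[OF card_image_le[OF fin] wt])
  have "set_decode (\<kappa>' e) = col (e ` {..<n})" for e
    unfolding \<kappa>'_def by (rule set_encode_inverse[OF fin_col])
  then have \<D>_eq: "\<D> = (\<lambda>e. col (compose {..<n} w e ` {..<n})) ` chain_Emb n ?S lt"
    unfolding \<D>_def image_image by (simp only:)
  have card_col: "card D \<le> n ^ n" if D: "D \<in> \<D>" for D
  proof -
    obtain e where e: "e \<in> chain_Emb n ?S lt" "D = col (compose {..<n} w e ` {..<n})"
      using D unfolding \<D>_eq by blast
    define B where "B = compose {..<n} w e ` {..<n}"
    have B: "finite B" "card B \<le> n" unfolding B_def using card_image_le[of "{..<n}"] by auto
    have sub: "{f \<in> Emb L ar ?A \<S>. f ` ?U = B} \<subseteq> ?U \<rightarrow>\<^sub>E B"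
      by (auto simp: Emb_def PiE_def)
    have "finite (?U \<rightarrow>\<^sub>E B)" using A0(1) B(1) by (intro finite_PiE) auto
    then have "card D \<le> card (?U \<rightarrow>\<^sub>E B)"
      unfolding e(2) B_def[symmetric] col_def
      using sub by (meson card_image_le card_mono finite_subset order_trans)
    also have "\<dots> \<le> n ^ n" using A0 B by (simp add: card_PiE power_mono)
    finally show ?thesis .
  qed
  have "\<kappa> ` (compose ?U w ` Emb L ar ?A \<S>) \<subseteq> \<Union>\<D>"
  proof
    fix c assume "c \<in> \<kappa> ` (compose ?U w ` Emb L ar ?A \<S>)"
    then obtain f where f: "f \<in> Emb L ar ?A \<S>" "c = \<kappa> (compose ?U w f)" by blast
    have "f ` ?U \<in> nsubsets ?S n"
      using EmbD(1,2)[OF f(1)] A0 by (auto simp: nsubsets_def card_image)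
    then obtain e where e: "e \<in> chain_Emb n ?S lt" "e ` {..<n} = f ` ?U"
      using chain_Emb_exists[OF lin] by blast
    have "compose ?U w f ` ?U = w ` f ` ?U" by (auto simp: compose_def)
    also have "\<dots> = compose {..<n} w e ` {..<n}" unfolding e(2)[symmetric] by (auto simp: compose_def)
    finally have "c \<in> col (compose {..<n} w e ` {..<n})"
      unfolding col_def f(2) using compose_Emb[OF f(1) wS] by blast
    then show "c \<in> \<Union>\<D>" unfolding \<D>_eq using e(1) by blast
  qed
  moreover have "finite (\<Union>\<D>)" using \<D>(1) fin_col unfolding \<D>_eq by auto
  ultimately have "card (\<kappa> ` (compose ?U w ` Emb L ar ?A \<S>)) \<le> card (\<Union>\<D>)" by (rule card_mono[rotated])
  also have "\<dots> \<le> (\<Sum>D\<in>\<D>. card D)" by (rule card_Union_le_sum_card)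
  also have "\<dots> \<le> card \<D> * n ^ n" using sum_bounded_above[of \<D> card "n ^ n"] card_col by simp
  also have "\<dots> \<le> t * n ^ n" using \<D>(2) by (rule mult_le_mono1)
  finally show "\<exists>w\<in>Emb L ar \<S> \<S>. card (\<kappa> ` (compose ?U w ` Emb L ar ?A \<S>)) \<le> t * n ^ n"
    using wS by blast
qed

lemma chain_ramsey_bound_of_recurrent:
  fixes \<S> :: "('r, 'a) rel_struct"
  assumes mono: "monomorphic L ar \<S>" and lin: "linear_order_of (universe \<S>) lt"
    and rec: "recurrent_order (universe \<S>) (Emb L ar \<S> \<S>) lt" and n: "n \<ge> 1"
    and bound: "ramsey_bound L ar (nth_substructure \<S> n) \<S> t"
  shows "ramsey_bound {()} (\<lambda>_. 2) (finite_chain n) (chain_struct (universe \<S>) lt) t"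
  unfolding ramsey_bound_def universe_finite_chain
proof (intro allI impI)
  let ?S = "universe \<S>" and ?A = "nth_substructure \<S> n"
  let ?U = "universe ?A" and ?C = "chain_struct ?S lt"
  fix k and \<kappa> :: "(nat \<Rightarrow> 'a) \<Rightarrow> nat"
  assume k: "k > 0" and \<kappa>: "\<kappa> \<in> Pi (chain_Emb n ?S lt) (\<lambda>_. {..<k})"
  have inf: "infinite ?S" using mono by (simp add: monomorphic_def)
  have A0: "?U \<in> nsubsets ?S n" by (rule nth_substructure_universe[OF inf])
  define enum where "enum B = (SOME e. e \<in> chain_Emb n ?S lt \<and> e ` {..<n} = B)" for B
  have enum: "enum B \<in> chain_Emb n ?S lt" "enum B ` {..<n} = B" if B: "B \<in> nsubsets ?S n" for B
  proof -
    have "\<exists>e. e \<in> chain_Emb n ?S lt \<and> e ` {..<n} = B" using chain_Emb_exists[OF lin B] by blast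
    then have "enum B \<in> chain_Emb n ?S lt \<and> enum B ` {..<n} = B" unfolding enum_def by (rule someI_ex)
    then show "enum B \<in> chain_Emb n ?S lt" "enum B ` {..<n} = B" by auto
  qed
  have img: "f ` ?U \<in> nsubsets ?S n" if "f \<in> Emb L ar ?A \<S>" for f
    using EmbD(1,2)[OF that] A0 by (auto simp: nsubsets_def card_image)
  define \<kappa>' where "\<kappa>' f = \<kappa> (enum (f ` ?U))" for f
  have "\<kappa>' \<in> Pi (Emb L ar ?A \<S>) (\<lambda>_. {..<k})" using \<kappa> enum(1) img by (auto simp: \<kappa>'_def)
  then obtain w where w: "w \<in> Emb L ar \<S> \<S>" "card (\<kappa>' ` (compose ?U w ` Emb L ar ?A \<S>)) \<le> t"
    using bound k unfolding ramsey_bound_def by blast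
  from bspec[OF rec[unfolded recurrent_order_def] w(1)]
  obtain u where u: "\<forall>x\<in>?S. u x \<in> ?S"
    "\<forall>x\<in>?S. \<forall>y\<in>?S. (x, y) \<in> lt \<longleftrightarrow> (w (u x), w (u y)) \<in> lt"
    by (elim exE conjE)
  define v where "v = restrict (\<lambda>x. w (u x)) ?S"
  have v: "v \<in> Emb {()} (\<lambda>_. 2) ?C ?C"
    unfolding chain_Emb_iff[OF lin lin] using u EmbD(1)[OF w(1)] by (auto simp: v_def)
  have "\<kappa> ` (compose {..<n} v ` chain_Emb n ?S lt) \<subseteq> \<kappa>' ` (compose ?U w ` Emb L ar ?A \<S>)"
  proof
    fix c assume "c \<in> \<kappa> ` (compose {..<n} v ` chain_Emb n ?S lt)"
    then obtain e where e: "e \<in> chain_Emb n ?S lt" and c: "c = \<kappa> (compose {..<n} v e)" by blast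
    have ve: "compose {..<n} v e \<in> chain_Emb n ?S lt" using compose_Emb[OF e v] by simp
    have eS: "e i \<in> ?S" if "i < n" for i using EmbD(1)[OF e] that by simp
    define B where "B = u ` e ` {..<n}"
    have veB: "compose {..<n} v e ` {..<n} = w ` B"
      using eS by (auto simp: compose_def v_def B_def image_image)
    have "inj_on (compose {..<n} v e) {..<n}" using EmbD(2)[OF ve] by simp
    then have "card (w ` B) = n" using card_image veB by fastforce
    moreover have "card B \<le> n"
      unfolding B_def image_image using card_image_le[of "{..<n}"] by simp
    moreover have "finite B" by (simp add: B_def)
    moreover have "B \<subseteq> ?S" using eS u(1) by (auto simp: B_def)
    ultimately have B: "B \<in> nsubsets ?S n"
      using card_image_le[of B w] by (simp add: nsubsets_def)
    have A: "substructure_on \<S> ?U = ?A"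
      by (simp add: nth_substructure_def substructure_on_def)
    have "isomorphic L ar (substructure_on \<S> ?U) (substructure_on \<S> B)"
      using mono n A0 B unfolding monomorphic_def by blast
    then obtain f where f: "f \<in> Emb L ar ?A (substructure_on \<S> B)" "f ` ?U = B"
      unfolding isomorphic_def A by (auto simp: substructure_on_def)
    have fS: "f \<in> Emb L ar ?A \<S>"
      unfolding Emb_def
    proof (intro CollectI conjI ballI)
      show "f \<in> ?U \<rightarrow>\<^sub>E ?S" using f \<open>B \<subseteq> ?S\<close> by (auto simp: Emb_def PiE_def)
      show "inj_on f ?U" by (rule EmbD(2)[OF f(1)])
      fix R a assume "R \<in> L" and a: "a \<in> tuples (ar R) ?U"
      then have "a \<in> interp ?A R \<longleftrightarrow> map f a \<in> interp (substructure_on \<S> B) R" by (rule EmbD(3)[OF f(1)])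
      moreover have "f ` set a \<subseteq> B" unfolding f(2)[symmetric] using a by (intro image_mono) (simp add: tuples_def)
      then have "map f a \<in> lists B" by (simp add: in_lists_conv_set image_subset_iff)
      ultimately show "a \<in> interp ?A R \<longleftrightarrow> map f a \<in> interp \<S> R" by (simp add: substructure_on_def)
    qed
    have "compose ?U w f ` ?U = w ` B" using f(2) by (auto simp: compose_def)
    then have "enum (compose ?U w f ` ?U) = compose {..<n} v e"
      using chain_Emb_unique[OF lin _ ve] enum[OF img[OF compose_Emb[OF fS w(1)]]] veB by simp
    then have "c = \<kappa>' (compose ?U w f)" by (simp add: c \<kappa>'_def)
    then show "c \<in> \<kappa>' ` (compose ?U w ` Emb L ar ?A \<S>)" using fS by blast
  qed
  moreover have "finite (\<kappa>' ` (compose ?U w ` Emb L ar ?A \<S>))"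
  proof (rule finite_subset)
    show "\<kappa>' ` (compose ?U w ` Emb L ar ?A \<S>) \<subseteq> {..<k}"
      unfolding image_subset_iff
      by (intro ballI Pi_mem[OF \<open>\<kappa>' \<in> Pi (Emb L ar ?A \<S>) (\<lambda>_. {..<k})\<close>])
        (auto intro: compose_Emb[OF _ w(1)])
  qed simp
  ultimately have "card (\<kappa> ` (compose {..<n} v ` chain_Emb n ?S lt)) \<le> t"
    using order_trans[OF card_mono w(2)] by simp
  then show "\<exists>w\<in>Emb {()} (\<lambda>_. 2) ?C ?C. card (\<kappa> ` (compose {..<n} w ` chain_Emb n ?S lt)) \<le> t"
    using v by blast
qed

theorem corollary3p5:
  fixes L :: "'r set" and ar :: "'r \<Rightarrow> nat" and \<S> :: "('r, 'a) rel_struct"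
  assumes "is_structure L ar \<S>"
    and "countable (universe \<S>)"
    and "monomorphic L ar \<S>"
  shows "finite_spec (spec L ar \<S>) \<longleftrightarrow>
    (\<exists>lt. linear_order_of (universe \<S>) lt \<and> chains_struct L ar lt \<S> \<and>
       finite_spec (chain_spec (universe \<S>) lt))"
proof
  have inf: "infinite (universe \<S>)" using assms(3) by (simp add: monomorphic_def)
  assume fin: "finite_spec (spec L ar \<S>)"
  obtain \<phi> where \<phi>: "\<forall>R\<in>L. qf_vars (\<phi> R) \<subseteq> {..<ar R}"
    and ne: "chaining_orders L ar \<phi> \<S> \<noteq> {}"
    using monomorphic_imp_chainable[OF assms(2,3)] by (elim exE conjE)
  have "\<exists>lt\<in>chaining_orders L ar \<phi> \<S>. recurrent_order (universe \<S>) (Emb L ar \<S> \<S>) lt"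
    by (rule recurrent_chaining_order[OF inf assms(2) _ ne]) (use \<phi> in blast)
  then obtain lt where lt: "lt \<in> chaining_orders L ar \<phi> \<S>"
    and rec: "recurrent_order (universe \<S>) (Emb L ar \<S> \<S>) lt" by (elim bexE)
  have lin: "linear_order_of (universe \<S>) lt" using lt by (simp add: chaining_orders_def)
  have "chains_struct L ar lt \<S>"
    unfolding chains_struct_def
  proof
    fix R assume R: "R \<in> L"
    then show "\<exists>\<phi>. qf_vars \<phi> \<subseteq> {..<ar R} \<and>
        (\<forall>xs\<in>tuples (ar R) (universe \<S>). xs \<in> interp \<S> R \<longleftrightarrow> qf_sat lt xs \<phi>)"
      using \<phi> lt by (intro exI[of _ "\<phi> R"]) (simp add: chaining_orders_def)
  qed
  moreover have "finite_spec (chain_spec (universe \<S>) lt)"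
    unfolding finite_spec_def chain_spec_def big_ramsey_degree_finite_iff
  proof (intro allI impI)
    fix n :: nat assume n: "n \<ge> 1"
    then obtain t where "t > 0" "ramsey_bound L ar (nth_substructure \<S> n) \<S> t"
      using fin unfolding finite_spec_def spec_def big_ramsey_degree_finite_iff by blast
    then show "\<exists>t>0. ramsey_bound {()} (\<lambda>_. 2) (finite_chain n) (chain_struct (universe \<S>) lt) t"
      using chain_ramsey_bound_of_recurrent[OF assms(3) lin rec n] by blast
  qed
  ultimately show "\<exists>lt. linear_order_of (universe \<S>) lt \<and> chains_struct L ar lt \<S> \<and>
      finite_spec (chain_spec (universe \<S>) lt)" using lin by blast
next
  have inf: "infinite (universe \<S>)" using assms(3) by (simp add: monomorphic_def)
  assume "\<exists>lt. linear_order_of (universe \<S>) lt \<and> chains_struct L ar lt \<S> \<and>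
      finite_spec (chain_spec (universe \<S>) lt)"
  then obtain lt where lin: "linear_order_of (universe \<S>) lt" and ch: "chains_struct L ar lt \<S>"
    and fin: "finite_spec (chain_spec (universe \<S>) lt)" by blast
  show "finite_spec (spec L ar \<S>)"
    unfolding finite_spec_def spec_def big_ramsey_degree_finite_iff
  proof (intro allI impI)
    fix n :: nat assume n: "n \<ge> 1"
    then obtain t where t: "t > 0"
      "ramsey_bound {()} (\<lambda>_. 2) (finite_chain n) (chain_struct (universe \<S>) lt) t"
      using fin unfolding finite_spec_def chain_spec_def big_ramsey_degree_finite_iff by blast
    have "ramsey_bound L ar (nth_substructure \<S> n) \<S> (t * n ^ n)"
      by (rule ramsey_bound_of_chain[OF inf lin ch t(2)])
    then show "\<exists>t>0. ramsey_bound L ar (nth_substructure \<S> n) \<S> t"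
      by (intro exI[of _ "t * n ^ n"] conjI) (use t(1) n in simp_all)
  qed
qed

end
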